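(* Let $G=S_n^+\subset U_n^+$ be the quantum permutation group, and let $U\in U_n$. The discrete group $\Gamma_U$ associated to $G$ and $U$ is the group generated by elements $g_1,\ldots,g_n$ with the relations $$\begin{cases} g_i=1&\text{if } c_i\neq 0\\ g_ig_j=1&\text{if } c_{ij}\neq 0\\ g_ig_j=g_k&\text{if } d_{ijk}\neq 0 \end{cases}$$ for $i,j,k\in\{1,\ldots,n\}$, where $c_i=\sum_lU_{il}$, $c_{ij}=\sum_lU_{il}U_{jl}$, $d_{ijk}=\sum_l\bar{U}_{il}\bar{U}_{jl}U_{kl}$.
   Context: $C(U_n^+)$ is the universal $C^*$-algebra generated by $u_{ij}$, $i,j=1,\ldots,n$, with the relations making $u=(u_{ij})$ and $u^t=(u_{ji})$ unitary, with comultiplication $\Delta(u_{ij})=\sum_ku_{ik}\otimes u_{kj}$. A closed subgroup $G\subset U_n^+$ is given by a surjective morphism of Hopf $C^*$-algebras $C(U_n^+)\to C(G)$ (full and reduced versions being identified; here full versions are meant), and the images of the generators are still denoted $u_{ij}$. For $U$ in the group $U_n$ of unitary $n\times n$ scalar matrices, set $v=UuU^*$; the quotient $C(G)/\langle v_{ij}=0,\ \forall\, i\neq j\rangle$ is cocommutative, generated by the group-like elements $g_i=v_{ii}$, and $\Gamma_U=\langle g_1,\ldots,g_n\rangle$ is the discrete group defined by $C^*(\Gamma_U)=C(G)/\langle v_{ij}=0,\ \forall\, i\neq j\rangle$. The quantum permutation group $S_n^+$ is the closed subgroup of $U_n^+$ for which $C(S_n^+)$ is the universal $C^*$-algebra generated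 by projections $u_{ij}$, $i,j=1,\ldots,n$, summing to $1$ on each row and each column of $u=(u_{ij})$. *)

theory Defs
  imports
    "HOL-Analysis.Cartesian_Space"
    "HOL-Algebra.QuotRing"
    "HOL-Algebra.Module"
    "HOL-Algebra.Generated_Groups"
begin

section \<open>Complex *-algebras, C*-seminorms, quotients and completions\<close>

text \<open>
  The library has no C*-algebras given by carrier sets. Unital complex *-algebras are encoded by
  extending the library record of modules by an involution, and then by a norm.
\<close>

record 'a star_alg = "(complex, 'a) module" +
  adj :: "'a \<Rightarrow> 'a"

record 'a normed_star_alg = "'a star_alg" +
  nrm :: "'a \<Rightarrow> real"

definition cstar_seminorm :: "('a, 'm) star_alg_scheme \<Rightarrow> ('a \<Rightarrow> real) \<Rightarrow> bool" where
  "cstar_seminorm A p \<longleftrightarrow>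
     (\<forall>x\<in>carrier A. 0 \<le> p x) \<and>
     (\<forall>x\<in>carrier A. \<forall>y\<in>carrier A. p (x \<oplus>\<^bsub>A\<^esub> y) \<le> p x + p y) \<and>
     (\<forall>c. \<forall>x\<in>carrier A. p (c \<odot>\<^bsub>A\<^esub> x) = cmod c * p x) \<and>
     (\<forall>x\<in>carrier A. \<forall>y\<in>carrier A. p (x \<otimes>\<^bsub>A\<^esub> y) \<le> p x * p y) \<and>
     (\<forall>x\<in>carrier A. p (adj A x \<otimes>\<^bsub>A\<^esub> x) = (p x)\<^sup>2)"

definition star_iso ::
  "('a, 'm) star_alg_scheme \<Rightarrow> ('b, 'k) star_alg_scheme \<Rightarrow> ('a \<Rightarrow> 'b) set" where
  "star_iso A B = {\<phi> \<in> ring_iso A B.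
     (\<forall>c. \<forall>x\<in>carrier A. \<phi> (c \<odot>\<^bsub>A\<^esub> x) = c \<odot>\<^bsub>B\<^esub> \<phi> x) \<and>
     (\<forall>x\<in>carrier A. \<phi> (adj A x) = adj B (\<phi> x))}"

text \<open>Quotient by a *-ideal, with the quotient norm; the elements are the cosets.\<close>

definition quotient_alg ::
  "('a, 'm) normed_star_alg_scheme \<Rightarrow> 'a set \<Rightarrow> 'a set normed_star_alg" where
  "quotient_alg A J =
     \<lparr>carrier = carrier (A Quot J),
      mult = mult (A Quot J),
      one = one (A Quot J),
      zero = zero (A Quot J),
      add = add (A Quot J),
      smult = (\<lambda>c X. \<Union>x\<in>X. J +>\<^bsub>A\<^esub> (c \<odot>\<^bsub>A\<^esub> x)),
      adj = (\<lambda>X. \<Union>x\<in>X. J +>\<^bsub>A\<^esub> adj A x),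
      nrm = (\<lambda>X. INF x\<in>X. nrm A x)\<rparr>"

definition closed_star_ideal :: "('a, 'm) normed_star_alg_scheme \<Rightarrow> 'a set \<Rightarrow> bool" where
  "closed_star_ideal A J \<longleftrightarrow>
     ideal J A \<and> (\<forall>x\<in>J. adj A x \<in> J) \<and>
     (\<forall>x\<in>carrier A. (\<forall>e>0. \<exists>y\<in>J. nrm A (x \<ominus>\<^bsub>A\<^esub> y) < e) \<longrightarrow> x \<in> J)"

definition generated_ideal :: "('a, 'm) normed_star_alg_scheme \<Rightarrow> 'a set \<Rightarrow> 'a set" where
  "generated_ideal A S = \<Inter> {J. closed_star_ideal A J \<and> S \<subseteq> J}"

text \<open>
  The Hausdorff completion of a *-algebra for a C*-seminorm: Cauchy sequences modulo null
  sequences. All representatives of a class have the same limit norm, so the quotient norm is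
  that limit.
\<close>

definition cauchy_alg ::
  "('a, 'm) star_alg_scheme \<Rightarrow> ('a \<Rightarrow> real) \<Rightarrow> (nat \<Rightarrow> 'a) normed_star_alg" where
  "cauchy_alg A p =
     \<lparr>carrier = {s. (\<forall>k. s k \<in> carrier A) \<and>
        (\<forall>e>0. \<exists>N. \<forall>m\<ge>N. \<forall>k\<ge>N. p (s m \<ominus>\<^bsub>A\<^esub> s k) < e)},
      mult = (\<lambda>s t k. s k \<otimes>\<^bsub>A\<^esub> t k),
      one = (\<lambda>k. \<one>\<^bsub>A\<^esub>),
      zero = (\<lambda>k. \<zero>\<^bsub>A\<^esub>),
      add = (\<lambda>s t k. s k \<oplus>\<^bsub>A\<^esub> t k),
      smult = (\<lambda>c s k. c \<odot>\<^bsub>A\<^esub> s k),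
      adj = (\<lambda>s k. adj A (s k)),
      nrm = (\<lambda>s. lim (\<lambda>k. p (s k)))\<rparr>"

definition null_seqs :: "('a, 'm) star_alg_scheme \<Rightarrow> ('a \<Rightarrow> real) \<Rightarrow> (nat \<Rightarrow> 'a) set" where
  "null_seqs A p = {s \<in> carrier (cauchy_alg A p). (\<lambda>k. p (s k)) \<longlonglongrightarrow> 0}"

text \<open>
  The universal C*-algebra of the *-algebra \<open>A\<close> subject to the relations \<open>r = 0\<close>, \<open>r \<in> R\<close>: the
  completion of \<open>A\<close> for the largest C*-seminorm vanishing on \<open>R\<close>. The functions
  \<open>x \<mapsto> \<parallel>\<pi> x\<parallel>\<close>, for unital *-homomorphisms \<open>\<pi>\<close> of \<open>A\<close> into (possibly zero) C*-algebras
  killing \<open>R\<close>, are exactly the C*-seminorms vanishing on \<open>R\<close>, so the supremum is the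
  usual one over all representations of the relations. It is only
  meaningful when it is finite, as it is in both uses below (generators that are projections,
  respectively unitaries).
\<close>

definition universal_seminorm :: "('a, 'm) star_alg_scheme \<Rightarrow> 'a set \<Rightarrow> 'a \<Rightarrow> real" where
  "universal_seminorm A R x = (SUP p \<in> {p. cstar_seminorm A p \<and> (\<forall>r\<in>R. p r = 0)}. p x)"

definition universal_cstar ::
  "('a, 'm) star_alg_scheme \<Rightarrow> 'a set \<Rightarrow> (nat \<Rightarrow> 'a) set normed_star_alg" where
  "universal_cstar A R =
     quotient_alg (cauchy_alg A (universal_seminorm A R)) (null_seqs A (universal_seminorm A R))"

definition universal_emb ::
  "('a, 'm) star_alg_scheme \<Rightarrow> 'a set \<Rightarrow> 'a \<Rightarrow> (nat \<Rightarrow> 'a) set" where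
  "universal_emb A R x =
     null_seqs A (universal_seminorm A R) +>\<^bsub>cauchy_alg A (universal_seminorm A R)\<^esub> (\<lambda>k. x)"


section \<open>Monoid *-algebras, free *-algebras and group C*-algebras\<close>

text \<open>
  The *-algebra of a monoid \<open>M\<close> with an involutive antiautomorphism \<open>\<iota>\<close>: finitely supported
  functions with convolution and \<open>f\<^sup>*(x) = cnj (f (\<iota> x))\<close>.
\<close>

definition monoid_alg ::
  "('a, 'm) monoid_scheme \<Rightarrow> ('a \<Rightarrow> 'a) \<Rightarrow> ('a \<Rightarrow> complex) star_alg" where
  "monoid_alg M \<iota> =
     \<lparr>carrier = {f. finite {x. f x \<noteq> 0} \<and> {x. f x \<noteq> 0} \<subseteq> carrier M},
      mult = (\<lambda>f g z. \<Sum>(x, y) \<in> {(x, y). f x \<noteq> 0 \<and> g y \<noteq> 0 \<and> x \<otimes>\<^bsub>M\<^esub> y = z}. f x * g y),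
      one = (\<lambda>x. if x = \<one>\<^bsub>M\<^esub> then 1 else 0),
      zero = (\<lambda>x. 0),
      add = (\<lambda>f g x. f x + g x),
      smult = (\<lambda>c f x. c * f x),
      adj = (\<lambda>f x. if x \<in> carrier M then cnj (f (\<iota> x)) else 0)\<rparr>"

definition basis_elem :: "'a \<Rightarrow> 'a \<Rightarrow> complex" where
  "basis_elem a = (\<lambda>x. if x = a then 1 else 0)"

text \<open>
  Words in letters \<open>x\<close> (encoded as \<open>(x, False)\<close>) and formal adjoints or inverses of letters
  (encoded as \<open>(x, True)\<close>).
\<close>

type_synonym 'x word = "('x \<times> bool) list"

definition word_monoid :: "'x word monoid" where
  "word_monoid = \<lparr>carrier = UNIV, mult = (@), one = []\<rparr>"

definition word_inv :: "'x word \<Rightarrow> 'x word" where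
  "word_inv w = rev (map (\<lambda>(x, b). (x, \<not> b)) w)"

definition free_star_alg :: "('x word \<Rightarrow> complex) star_alg" where
  "free_star_alg = monoid_alg word_monoid word_inv"

definition indet :: "'x \<Rightarrow> 'x word \<Rightarrow> complex" where
  "indet x = basis_elem [(x, False)]"

text \<open>The full group C*-algebra and its canonical unitaries.\<close>

definition group_cstar :: "('g, 'm) monoid_scheme \<Rightarrow> (nat \<Rightarrow> 'g \<Rightarrow> complex) set normed_star_alg" where
  "group_cstar \<Gamma> = universal_cstar (monoid_alg \<Gamma> (m_inv \<Gamma>)) {}"

definition group_cstar_elem :: "('g, 'm) monoid_scheme \<Rightarrow> 'g \<Rightarrow> (nat \<Rightarrow> 'g \<Rightarrow> complex) set" where
  "group_cstar_elem \<Gamma> x = universal_emb (monoid_alg \<Gamma> (m_inv \<Gamma>)) {} (basis_elem x)"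


section \<open>The discrete group attached to a closed subgroup and a unitary matrix\<close>

definition unitary_matrix :: "complex ^ 'n ^ 'n \<Rightarrow> bool" where
  "unitary_matrix U \<longleftrightarrow>
     (let V = (\<chi> i j. cnj (U $ j $ i)) in U ** V = mat 1 \<and> V ** U = mat 1)"

text \<open>
  In the next three definitions, \<open>A = C(G)\<close> and \<open>u\<close> is its matrix of generators.
  The first one gives the entries of \<open>v = U u U\<^sup>*\<close>.
\<close>

definition conj_coeff ::
  "('a, 'm) normed_star_alg_scheme \<Rightarrow> ('n::finite \<Rightarrow> 'n \<Rightarrow> 'a) \<Rightarrow> complex ^ 'n ^ 'n \<Rightarrow> 'n \<Rightarrow> 'n \<Rightarrow> 'a"
where
  "conj_coeff A u U i j =
     (\<Oplus>\<^bsub>A\<^esub>k\<in>UNIV. \<Oplus>\<^bsub>A\<^esub>l\<in>UNIV. (U $ i $ k * cnj (U $ j $ l)) \<odot>\<^bsub>A\<^esub> u k l)"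

definition diag_ideal ::
  "('a, 'm) normed_star_alg_scheme \<Rightarrow> ('n::finite \<Rightarrow> 'n \<Rightarrow> 'a) \<Rightarrow> complex ^ 'n ^ 'n \<Rightarrow> 'a set" where
  "diag_ideal A u U = generated_ideal A {conj_coeff A u U i j | i j. i \<noteq> j}"

text \<open>
  \<open>(\<Gamma>, g)\<close> is the group \<open>\<Gamma>\<^sub>U\<close> with its generators:
  \<open>C\<^sup>*(\<Gamma>)\<close> is the quotient of \<open>A\<close> by the relations \<open>v\<^sub>i\<^sub>j = 0\<close> (\<open>i \<noteq> j\<close>), with \<open>g\<^sub>i = v\<^sub>i\<^sub>i\<close>.
  Compatibility with the comultiplications is automatic, since it can be checked on the
  \<open>g\<^sub>i\<close>, which are group-like on both sides.
\<close>

definition is_diag_group ::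
  "('a, 'm) normed_star_alg_scheme \<Rightarrow> ('n::finite \<Rightarrow> 'n \<Rightarrow> 'a) \<Rightarrow> complex ^ 'n ^ 'n \<Rightarrow>
   ('g, 'k) monoid_scheme \<Rightarrow> ('n \<Rightarrow> 'g) \<Rightarrow> bool" where
  "is_diag_group A u U \<Gamma> g \<longleftrightarrow>
     group \<Gamma> \<and> range g \<subseteq> carrier \<Gamma> \<and> generate \<Gamma> (range g) = carrier \<Gamma> \<and>
     (\<exists>\<phi> \<in> star_iso (group_cstar \<Gamma>) (quotient_alg A (diag_ideal A u U)).
        \<forall>i. \<phi> (group_cstar_elem \<Gamma> (g i)) = diag_ideal A u U +>\<^bsub>A\<^esub> conj_coeff A u U i i)"


section \<open>The quantum permutation group\<close>

text \<open>Left-hand sides of the relations: projections, with sum 1 on each row and each column.\<close>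

definition magic_relations :: "(('n::finite \<times> 'n) word \<Rightarrow> complex) set" where
  "magic_relations =
     (let F = free_star_alg; x = (\<lambda>i j. indet (i, j)) in
      {x i j \<ominus>\<^bsub>F\<^esub> adj F (x i j) | i j. True} \<union>
      {x i j \<otimes>\<^bsub>F\<^esub> x i j \<ominus>\<^bsub>F\<^esub> x i j | i j. True} \<union>
      {(\<Oplus>\<^bsub>F\<^esub>j\<in>UNIV. x i j) \<ominus>\<^bsub>F\<^esub> \<one>\<^bsub>F\<^esub> | i. True} \<union>
      {(\<Oplus>\<^bsub>F\<^esub>i\<in>UNIV. x i j) \<ominus>\<^bsub>F\<^esub> \<one>\<^bsub>F\<^esub> | j. True})"

definition quantum_perm_alg :: "(nat \<Rightarrow> ('n::finite \<times> 'n) word \<Rightarrow> complex) set normed_star_alg" where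
  "quantum_perm_alg = universal_cstar free_star_alg magic_relations"

definition quantum_perm_gen ::
  "'n::finite \<Rightarrow> 'n \<Rightarrow> (nat \<Rightarrow> ('n \<times> 'n) word \<Rightarrow> complex) set" where
  "quantum_perm_gen i j = universal_emb free_star_alg magic_relations (indet (i, j))"


section \<open>Groups given by generators and relations\<close>

text \<open>Words modulo the least congruence containing \<open>R\<close> and making the letters invertible.\<close>

inductive_set word_congruence :: "('x word \<times> 'x word) set \<Rightarrow> ('x word \<times> 'x word) set"
  for R where
  refl: "(w, w) \<in> word_congruence R"
| sym: "(v, w) \<in> word_congruence R \<Longrightarrow> (w, v) \<in> word_congruence R"
| trans: "(v, w) \<in> word_congruence R \<Longrightarrow> (w, z) \<in> word_congruence R \<Longrightarrow> (v, z) \<in> word_congruence R"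
| append: "(v, w) \<in> word_congruence R \<Longrightarrow> (v', w') \<in> word_congruence R \<Longrightarrow>
           (v @ v', w @ w') \<in> word_congruence R"
| cancel: "([(x, b), (x, \<not> b)], []) \<in> word_congruence R"
| rel: "(v, w) \<in> R \<Longrightarrow> (v, w) \<in> word_congruence R"

definition presented_group :: "('x word \<times> 'x word) set \<Rightarrow> 'x word set monoid" where
  "presented_group R =
     \<lparr>carrier = UNIV // word_congruence R,
      mult = (\<lambda>X Y. \<Union>v\<in>X. \<Union>w\<in>Y. word_congruence R `` {v @ w}),
      one = word_congruence R `` {[]}\<rparr>"

definition presented_gen :: "('x word \<times> 'x word) set \<Rightarrow> 'x \<Rightarrow> 'x word set" where
  "presented_gen R x = word_congruence R `` {[(x, False)]}"

definition diag_relations :: "complex ^ 'n ^ 'n \<Rightarrow> ('n word \<times> 'n word) set" where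
  "diag_relations U =
     (let g = (\<lambda>i. (i, False));
          c1 = (\<lambda>i. \<Sum>l\<in>UNIV. U $ i $ l);
          c2 = (\<lambda>i j. \<Sum>l\<in>UNIV. U $ i $ l * U $ j $ l);
          d = (\<lambda>i j k. \<Sum>l\<in>UNIV. cnj (U $ i $ l) * cnj (U $ j $ l) * U $ k $ l)
      in {([g i], []) | i. c1 i \<noteq> 0} \<union>
         {([g i, g j], []) | i j. c2 i j \<noteq> 0} \<union>
         {([g i, g j], [g k]) | i j k. d i j k \<noteq> 0})"

end

theory Submission
  imports Defs "HOL-Computational_Algebra.Polynomial"
begin

text \<open>
  Let \<open>e\<^sub>1, \<dots>, e\<^sub>n\<close> be the standard basis of the algebra \<open>\<complex>\<^sup>n\<close>. If \<open>u\<close> is magic with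
  orthogonal entries in each row, then \<open>e\<^sub>l \<mapsto> \<Sum>\<^sub>k e\<^sub>k \<otimes> u\<^sub>k\<^sub>l\<close> is a unital star homomorphism, and
  conversely, up to the condition that the columns have sum \<open>1\<close>. If \<open>U u U\<^sup>*\<close> is diagonal with entries \<open>g\<^sub>i\<close>,
  then this map is diagonal in the orthonormal basis \<open>f\<^sub>i = \<Sum>\<^sub>l cnj U\<^sub>i\<^sub>l e\<^sub>l\<close>, namely
  \<open>f\<^sub>i \<mapsto> f\<^sub>i \<otimes> g\<^sub>i\<close>. In this basis \<open>1 = \<Sum>\<^sub>i c\<^sub>i f\<^sub>i\<close>, \<open>f\<^sub>i\<^sup>* = \<Sum>\<^sub>j c\<^sub>i\<^sub>j f\<^sub>j\<close> and \<open>f\<^sub>i f\<^sub>j = \<Sum>\<^sub>k d\<^sub>i\<^sub>j\<^sub>k f\<^sub>k\<close>, so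
  compatibility with the unit, the adjoint and the product says that \<open>g\<^sub>i = 1\<close> if \<open>c\<^sub>i \<noteq> 0\<close>,
  \<open>g\<^sub>i\<^sup>* = g\<^sub>j\<close> if \<open>c\<^sub>i\<^sub>j \<noteq> 0\<close>, and \<open>g\<^sub>i g\<^sub>j = g\<^sub>k\<close> if \<open>d\<^sub>i\<^sub>j\<^sub>k \<noteq> 0\<close>; the first family also
  takes care of the columns. The two directions are the locales
  \<open>diagonal_magic\<close> and \<open>diag_unitaries\<close>; they identify the quotient with \<open>\<complex>[P]\<close>, for the presented group
  \<open>P\<close>, on the level of star algebras.

  The passage to C*-algebras is \<open>completion_quotient_iso\<close>: completing a quotient star algebra in the
  quotient seminorm is the same as dividing the completion by the closed ideal generated by the
  kernel. To apply it, the quotient seminorm must be the full norm of \<open>\<complex>[P]\<close>, and the crucial point is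
  that the quotient of a C*-seminorm by a star ideal satisfies the C*-identity
  (\<open>quotient_cstar_seminorm\<close>). This needs approximate units of the ideal. They are polynomials in a
  self-adjoint element, obtained from an approximate square root \<open>sqrt (1 - h\<^sup>2)\<close> computed by
  iteration (\<open>approximate_sqrt\<close>, \<open>approximate_unit\<close>), so that the whole argument takes place in the
  dense star algebras. The same square roots show that projections with sum \<open>1\<close> are orthogonal
  (\<open>projections_sum_one_orthogonal\<close>), which is where the norm of \<open>C(S\<^sub>n\<^sup>+)\<close> enters the computations above.

  For the uniqueness of the group, note that \<open>\<Gamma> \<rightarrow> C\<^sup>*(\<Gamma>)\<close> is injective, by the regular representation
  (\<open>op_norm_faithful\<close>). Hence an equation between words in the generators holds in \<open>\<Gamma>\<close> if and only if
  it holds in the quotient algebra, and this condition is the same for \<open>P\<close>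
  (\<open>diag_group_word_eq_iff\<close>).
\<close>

section \<open>C*-seminorms on polynomials in one self-adjoint variable\<close>

abbreviation poly_adj :: "complex poly \<Rightarrow> complex poly" where
  "poly_adj \<equiv> map_poly cnj"

lemma poly_adj_mult: "poly_adj (f * g) = poly_adj f * poly_adj g"
  by (intro poly_eqI) (simp add: coeff_mult coeff_map_poly)

lemma poly_adj_add: "poly_adj (f + g) = poly_adj f + poly_adj g"
  by (intro poly_eqI) (simp add: coeff_map_poly)

lemma poly_adj_diff: "poly_adj (f - g) = poly_adj f - poly_adj g"
  by (intro poly_eqI) (simp add: coeff_map_poly)

lemma poly_adj_smult: "poly_adj (smult c f) = smult (cnj c) (poly_adj f)"
  by (intro poly_eqI) (simp add: coeff_map_poly)

lemma poly_adj_adj: "poly_adj (poly_adj f) = f"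
  by (intro poly_eqI) (simp add: coeff_map_poly)

lemma poly_adj_1: "poly_adj 1 = 1"
  by simp

lemmas poly_adj_simps =
  poly_adj_mult poly_adj_add poly_adj_diff poly_adj_smult poly_adj_adj poly_adj_1

lemma smult_2: "Polynomial.smult 2 f = f * 2" for f :: "complex poly"
  using smult_add_left[of 1 1 f] by (simp add: mult_2_right)

text \<open>
  The norm of a polynomial in a self-adjoint element of a C*-algebra is such a seminorm. Estimates
  inside the polynomial ring take the place of the continuous functional calculus.
\<close>

locale poly_cstar_seminorm =
  fixes N :: "complex poly \<Rightarrow> real"
  assumes nonneg: "0 \<le> N f"
    and triangle: "N (f + g) \<le> N f + N g"
    and smult: "N (Polynomial.smult c f) = cmod c * N f"
    and submult: "N (f * g) \<le> N f * N g"
    and cstar: "N (poly_adj f * f) = (N f)\<^sup>2"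
begin

lemma zero: "N 0 = 0"
  using smult[of 0 0] by simp

lemma minus: "N (- f) = N f"
  using smult[of "-1" f] by simp

lemma diff: "N (f - g) \<le> N f + N g"
  using triangle[of f "- g"] by (simp add: minus)

lemma one_le: "N 1 \<le> 1"
proof -
  have "N 1 = (N 1)\<^sup>2" using cstar[of 1] by simp
  then have "N 1 = 0 \<or> N 1 = 1" by (simp add: power2_eq_square)
  then show ?thesis by auto
qed

lemma le_adj: "N f \<le> N (poly_adj f)"
proof (cases "N f = 0")
  case False
  then have "0 < N f" using nonneg[of f] by simp
  moreover have "N f * N f \<le> N (poly_adj f) * N f"
    using cstar[of f] submult[of "poly_adj f" f] by (simp add: power2_eq_square)
  ultimately show ?thesis by simp
qed (simp add: nonneg)

lemma adj: "N (poly_adj f) = N f"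
  using le_adj[of f] le_adj[of "poly_adj f"] by (simp add: poly_adj_adj)

lemma power: "N (f ^ n) \<le> N f ^ n"
proof (induction n)
  case (Suc n)
  then show ?case
    using submult[of f "f ^ n"] mult_left_mono[OF Suc nonneg[of f]] by simp
qed (simp add: one_le)

text \<open>
  Write \<open>1 - a = (1 - y)\<^sup>2\<close>, that is \<open>y = (a + y\<^sup>2) / 2\<close>, and iterate. If \<open>\<parallel>a\<parallel> \<le> 2r - r\<^sup>2\<close>
  with \<open>r < 1\<close>, then all iterates stay in the ball of radius \<open>r\<close>, where the iteration contracts
  by the factor \<open>r\<close>; the defect \<open>(1 - y)\<^sup>2 - (1 - a)\<close> is twice the length of the next step.
\<close>
lemma approximate_sqrt:
  assumes sa: "poly_adj a = a" and a: "N a < 1" and \<delta>: "0 < \<delta>"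
  shows "\<exists>y. poly_adj y = y \<and> a dvd y \<and> N ((1 - y)\<^sup>2 - (1 - a)) \<le> \<delta>"
proof -
  \<comment> \<open>the smaller solution of \<open>r = (N a + r\<^sup>2) / 2\<close>\<close>
  define r where "r = 1 - sqrt (1 - N a)"
  have r0: "0 \<le> r" using nonneg[of a] a by (simp add: r_def)
  have r1: "r < 1" using a by (simp add: r_def)
  have ra: "N a = 2 * r - r\<^sup>2"
  proof -
    have "(1 - r)\<^sup>2 = 1 - N a" using a by (simp add: r_def)
    then show ?thesis by (simp add: power2_eq_square algebra_simps)
  qed
  define Y where "Y = rec_nat 0 (\<lambda>_ y. Polynomial.smult (1/2) (a + y\<^sup>2))"
  have Y0: "Y 0 = 0" and YS: "Y (Suc n) = Polynomial.smult (1/2) (a + (Y n)\<^sup>2)" for n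
    by (simp_all add: Y_def)
  have Ysa: "poly_adj (Y n) = Y n" for n
    by (induction n) (simp_all add: Y0 YS poly_adj_simps power2_eq_square sa)
  have Ydvd: "a dvd Y n" for n
    by (induction n) (simp_all add: Y0 YS dvd_smult power2_eq_square)
  have Yr: "N (Y n) \<le> r" for n
  proof (induction n)
    case 0 then show ?case by (simp add: Y0 zero r0)
  next
    case (Suc n)
    have "N ((Y n)\<^sup>2) \<le> r\<^sup>2"
      using power[of "Y n" 2] power_mono[OF Suc nonneg, of 2] by linarith
    then have "N (Y (Suc n)) \<le> (N a + r\<^sup>2) / 2"
      using triangle[of a "(Y n)\<^sup>2"] by (simp add: YS smult)
    then show ?case using ra by simp
  qed
  have step: "N (Y (Suc n) - Y n) \<le> r ^ n * N (Y 1)" for n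
  proof (induction n)
    case 0 then show ?case by (simp add: Y0)
  next
    case (Suc n)
    have "Y (Suc (Suc n)) - Y (Suc n) =
        Polynomial.smult (1/2) ((Y (Suc n) + Y n) * (Y (Suc n) - Y n))"
      by (simp add: YS[of "Suc n"] YS[of n] smult_diff_right[symmetric] power2_eq_square algebra_simps)
    then have "N (Y (Suc (Suc n)) - Y (Suc n)) =
        N ((Y (Suc n) + Y n) * (Y (Suc n) - Y n)) / 2"
      by (simp add: smult)
    also have "\<dots> \<le> (N (Y (Suc n) + Y n) * N (Y (Suc n) - Y n)) / 2"
      using submult by (simp add: divide_right_mono)
    also have "\<dots> \<le> ((2 * r) * (r ^ n * N (Y 1))) / 2"
      using triangle[of "Y (Suc n)" "Y n"] Yr[of n] Yr[of "Suc n"] r0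
      by (intro divide_right_mono mult_mono Suc) (auto simp: nonneg)
    finally show ?case by simp
  qed
  have "(\<lambda>n. 2 * (r ^ n * N (Y 1))) \<longlonglongrightarrow> 2 * (0 * N (Y 1))"
    by (intro tendsto_intros LIMSEQ_power_zero) (use r0 r1 in auto)
  then have "eventually (\<lambda>n. 2 * (r ^ n * N (Y 1)) < \<delta>) sequentially"
    using \<delta> by (intro order_tendstoD) auto
  then obtain n where n: "2 * (r ^ n * N (Y 1)) < \<delta>"
    by (auto simp: eventually_sequentially)
  have "(1 - Y n)\<^sup>2 - (1 - a) = Polynomial.smult 2 (Y (Suc n) - Y n)"
    unfolding YS smult_diff_right by (simp add: power2_eq_square algebra_simps smult_2)
  then have "N ((1 - Y n)\<^sup>2 - (1 - a)) \<le> \<delta>"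
    using step[of n] n by (simp add: smult)
  then show ?thesis using Ysa Ydvd by blast
qed

lemma norm_real_imaginary:
  assumes "poly_adj f = f" "poly_adj g = g"
  shows "(N (f + Polynomial.smult \<i> g))\<^sup>2 = N (f\<^sup>2 + g\<^sup>2)"
proof -
  have "poly_adj (f + Polynomial.smult \<i> g) * (f + Polynomial.smult \<i> g) = f\<^sup>2 + g\<^sup>2"
    by (simp add: poly_adj_simps assms power2_eq_square algebra_simps)
  then show ?thesis using cstar[of "f + Polynomial.smult \<i> g"] by simp
qed

text \<open>
  The evaluation at the variable \<open>X = h\<close> will send a \<open>c\<close> as below to \<open>1 - e\<close>, where \<open>e\<close> is an
  approximate unit for an ideal containing \<open>h\<close>. For \<open>h\<close> of norm \<open>< 1\<close> write \<open>h = cos \<theta>\<close> and let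
  \<open>v = h + \<i> sqrt (1 - h\<^sup>2)\<close>, an approximate unitary with value \<open>\<i>\<close> at \<open>h = 0\<close>. For the
  unitary \<open>z = - v\<^sup>2\<close>, with value \<open>1\<close> at \<open>h = 0\<close>, the average \<open>f\<close> of its first \<open>m\<close> powers is
  contractive, and \<open>2 h v f = (1 - z) f = (1 - z\<^sup>m) / m\<close> is small. Take \<open>c = - \<i> v f\<close>.
\<close>
lemma approximate_unit:
  assumes e: "0 < e"
  shows "\<exists>c. poly c 0 = 1 \<and> N c \<le> 1 + e \<and> N ([:0, 1:] * c) \<le> e"
proof -
  define X :: "complex poly" where "X = [:0, 1:]"
  \<comment> \<open>rescale to norm less than \<open>1\<close>, so that the square root exists\<close>
  define s where "s = N X + 1"
  have s: "s \<ge> 1" using nonneg[of X] by (simp add: s_def)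
  define h where "h = Polynomial.smult (1 / complex_of_real s) X"
  have hsa: "poly_adj h = h" by (simp add: h_def X_def map_poly_pCons)
  have Nh: "N h < 1" using s by (simp add: h_def smult norm_divide) (simp add: s_def)
  have h0: "poly h 0 = 0" by (simp add: h_def X_def)
  have Xh: "X = Polynomial.smult (complex_of_real s) h" using s by (simp add: h_def)
  have Na: "N (h\<^sup>2) < 1"
    using power[of h 2] power_strict_mono[OF Nh nonneg, of 2] by simp
  obtain m :: nat where m: "2 * s * 3 / e < real m"
    using reals_Archimedean2 by blast
  have "0 < 2 * s * 3 / e" using e s by simp
  then have m0: "0 < m" using m by linarith
  have "((\<lambda>\<delta>. (1 + \<delta>) ^ Suc m) \<longlongrightarrow> (1 + 0) ^ Suc m) (at_right (0::real))"
    by (intro tendsto_intros)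
  then have "eventually (\<lambda>\<delta>. (1 + \<delta>) ^ Suc m < 1 + min e 1) (at_right (0::real))"
    using e by (intro order_tendstoD) auto
  moreover have "eventually (\<lambda>\<delta>. \<delta> < e / (4 * s)) (at_right (0::real))"
    using e s by (intro order_tendstoD(2)[OF tendsto_ident_at]) auto
  moreover have "eventually (\<lambda>\<delta>. 0 < \<delta>) (at_right (0::real))"
    by (rule eventually_at_right_less)
  ultimately have "eventually (\<lambda>\<delta>. (1 + \<delta>) ^ Suc m < 1 + min e 1 \<and> \<delta> < e / (4 * s) \<and> 0 < \<delta>) (at_right (0::real))"
    by eventually_elim auto
  then obtain \<delta> :: real where \<delta>: "(1 + \<delta>) ^ Suc m < 1 + min e 1" "\<delta> < e / (4 * s)" "0 < \<delta>"
    using eventually_happens'[OF trivial_limit_at_right_real] by blast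
  obtain y where y: "poly_adj y = y" "h\<^sup>2 dvd y" "N ((1 - y)\<^sup>2 - (1 - h\<^sup>2)) \<le> \<delta>"
    using approximate_sqrt[of "h\<^sup>2" \<delta>] Na \<delta> by (auto simp: poly_adj_simps power2_eq_square hsa)
  define d where "d = (1 - y)\<^sup>2 - (1 - h\<^sup>2)"
  define v where "v = h + Polynomial.smult \<i> (1 - y)"
  \<comment> \<open>the adjoint of \<open>v\<close>\<close>
  define w where "w = h - Polynomial.smult \<i> (1 - y)"
  have wv: "w * v = 1 + d" "v + w = 2 * h"
    by (simp_all add: w_def v_def d_def power2_eq_square algebra_simps)
  have y0: "poly y 0 = 0" using y(2) h0 by (auto elim!: dvdE simp: power2_eq_square)
  have Nv2: "(N v)\<^sup>2 \<le> 1 + \<delta>"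
  proof -
    have "(N v)\<^sup>2 = N (1 + d)"
      unfolding v_def by (subst norm_real_imaginary)
        (simp_all add: hsa y poly_adj_simps d_def algebra_simps)
    also have "\<dots> \<le> 1 + \<delta>" using triangle[of 1 d] one_le y(3) by (simp add: d_def)
    finally show ?thesis .
  qed
  have Nv: "N v \<le> 1 + \<delta>"
  proof -
    have "(N v)\<^sup>2 \<le> (1 + \<delta>)\<^sup>2" using Nv2 \<delta>(3) zero_le_power2[of \<delta>] unfolding power2_sum one_power2 mult_1_right by linarith
    then show ?thesis using \<delta>(3) by (simp add: power2_le_iff_abs_le)
  qed
  define z where "z = - (v\<^sup>2)"
  have p1: "(1 + \<delta>) ^ m \<le> 2"
  proof -
    have "(1 + \<delta>) ^ m \<le> (1 + \<delta>) ^ Suc m" using \<delta>(3) by (intro power_increasing) auto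
    then show ?thesis using \<delta>(1) by linarith
  qed
  have Nzk: "N (z ^ k) \<le> (1 + \<delta>) ^ k" for k
  proof -
    have "N z \<le> 1 + \<delta>" using power[of v 2] Nv2 by (simp add: z_def minus)
    then show ?thesis using power[of z k] power_mono[OF _ nonneg, of z "1 + \<delta>" k] by linarith
  qed
  define f where "f = Polynomial.smult (1 / of_nat m) (\<Sum>k<m. z ^ k)"
  define c where "c = Polynomial.smult (- \<i>) (v * f)"
  have Nzm: "N (z ^ k) \<le> (1 + \<delta>) ^ m" if "k \<le> m" for k
    by (rule order_trans[OF Nzk power_increasing[OF that]]) (use \<delta>(3) in simp)
  have Nsum: "N (\<Sum>k\<in>K. g k) \<le> (\<Sum>k\<in>K. N (g k))" if "finite K" for K and g :: "nat \<Rightarrow> complex poly"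
    using that by (induction K) (auto simp: zero intro: order_trans[OF triangle])
  have Nf: "N f \<le> (1 + \<delta>) ^ m"
  proof -
    have "N f = N (\<Sum>k<m. z ^ k) / m" using m0 by (simp add: f_def smult norm_divide)
    also have "\<dots> \<le> (\<Sum>k<m. (1 + \<delta>) ^ m) / m"
      by (intro divide_right_mono order_trans[OF Nsum sum_mono] Nzm) auto
    finally show ?thesis using m0 by simp
  qed
  have Nvf: "N (v * f) \<le> (1 + \<delta>) ^ Suc m"
    using submult[of v f] mult_mono[OF Nv Nf] \<delta>(3) nonneg by (simp add: order_trans)
  have Nc: "N c = N (v * f)" by (simp add: c_def smult minus)
  have c0: "poly c 0 = 1"
    using m0 by (simp add: c_def f_def v_def z_def h0 y0 poly_sum power2_eq_square)
  have zf: "(1 - z) * f = Polynomial.smult (1 / of_nat m) (1 - z ^ m)"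
    by (simp add: f_def one_diff_power_eq)
  have "Polynomial.smult 2 (h * v * f) = (v + w) * v * f"
    unfolding wv(2) by (simp add: smult_2 algebra_simps)
  also have "\<dots> = (v * v + w * v) * f"
    by (simp add: algebra_simps)
  also have "\<dots> = (1 - z) * f + d * f"
    unfolding wv(1) by (simp add: z_def power2_eq_square algebra_simps)
  finally have hvf: "2 * N (h * v * f) = N (Polynomial.smult (1 / of_nat m) (1 - z ^ m) + d * f)"
    using smult[of 2 "h * v * f"] by (simp add: zf)
  also have "\<dots> \<le> (1 + (1 + \<delta>) ^ m) / m + \<delta> * (1 + \<delta>) ^ m"
  proof (intro order_trans[OF triangle] add_mono)
    show "N (Polynomial.smult (1 / of_nat m) (1 - z ^ m)) \<le> (1 + (1 + \<delta>) ^ m) / m"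
      using diff[of 1 "z ^ m"] one_le Nzm[of m] m0
      by (simp add: smult norm_divide divide_right_mono del: of_nat_Suc)
    show "N (d * f) \<le> \<delta> * (1 + \<delta>) ^ m"
      using submult[of d f] y(3) Nf \<delta>(3) nonneg
      by (intro order_trans[OF submult mult_mono]) (auto simp: d_def)
  qed
  also have "\<dots> \<le> 3 / m + \<delta> * 2"
    using p1 \<delta>(3) by (intro add_mono divide_right_mono mult_left_mono) auto
  also have "\<dots> \<le> e / (2 * s) + e / (2 * s)"
  proof (intro add_mono)
    show "3 / real m \<le> e / (2 * s)" using m m0 e s by (simp add: field_simps)
    show "\<delta> * 2 \<le> e / (2 * s)" using \<delta>(2) s by (simp add: field_simps)
  qed
  finally have "2 * N (h * v * f) \<le> e / s" using s by (simp add: field_simps)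
  moreover have "N (X * c) = s * N (h * v * f)"
    using s by (simp add: Xh c_def smult minus mult.assoc norm_mult)
  ultimately have "N (X * c) \<le> e" using s e by (simp add: field_simps)
  moreover have "N c \<le> 1 + e" using Nc Nvf \<delta>(1) by linarith
  ultimately show ?thesis using c0 unfolding X_def by blast
qed

text \<open>
  The two norm bounds say that \<open>b\<close> and \<open>- b\<close> are positive. Shifted by a small \<open>\<eta>\<close> and rescaled by
  \<open>r = 1 / (1 + \<eta>)\<close>, they have approximate square roots \<open>q\<^sub>1\<close> and \<open>q\<^sub>2\<close>, so that
  \<open>(q\<^sub>1 + \<i> q\<^sub>2)\<^sup>* (q\<^sub>1 + \<i> q\<^sub>2) = q\<^sub>1\<^sup>2 + q\<^sub>2\<^sup>2\<close> is of order \<open>\<eta>\<close>. Hence so is \<open>b\<close>, which is close to \<open>q\<^sub>1\<^sup>2\<close>.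
\<close>
lemma zero_if_pos_and_neg:
  assumes sa: "poly_adj b = b" and b: "N (1 - b) \<le> 1" "N (1 + b) \<le> 1"
  shows "N b = 0"
proof -
  have bound: "N b \<le> 6 * \<eta> * (1 + \<eta>)" if \<eta>: "0 < \<eta>" for \<eta> :: real
  proof -
    define r where "r = 1 / (1 + \<eta>)"
    have r: "0 < r" "r < 1" "r * (1 + \<eta>) = 1" using \<eta> by (simp_all add: r_def)
    have sqrt: "\<exists>q. poly_adj q = q \<and> N (q\<^sup>2 - Polynomial.smult (of_real r) (x + [:of_real \<eta>:])) \<le> \<eta>"
      if x: "poly_adj x = x" "N (1 - x) \<le> 1" for x
    proof -
      let ?a = "Polynomial.smult (of_real r) (1 - x)"
      have "N ?a \<le> r" using x r by (simp add: smult mult_left_le)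
      then obtain y where y: "poly_adj y = y" "N ((1 - y)\<^sup>2 - (1 - ?a)) \<le> \<eta>"
        using approximate_sqrt[of ?a \<eta>] r \<eta> x by (auto simp: poly_adj_simps)
      have "complex_of_real r * complex_of_real (1 + \<eta>) = 1"
        using r(3) by (metis of_real_1 of_real_mult)
      then have r': "[:complex_of_real r * complex_of_real \<eta>:] = 1 - [:complex_of_real r:]"
        by (simp add: algebra_simps one_pCons)
      have "1 - ?a = Polynomial.smult (of_real r) (x + [:of_real \<eta>:])"
        by (simp add: smult_add_right smult_diff_right r')
      with y show ?thesis by (intro exI[of _ "1 - y"]) (simp add: poly_adj_simps)
    qed
    obtain q1 where q1: "poly_adj q1 = q1"
        "N (q1\<^sup>2 - Polynomial.smult (of_real r) (b + [:of_real \<eta>:])) \<le> \<eta>"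
      using sqrt[of b] sa b by auto
    obtain q2 where q2: "poly_adj q2 = q2"
        "N (q2\<^sup>2 - Polynomial.smult (of_real r) (- b + [:of_real \<eta>:])) \<le> \<eta>"
      using sqrt[of "- b"] sa b poly_adj_smult[of "-1" b] by auto
    let ?d1 = "q1\<^sup>2 - Polynomial.smult (of_real r) (b + [:of_real \<eta>:])"
    let ?d2 = "q2\<^sup>2 - Polynomial.smult (of_real r) (- b + [:of_real \<eta>:])"
    let ?v = "q1 + Polynomial.smult \<i> q2"
    have r\<eta>: "N [:complex_of_real (r * \<eta>):] \<le> \<eta>"
    proof -
      have "N [:complex_of_real (r * \<eta>):] = r * \<eta> * N 1"
        using smult[of "complex_of_real (r * \<eta>)" 1] r \<eta> by (simp add: one_pCons norm_mult)
      also have "\<dots> \<le> 1 * \<eta> * 1" using r \<eta> one_le nonneg[of 1] by (intro mult_mono) auto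
      finally show ?thesis by simp
    qed
    have "(N ?v)\<^sup>2 = N (q1\<^sup>2 + q2\<^sup>2)" by (rule norm_real_imaginary[OF q1(1) q2(1)])
    also have "q1\<^sup>2 + q2\<^sup>2 = (?d1 + ?d2) + ([:complex_of_real (r * \<eta>):] + [:complex_of_real (r * \<eta>):])"
      by (simp add: smult_add_right smult_diff_right algebra_simps)
    also have "N \<dots> \<le> 4 * \<eta>"
      using triangle[of "?d1 + ?d2" "[:complex_of_real (r * \<eta>):] + [:complex_of_real (r * \<eta>):]"]
        triangle[of ?d1 ?d2] triangle[of "[:complex_of_real (r * \<eta>):]" "[:complex_of_real (r * \<eta>):]"]
        q1(2) q2(2) r\<eta> by linarith
    finally have v: "(N ?v)\<^sup>2 \<le> 4 * \<eta>" .
    have "q1 = Polynomial.smult (1/2) (?v + poly_adj ?v)"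
    proof -
      have "?v + poly_adj ?v = Polynomial.smult 2 q1"
        by (simp add: poly_adj_simps q1 q2 smult_2)
      then show ?thesis by simp
    qed
    then have "N q1 = N (?v + poly_adj ?v) / 2" using smult[of "1/2" "?v + poly_adj ?v"] by simp
    then have "N q1 \<le> N ?v" using triangle[of ?v "poly_adj ?v"] adj[of ?v] by simp
    then have "(N q1)\<^sup>2 \<le> 4 * \<eta>" using v power_mono[OF _ nonneg, of q1 "N ?v" 2] by linarith
    then have q12: "N (q1\<^sup>2) \<le> 4 * \<eta>" using power[of q1 2] by linarith
    have "Polynomial.smult (of_real r) b = q1\<^sup>2 - ?d1 - [:complex_of_real (r * \<eta>):]"
      by (simp add: smult_add_right smult_diff_right)
    then have "r * N b = N (q1\<^sup>2 - ?d1 - [:complex_of_real (r * \<eta>):])"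
      using r smult[of "of_real r" b] by simp
    also have "\<dots> \<le> 6 * \<eta>"
      using diff[of "q1\<^sup>2 - ?d1" "[:complex_of_real (r * \<eta>):]"] diff[of "q1\<^sup>2" ?d1] q12 q1(2) r\<eta>
      by linarith
    finally have "r * N b \<le> 6 * \<eta>" .
    then have "(1 + \<eta>) * (r * N b) \<le> (1 + \<eta>) * (6 * \<eta>)" using \<eta> by (intro mult_left_mono) auto
    moreover have "(1 + \<eta>) * (r * N b) = N b" using r(3) by (metis mult.assoc mult.commute mult_1)
    ultimately show ?thesis by (simp add: mult.commute)
  qed
  have "((\<lambda>\<eta>. 6 * \<eta> * (1 + \<eta>)) \<longlongrightarrow> 6 * 0 * (1 + 0)) (at_right (0::real))"
    by (intro tendsto_intros)
  then have "N b \<le> 6 * 0 * (1 + 0)"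
    by (rule tendsto_lowerbound) (auto intro: eventually_mono[OF eventually_at_right_less] bound)
  then show ?thesis using nonneg[of b] by simp
qed

end

section \<open>Star algebras and linear combinations\<close>

locale star_algebra = ring A for A :: "('a, 'm) star_alg_scheme" (structure) +
  assumes smult_closed [simp, intro]: "x \<in> carrier A \<Longrightarrow> c \<odot> x \<in> carrier A"
    and smult_add_left: "x \<in> carrier A \<Longrightarrow> (c + d) \<odot> x = c \<odot> x \<oplus> d \<odot> x"
    and smult_add_right: "x \<in> carrier A \<Longrightarrow> y \<in> carrier A \<Longrightarrow> c \<odot> (x \<oplus> y) = c \<odot> x \<oplus> c \<odot> y"
    and smult_smult: "x \<in> carrier A \<Longrightarrow> c \<odot> (d \<odot> x) = (c * d) \<odot> x"
    and smult_one [simp]: "x \<in> carrier A \<Longrightarrow> 1 \<odot> x = x"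
    and smult_mult_left: "x \<in> carrier A \<Longrightarrow> y \<in> carrier A \<Longrightarrow> (c \<odot> x) \<otimes> y = c \<odot> (x \<otimes> y)"
    and smult_mult_right: "x \<in> carrier A \<Longrightarrow> y \<in> carrier A \<Longrightarrow> x \<otimes> (c \<odot> y) = c \<odot> (x \<otimes> y)"
    and adj_closed [simp, intro]: "x \<in> carrier A \<Longrightarrow> adj A x \<in> carrier A"
    and adj_adj [simp]: "x \<in> carrier A \<Longrightarrow> adj A (adj A x) = x"
    and adj_add: "x \<in> carrier A \<Longrightarrow> y \<in> carrier A \<Longrightarrow> adj A (x \<oplus> y) = adj A x \<oplus> adj A y"
    and adj_mult: "x \<in> carrier A \<Longrightarrow> y \<in> carrier A \<Longrightarrow> adj A (x \<otimes> y) = adj A y \<otimes> adj A x"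
    and adj_smult: "x \<in> carrier A \<Longrightarrow> adj A (c \<odot> x) = cnj c \<odot> adj A x"
begin

lemma zero_smult [simp]: assumes "x \<in> carrier A" shows "0 \<odot> x = \<zero>"
proof -
  have "0 \<odot> x \<oplus> 0 \<odot> x = 0 \<odot> x" using smult_add_left[of x 0 0] assms by simp
  then show ?thesis using assms by (metis add.l_cancel_one smult_closed)
qed

lemma smult_zero [simp]: "c \<odot> \<zero> = \<zero>"
proof -
  have "c \<odot> \<zero> \<oplus> c \<odot> \<zero> = c \<odot> \<zero>" using smult_add_right[of \<zero> \<zero> c] by simp
  then show ?thesis by (metis add.l_cancel_one smult_closed zero_closed)
qed

lemma minus_eq_smult: assumes "x \<in> carrier A" shows "\<ominus> x = (-1) \<odot> x"
proof -
  have "x \<oplus> (-1) \<odot> x = \<zero>" using smult_add_left[of x 1 "-1"] assms by simp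
  then show ?thesis using assms by (metis minus_equality a_comm smult_closed)
qed

lemma smult_minus: "x \<in> carrier A \<Longrightarrow> c \<odot> (\<ominus> x) = \<ominus> (c \<odot> x)"
  by (simp add: minus_eq_smult smult_smult)

lemma smult_diff: "x \<in> carrier A \<Longrightarrow> y \<in> carrier A \<Longrightarrow> c \<odot> (x \<ominus> y) = c \<odot> x \<ominus> c \<odot> y"
  by (simp add: minus_eq smult_add_right smult_minus)

lemma adj_zero [simp]: "adj A \<zero> = \<zero>"
  using adj_smult[of \<zero> 0] by simp

lemma adj_one [simp]: "adj A \<one> = \<one>"
  by (metis adj_adj adj_closed adj_mult l_one one_closed r_one)

lemma adj_minus: "x \<in> carrier A \<Longrightarrow> adj A (\<ominus> x) = \<ominus> adj A x"
  by (simp add: minus_eq_smult adj_smult)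

lemma adj_diff: "x \<in> carrier A \<Longrightarrow> y \<in> carrier A \<Longrightarrow> adj A (x \<ominus> y) = adj A x \<ominus> adj A y"
  by (simp add: minus_eq adj_add adj_minus)

lemma ideal_smult: assumes "ideal J A" "x \<in> J" shows "c \<odot> x \<in> J"
proof -
  have x: "x \<in> carrier A" using assms by (rule ideal.Icarr)
  have "(c \<odot> \<one>) \<otimes> x \<in> J" using ideal.I_l_closed[OF assms] by simp
  then show ?thesis using x by (simp add: smult_mult_left)
qed

end

definition lincomb ::
  "('a, 'm) star_alg_scheme \<Rightarrow> 'i set \<Rightarrow> ('i \<Rightarrow> complex) \<Rightarrow> ('i \<Rightarrow> 'a) \<Rightarrow> 'a" where
  "lincomb A S c V = (\<Oplus>\<^bsub>A\<^esub>i\<in>S. c i \<odot>\<^bsub>A\<^esub> V i)"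

context star_algebra
begin

lemma lincomb_empty [simp]: "lincomb A {} c V = \<zero>"
  by (simp add: lincomb_def)

lemma lincomb_insert:
  "finite S \<Longrightarrow> i \<notin> S \<Longrightarrow> V i \<in> carrier A \<Longrightarrow> V ` S \<subseteq> carrier A \<Longrightarrow>
    lincomb A (insert i S) c V = c i \<odot> V i \<oplus> lincomb A S c V"
  unfolding lincomb_def by (subst finsum_insert) auto

lemma lincomb_closed [simp, intro]: "V ` S \<subseteq> carrier A \<Longrightarrow> lincomb A S c V \<in> carrier A"
  unfolding lincomb_def by (intro finsum_closed) auto

lemma lincomb_cong:
  assumes "S = T" "\<And>i. i \<in> T \<Longrightarrow> c i = d i" "\<And>i. i \<in> T \<Longrightarrow> V i = W i" "W ` T \<subseteq> carrier A"
  shows "lincomb A S c V = lincomb A T d W"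
  unfolding lincomb_def using assms by (intro finsum_cong') auto

lemma lincomb_add:
  assumes "V ` S \<subseteq> carrier A"
  shows "lincomb A S (\<lambda>i. c i + d i) V = lincomb A S c V \<oplus> lincomb A S d V"
  using assms
proof (induction S rule: infinite_finite_induct)
  case (insert i S)
  then have "V i \<in> carrier A" "V ` S \<subseteq> carrier A" by auto
  then show ?case using insert
    by (simp add: lincomb_insert smult_add_left a_ac)
qed (simp_all add: lincomb_def)

lemma lincomb_smult:
  assumes "V ` S \<subseteq> carrier A"
  shows "a \<odot> lincomb A S c V = lincomb A S (\<lambda>i. a * c i) V"
  using assms
proof (induction S rule: infinite_finite_induct)
  case (insert i S)
  then have "V i \<in> carrier A" "V ` S \<subseteq> carrier A" by auto
  then show ?case using insert by (simp add: lincomb_insert smult_add_right smult_smult)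
qed (simp_all add: lincomb_def)

lemma lincomb_mult_left:
  assumes "V ` S \<subseteq> carrier A" "x \<in> carrier A"
  shows "x \<otimes> lincomb A S c V = lincomb A S c (\<lambda>i. x \<otimes> V i)"
  using assms
proof (induction S rule: infinite_finite_induct)
  case (insert i S)
  then have "V i \<in> carrier A" "V ` S \<subseteq> carrier A" "(\<lambda>i. x \<otimes> V i) ` S \<subseteq> carrier A" by auto
  then show ?case using insert by (simp add: lincomb_insert r_distr smult_mult_right)
qed (simp_all add: lincomb_def)

lemma lincomb_mult_right:
  assumes "V ` S \<subseteq> carrier A" "x \<in> carrier A"
  shows "lincomb A S c V \<otimes> x = lincomb A S c (\<lambda>i. V i \<otimes> x)"
  using assms
proof (induction S rule: infinite_finite_induct)
  case (insert i S)
  then have "V i \<in> carrier A" "V ` S \<subseteq> carrier A" "(\<lambda>i. V i \<otimes> x) ` S \<subseteq> carrier A" by auto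
  then show ?case using insert by (simp add: lincomb_insert l_distr smult_mult_left)
qed (simp_all add: lincomb_def)

lemma lincomb_adj:
  assumes "V ` S \<subseteq> carrier A"
  shows "adj A (lincomb A S c V) = lincomb A S (\<lambda>i. cnj (c i)) (\<lambda>i. adj A (V i))"
  using assms
proof (induction S rule: infinite_finite_induct)
  case (insert i S)
  then have "V i \<in> carrier A" "V ` S \<subseteq> carrier A" "(\<lambda>i. adj A (V i)) ` S \<subseteq> carrier A" by auto
  then show ?case using insert by (simp add: lincomb_insert adj_add adj_smult)
qed (simp_all add: lincomb_def)

lemma lincomb_zero:
  assumes "V ` S \<subseteq> carrier A" "\<And>i. i \<in> S \<Longrightarrow> c i = 0"
  shows "lincomb A S c V = \<zero>"
  using assms
proof (induction S rule: infinite_finite_induct)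
  case (insert i S)
  then have "V i \<in> carrier A" "V ` S \<subseteq> carrier A" by auto
  then show ?case using insert by (simp add: lincomb_insert)
qed (simp_all add: lincomb_def)

lemma lincomb_neutral:
  assumes "finite T" "S \<subseteq> T" "V ` T \<subseteq> carrier A" "\<And>i. i \<in> T - S \<Longrightarrow> c i = 0"
  shows "lincomb A T c V = lincomb A S c V"
proof -
  have fin: "finite S" "finite (T - S)" using assms finite_subset by auto
  have V: "(\<lambda>i. c i \<odot> V i) \<in> S \<rightarrow> carrier A" "(\<lambda>i. c i \<odot> V i) \<in> (T - S) \<rightarrow> carrier A"
    using assms by auto
  have z: "lincomb A (T - S) c V = \<zero>" using assms by (intro lincomb_zero) auto
  have "T = S \<union> (T - S)" using assms by auto
  then have "lincomb A T c V = lincomb A S c V \<oplus> lincomb A (T - S) c V"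
    unfolding lincomb_def using finsum_Un_disjoint[OF fin _ V] by simp
  moreover have "V ` S \<subseteq> carrier A" using assms by auto
  ultimately show ?thesis by (simp add: z)
qed

lemma lincomb_single:
  assumes "finite S" "i \<in> S" "V ` S \<subseteq> carrier A"
  shows "lincomb A S (\<lambda>j. if j = i then a else 0) V = a \<odot> V i"
proof -
  have "V i \<in> carrier A" using assms by auto
  then have "lincomb A {i} (\<lambda>j. if j = i then a else 0) V = a \<odot> V i"
    using lincomb_insert[of "{}" i V] by simp
  then show ?thesis using lincomb_neutral[of S "{i}" V "\<lambda>j. if j = i then a else 0"] assms by auto
qed

lemma lincomb_lincomb:
  assumes "finite S" "V ` T \<subseteq> carrier A"
  shows "lincomb A S a (\<lambda>k. lincomb A T (c k) V) = lincomb A T (\<lambda>i. \<Sum>k\<in>S. a k * c k i) V"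
  using assms(1)
proof (induction S)
  case (insert k S)
  then show ?case using assms
    by (subst lincomb_insert) (auto simp: lincomb_smult lincomb_add)
qed (simp add: lincomb_zero assms)

lemma lincomb_add_vectors:
  assumes "V ` S \<subseteq> carrier A" "W ` S \<subseteq> carrier A"
  shows "lincomb A S c (\<lambda>i. V i \<oplus> W i) = lincomb A S c V \<oplus> lincomb A S c W"
  using assms
proof (induction S rule: infinite_finite_induct)
  case (insert i S)
  then have "V i \<in> carrier A" "V ` S \<subseteq> carrier A" "W i \<in> carrier A" "W ` S \<subseteq> carrier A"
    "(\<lambda>i. V i \<oplus> W i) ` S \<subseteq> carrier A" by auto
  then show ?case using insert by (simp add: lincomb_insert smult_add_right a_ac)
qed (simp_all add: lincomb_def)

lemma lincomb_smult_vectors: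
  assumes "V ` S \<subseteq> carrier A"
  shows "lincomb A S c (\<lambda>i. d i \<odot> V i) = lincomb A S (\<lambda>i. c i * d i) V"
  unfolding lincomb_def using assms by (intro finsum_cong') (auto simp: smult_smult)

lemma lincomb_swap:
  assumes "finite S" "finite T" "\<And>i j. i \<in> S \<Longrightarrow> j \<in> T \<Longrightarrow> V i j \<in> carrier A"
  shows "lincomb A S a (\<lambda>i. lincomb A T b (V i)) = lincomb A T b (\<lambda>j. lincomb A S a (\<lambda>i. V i j))"
  using assms(1,3)
proof (induction S)
  case empty
  then show ?case using lincomb_smult_vectors[of "\<lambda>_. \<zero>" T b "\<lambda>_. 0"] lincomb_zero[of "\<lambda>_. \<zero>" T "\<lambda>_. 0"]
    by (simp add: image_subset_iff)
next
  case (insert k S)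
  have VT: "V k ` T \<subseteq> carrier A" "(\<lambda>i. lincomb A T b (V i)) ` S \<subseteq> carrier A"
    "\<And>j. j \<in> T \<Longrightarrow> V k j \<in> carrier A" "\<And>j. j \<in> T \<Longrightarrow> (\<lambda>i. V i j) ` S \<subseteq> carrier A"
    "(\<lambda>j. a k \<odot> V k j) ` T \<subseteq> carrier A" "(\<lambda>j. lincomb A S a (\<lambda>i. V i j)) ` T \<subseteq> carrier A"
    using insert by (auto simp: image_subset_iff)
  have "lincomb A T b (\<lambda>j. lincomb A (insert k S) a (\<lambda>i. V i j)) =
      lincomb A T b (\<lambda>j. a k \<odot> V k j \<oplus> lincomb A S a (\<lambda>i. V i j))"
    using insert(1,2) VT by (intro lincomb_cong) (auto simp: lincomb_insert)
  also have "\<dots> = a k \<odot> lincomb A T b (V k) \<oplus> lincomb A T b (\<lambda>j. lincomb A S a (\<lambda>i. V i j))"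
    using VT by (simp add: lincomb_add_vectors lincomb_smult_vectors lincomb_smult mult.commute)
  also have "\<dots> = lincomb A (insert k S) a (\<lambda>i. lincomb A T b (V i))"
    using insert VT by (subst lincomb_insert) auto
  finally show ?case by simp
qed

lemma lincomb_reindex:
  assumes "inj_on f S" "V ` f ` S \<subseteq> carrier A"
  shows "lincomb A (f ` S) c V = lincomb A S (\<lambda>i. c (f i)) (\<lambda>i. V (f i))"
  unfolding lincomb_def using assms by (subst finsum_reindex) auto

text \<open>
  Collecting the coefficients of equal vectors; this is how convolution arises from multiplying
  linear combinations.
\<close>

lemma lincomb_fibre:
  assumes "finite S" "f ` S \<subseteq> T" "finite T" "V ` T \<subseteq> carrier A"
  shows "lincomb A S c (\<lambda>i. V (f i)) = lincomb A T (\<lambda>j. \<Sum>i\<in>{i\<in>S. f i = j}. c i) V"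
proof -
  have "lincomb A S c (\<lambda>i. V (f i)) =
      lincomb A S c (\<lambda>i. lincomb A T (\<lambda>j. if j = f i then 1 else 0) V)"
    using assms by (intro lincomb_cong) (auto simp: lincomb_single image_subset_iff)
  also have "\<dots> = lincomb A T (\<lambda>j. \<Sum>i\<in>S. c i * (if j = f i then 1 else 0)) V"
    using assms by (simp add: lincomb_lincomb)
  also have "\<dots> = lincomb A T (\<lambda>j. \<Sum>i\<in>{i\<in>S. f i = j}. c i) V"
    using assms by (intro lincomb_cong) (auto simp: sum.inter_filter if_distrib eq_commute cong: if_cong)
  finally show ?thesis .
qed

lemma lincomb_product:
  assumes "finite S" "finite T" "V ` S \<subseteq> carrier A" "W ` T \<subseteq> carrier A"
  shows "lincomb A S a V \<otimes> lincomb A T b W =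
    lincomb A (S \<times> T) (\<lambda>(i, j). a i * b j) (\<lambda>(i, j). V i \<otimes> W j)"
  using assms(1,3)
proof (induction S)
  case empty then show ?case using assms by simp
next
  case (insert k S)
  have V: "V k \<in> carrier A" "V ` S \<subseteq> carrier A" using insert by auto
  have "{k} \<times> T = Pair k ` T" by auto
  then have "lincomb A ({k} \<times> T) (\<lambda>(i, j). a i * b j) (\<lambda>(i, j). V i \<otimes> W j) =
      lincomb A T (\<lambda>j. a k * b j) (\<lambda>j. V k \<otimes> W j)"
    using V assms by (simp add: lincomb_reindex inj_on_def image_subset_iff)
  also have "\<dots> = a k \<odot> V k \<otimes> lincomb A T b W"
    using V assms by (subst smult_mult_left) (auto simp: lincomb_mult_left lincomb_smult image_subset_iff)
  finally have 1: "lincomb A ({k} \<times> T) (\<lambda>(i, j). a i * b j) (\<lambda>(i, j). V i \<otimes> W j) =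
    a k \<odot> V k \<otimes> lincomb A T b W" .
  have "insert k S \<times> T = {k} \<times> T \<union> S \<times> T" "({k} \<times> T) \<inter> (S \<times> T) = {}" using insert by auto
  then have "lincomb A (insert k S \<times> T) (\<lambda>(i, j). a i * b j) (\<lambda>(i, j). V i \<otimes> W j) =
     lincomb A ({k} \<times> T) (\<lambda>(i, j). a i * b j) (\<lambda>(i, j). V i \<otimes> W j) \<oplus>
     lincomb A (S \<times> T) (\<lambda>(i, j). a i * b j) (\<lambda>(i, j). V i \<otimes> W j)"
    unfolding lincomb_def using V assms insert(1)
    by (simp, subst finsum_Un_disjoint) (auto simp: image_subset_iff)
  then show ?case using insert V assms 1 by (simp add: lincomb_insert l_distr)
qed

end

definition star_hom :: "('a, 'm) star_alg_scheme \<Rightarrow> ('b, 'k) star_alg_scheme \<Rightarrow> ('a \<Rightarrow> 'b) set" where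
  "star_hom A B = {h \<in> ring_hom A B.
     (\<forall>c. \<forall>x\<in>carrier A. h (c \<odot>\<^bsub>A\<^esub> x) = c \<odot>\<^bsub>B\<^esub> h x) \<and>
     (\<forall>x\<in>carrier A. h (adj A x) = adj B (h x))}"

lemma star_homD:
  assumes "h \<in> star_hom A B"
  shows "x \<in> carrier A \<Longrightarrow> h x \<in> carrier B"
    and "x \<in> carrier A \<Longrightarrow> y \<in> carrier A \<Longrightarrow> h (x \<oplus>\<^bsub>A\<^esub> y) = h x \<oplus>\<^bsub>B\<^esub> h y"
    and "x \<in> carrier A \<Longrightarrow> y \<in> carrier A \<Longrightarrow> h (x \<otimes>\<^bsub>A\<^esub> y) = h x \<otimes>\<^bsub>B\<^esub> h y"
    and "h \<one>\<^bsub>A\<^esub> = \<one>\<^bsub>B\<^esub>"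
    and "x \<in> carrier A \<Longrightarrow> h (c \<odot>\<^bsub>A\<^esub> x) = c \<odot>\<^bsub>B\<^esub> h x"
    and "x \<in> carrier A \<Longrightarrow> h (adj A x) = adj B (h x)"
  using assms by (auto simp: star_hom_def ring_hom_def Pi_iff)

lemma star_hom_zero:
  assumes "star_algebra A" "star_algebra B" "h \<in> star_hom A B"
  shows "h \<zero>\<^bsub>A\<^esub> = \<zero>\<^bsub>B\<^esub>"
proof -
  interpret A: star_algebra A by fact
  interpret B: star_algebra B by fact
  show ?thesis using star_homD(5)[OF assms(3), of "\<zero>\<^bsub>A\<^esub>" 0] star_homD(1)[OF assms(3)] by simp
qed

lemma star_hom_minus:
  assumes "star_algebra A" "star_algebra B" "h \<in> star_hom A B" "x \<in> carrier A"
  shows "h (\<ominus>\<^bsub>A\<^esub> x) = \<ominus>\<^bsub>B\<^esub> h x"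
proof -
  interpret A: star_algebra A by fact
  interpret B: star_algebra B by fact
  show ?thesis using star_homD[OF assms(3)] assms(4) by (simp add: A.minus_eq_smult B.minus_eq_smult)
qed

lemma star_hom_diff:
  assumes "star_algebra A" "star_algebra B" "h \<in> star_hom A B" "x \<in> carrier A" "y \<in> carrier A"
  shows "h (x \<ominus>\<^bsub>A\<^esub> y) = h x \<ominus>\<^bsub>B\<^esub> h y"
proof -
  interpret A: star_algebra A by fact
  interpret B: star_algebra B by fact
  show ?thesis using star_homD[OF assms(3)] star_hom_minus[OF assms(1-3)] assms(4,5)
    by (simp add: A.minus_eq B.minus_eq)
qed

lemma star_hom_lincomb:
  assumes "star_algebra A" "star_algebra B" "h \<in> star_hom A B" "V ` S \<subseteq> carrier A"
  shows "h (lincomb A S c V) = lincomb B S c (\<lambda>i. h (V i))"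
proof -
  interpret A: star_algebra A by fact
  interpret B: star_algebra B by fact
  note h = star_homD[OF assms(3)]
  show ?thesis using assms(4)
  proof (induction S rule: infinite_finite_induct)
    case (insert i S)
    then have "V i \<in> carrier A" "V ` S \<subseteq> carrier A" "(\<lambda>i. h (V i)) ` S \<subseteq> carrier B"
      using h(1) by auto
    then show ?case using insert by (simp add: A.lincomb_insert B.lincomb_insert h)
  qed (simp_all add: lincomb_def star_hom_zero[OF assms(1-3)])
qed

lemma star_hom_comp:
  assumes "h \<in> star_hom A B" "k \<in> star_hom B C"
  shows "(\<lambda>x. k (h x)) \<in> star_hom A C"
  using star_homD[OF assms(1)] star_homD[OF assms(2)]
  by (auto simp: star_hom_def intro!: ring_hom_memI)

lemma star_algebra_image:
  assumes "star_algebra A" and h: "h \<in> star_hom A B" "h ` carrier A = carrier B"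
    and z: "h \<zero>\<^bsub>A\<^esub> = \<zero>\<^bsub>B\<^esub>"
  shows "star_algebra B"
proof -
  interpret A: star_algebra A by fact
  note hD = star_homD(2-6)[OF h(1), symmetric] z[symmetric] 
  have B: "\<exists>a\<in>carrier A. x = h a" if "x \<in> carrier B" for x using that h(2) by auto
  have cl: "x \<in> carrier A \<Longrightarrow> h x \<in> carrier B" for x using h(2) by auto
  have "ring B"
  proof (intro ringI abelian_groupI monoidI)
    fix x assume "x \<in> carrier B"
    then obtain a where a: "a \<in> carrier A" "x = h a" using B by blast
    then show "\<exists>y\<in>carrier B. y \<oplus>\<^bsub>B\<^esub> x = \<zero>\<^bsub>B\<^esub>"
      by (intro bexI[of _ "h (\<ominus>\<^bsub>A\<^esub> a)"]) (auto simp: hD cl A.l_neg)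
  qed (auto dest!: B simp: hD cl A.a_ac A.m_assoc A.l_distr A.r_distr)
  then interpret B: ring B .
  show ?thesis
    by unfold_locales (auto dest!: B simp: hD cl A.smult_add_left A.smult_add_right A.smult_smult
      A.smult_mult_left A.smult_mult_right A.adj_add A.adj_mult A.adj_smult)
qed

section \<open>C*-seminorms\<close>

text \<open>
  One inequality suffices for homogeneity, by scaling back with \<open>1 / c\<close>, and one for the C*-identity,
  as the other follows from submultiplicativity.
\<close>

lemma (in star_algebra) cstar_seminormI:
  assumes nn: "\<And>x. x \<in> carrier A \<Longrightarrow> 0 \<le> p x"
    and add: "\<And>x y. x \<in> carrier A \<Longrightarrow> y \<in> carrier A \<Longrightarrow> p (x \<oplus> y) \<le> p x + p y"
    and smult: "\<And>c x. x \<in> carrier A \<Longrightarrow> p (c \<odot> x) \<le> cmod c * p x"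
    and mult: "\<And>x y. x \<in> carrier A \<Longrightarrow> y \<in> carrier A \<Longrightarrow> p (x \<otimes> y) \<le> p x * p y"
    and adj: "\<And>x. x \<in> carrier A \<Longrightarrow> p (adj A x) \<le> p x"
    and square: "\<And>x. x \<in> carrier A \<Longrightarrow> (p x)\<^sup>2 \<le> p (adj A x \<otimes> x)"
  shows "cstar_seminorm A p"
proof -
  have smult_eq: "p (c \<odot> x) = cmod c * p x" if x: "x \<in> carrier A" for c x
  proof (cases "c = 0")
    case True
    then show ?thesis using smult[OF x, of 0] nn[of \<zero>] x by simp
  next
    case False
    have "p ((1 / c) \<odot> (c \<odot> x)) \<le> cmod (1 / c) * p (c \<odot> x)" using x by (intro smult) auto
    then have "cmod c * p x \<le> p (c \<odot> x)" using x False by (simp add: smult_smult norm_divide field_simps)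
    then show ?thesis using smult[OF x, of c] by simp
  qed
  have square_eq: "p (adj A x \<otimes> x) = (p x)\<^sup>2" if x: "x \<in> carrier A" for x
  proof (rule antisym[OF _ square[OF x]])
    have "p (adj A x \<otimes> x) \<le> p (adj A x) * p x" using x by (intro mult) auto
    also have "\<dots> \<le> p x * p x" using adj[OF x] nn[OF x] by (intro mult_right_mono)
    finally show "p (adj A x \<otimes> x) \<le> (p x)\<^sup>2" by (simp add: power2_eq_square)
  qed
  show ?thesis unfolding cstar_seminorm_def
    by (intro conjI ballI allI nn add smult_eq mult square_eq)
qed

locale cstar_seminormed = star_algebra A for A :: "('a, 'm) star_alg_scheme" (structure) +
  fixes p :: "'a \<Rightarrow> real"
  assumes p_cstar: "cstar_seminorm A p"

lemma cstar_seminormedI: "star_algebra A \<Longrightarrow> cstar_seminorm A p \<Longrightarrow> cstar_seminormed A p"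
  by (simp add: cstar_seminormed_def cstar_seminormed_axioms_def)

context cstar_seminormed
begin

lemma p_nonneg: "x \<in> carrier A \<Longrightarrow> 0 \<le> p x"
  and p_add: "x \<in> carrier A \<Longrightarrow> y \<in> carrier A \<Longrightarrow> p (x \<oplus> y) \<le> p x + p y"
  and p_smult: "x \<in> carrier A \<Longrightarrow> p (c \<odot> x) = cmod c * p x"
  and p_mult: "x \<in> carrier A \<Longrightarrow> y \<in> carrier A \<Longrightarrow> p (x \<otimes> y) \<le> p x * p y"
  and p_adj_mult: "x \<in> carrier A \<Longrightarrow> p (adj A x \<otimes> x) = (p x)\<^sup>2"
  using p_cstar by (auto simp: cstar_seminorm_def)

lemma p_zero [simp]: "p \<zero> = 0"
  using p_smult[of \<zero> 0] by simp

lemma p_minus: "x \<in> carrier A \<Longrightarrow> p (\<ominus> x) = p x"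
  using p_smult[of x "-1"] by (simp add: minus_eq_smult)

lemma p_one_le: "p \<one> \<le> 1"
proof -
  have "p \<one> = (p \<one>)\<^sup>2" using p_adj_mult[of \<one>] by simp
  then have "p \<one> = 0 \<or> p \<one> = 1" by (simp add: power2_eq_square)
  then show ?thesis by auto
qed

lemma p_adj_ge: assumes "x \<in> carrier A" shows "p x \<le> p (adj A x)"
proof (cases "p x = 0")
  case False
  then have "0 < p x" using p_nonneg[of x] assms by simp
  moreover have "p x * p x \<le> p (adj A x) * p x"
    using p_adj_mult[of x] p_mult[of "adj A x" x] assms by (simp add: power2_eq_square)
  ultimately show ?thesis by simp
qed (simp add: p_nonneg assms)

lemma p_adj [simp]: "x \<in> carrier A \<Longrightarrow> p (adj A x) = p x"
  using p_adj_ge[of x] p_adj_ge[of "adj A x"] by simp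

lemma p_triangle:
  assumes "x \<in> carrier A" "y \<in> carrier A" "z \<in> carrier A"
  shows "p (x \<ominus> z) \<le> p (x \<ominus> y) + p (y \<ominus> z)"
proof -
  have "x \<ominus> z = (x \<ominus> y) \<oplus> (y \<ominus> z)" using assms by algebra
  then show ?thesis using p_add[of "x \<ominus> y" "y \<ominus> z"] assms by simp
qed

lemma p_diff_commute:
  assumes "x \<in> carrier A" "y \<in> carrier A"
  shows "p (x \<ominus> y) = p (y \<ominus> x)"
proof -
  have "x \<ominus> y = \<ominus> (y \<ominus> x)" using assms by algebra
  then show ?thesis using p_minus[of "y \<ominus> x"] assms by simp
qed

lemma p_diff_ge:
  assumes "x \<in> carrier A" "y \<in> carrier A"
  shows "\<bar>p x - p y\<bar> \<le> p (x \<ominus> y)"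
proof -
  have "x = (x \<ominus> y) \<oplus> y" "y = (y \<ominus> x) \<oplus> x" using assms by algebra+
  then have "p x \<le> p (x \<ominus> y) + p y" "p y \<le> p (y \<ominus> x) + p x"
    using assms by (metis p_add minus_closed)+
  then show ?thesis using p_diff_commute[OF assms] by linarith
qed

lemma p_lincomb:
  assumes "V ` S \<subseteq> carrier A"
  shows "p (lincomb A S c V) \<le> (\<Sum>i\<in>S. cmod (c i) * p (V i))"
  using assms
proof (induction S rule: infinite_finite_induct)
  case (insert i S)
  then have V: "V i \<in> carrier A" "V ` S \<subseteq> carrier A" by auto
  then show ?case using insert p_add[of "c i \<odot> V i" "lincomb A S c V"]
    by (simp add: lincomb_insert p_smult)
qed (simp_all add: lincomb_def)

end

section \<open>Functional calculus, quotient seminorms and orthogonality\<close>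

context star_algebra
begin

definition poly_ev :: "'a \<Rightarrow> complex poly \<Rightarrow> 'a" where
  "poly_ev h f = fold_coeffs (\<lambda>a x. a \<odot> \<one> \<oplus> h \<otimes> x) f \<zero>"

lemma poly_ev_0 [simp]: "poly_ev h 0 = \<zero>"
  by (simp add: poly_ev_def)

lemma poly_ev_pCons [simp]:
  "h \<in> carrier A \<Longrightarrow> poly_ev h (pCons a f) = a \<odot> \<one> \<oplus> h \<otimes> poly_ev h f"
  by (cases "a = 0 \<and> f = 0") (auto simp: poly_ev_def)

lemma poly_ev_closed [simp, intro]: "h \<in> carrier A \<Longrightarrow> poly_ev h f \<in> carrier A"
  by (induction f) auto

lemma poly_ev_add:
  assumes h: "h \<in> carrier A"
  shows "poly_ev h (f + g) = poly_ev h f \<oplus> poly_ev h g"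
proof (induction f arbitrary: g)
  case (pCons a f)
  obtain b g' where "g = pCons b g'" by (cases g)
  then show ?case using pCons h by (simp add: smult_add_left r_distr a_ac)
qed (simp add: h)

lemma poly_ev_smult:
  assumes h: "h \<in> carrier A"
  shows "poly_ev h (Polynomial.smult c f) = c \<odot> poly_ev h f"
  by (induction f) (simp_all add: h smult_add_right smult_smult smult_mult_right)

lemma poly_ev_mult:
  assumes h: "h \<in> carrier A"
  shows "poly_ev h (f * g) = poly_ev h f \<otimes> poly_ev h g"
proof (induction f)
  case (pCons a f)
  then show ?case using h
    by (simp add: poly_ev_add poly_ev_smult smult_mult_left l_distr m_assoc)
qed (simp add: h)

lemma poly_ev_commute:
  assumes h: "h \<in> carrier A" and x: "x \<in> carrier A" "x \<otimes> h = h \<otimes> x"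
  shows "x \<otimes> poly_ev h f = poly_ev h f \<otimes> x"
proof (induction f)
  case (pCons a f)
  have "x \<otimes> (h \<otimes> poly_ev h f) = h \<otimes> (x \<otimes> poly_ev h f)" using h x by (metis m_assoc poly_ev_closed)
  then show ?case using h x pCons
    by (simp add: r_distr l_distr smult_mult_left smult_mult_right m_assoc)
qed (simp add: h x)

lemma poly_ev_adj:
  assumes h: "h \<in> carrier A" "adj A h = h"
  shows "adj A (poly_ev h f) = poly_ev h (poly_adj f)"
proof (induction f)
  case (pCons a f)
  then show ?case using h poly_ev_commute[of h h "poly_adj f"]
    by (simp add: map_poly_pCons adj_add adj_smult adj_mult)
qed (simp add: h)

end

text \<open>
  The seminorm is pulled back to the corner cut out by a projection \<open>e\<close> commuting with \<open>h\<close>, of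
  which \<open>e\<close> is the unit.
\<close>

lemma (in cstar_seminormed) poly_ev_cstar_seminorm:
  assumes h: "h \<in> carrier A" "adj A h = h"
    and e: "e \<in> carrier A" "adj A e = e" "e \<otimes> e = e" "e \<otimes> h = h \<otimes> e"
  shows "poly_cstar_seminorm (\<lambda>f. p (e \<otimes> poly_ev h f))"
proof
  fix f g :: "complex poly" and c
  have comm: "poly_ev h f \<otimes> e = e \<otimes> poly_ev h f" for f using poly_ev_commute[OF h(1) e(1) e(4)] by simp
  have mult: "e \<otimes> poly_ev h (f * g) = (e \<otimes> poly_ev h f) \<otimes> (e \<otimes> poly_ev h g)" for f g
  proof -
    have "(e \<otimes> poly_ev h f) \<otimes> (e \<otimes> poly_ev h g) = e \<otimes> (poly_ev h f \<otimes> e) \<otimes> poly_ev h g"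
      using h e by (simp add: m_assoc)
    also have "\<dots> = (e \<otimes> e) \<otimes> (poly_ev h f \<otimes> poly_ev h g)"
      unfolding comm using h e(1) by (simp add: m_assoc)
    finally show ?thesis using e h by (simp add: poly_ev_mult)
  qed
  show "0 \<le> p (e \<otimes> poly_ev h f)" using h e by (simp add: p_nonneg)
  show "p (e \<otimes> poly_ev h (f + g)) \<le> p (e \<otimes> poly_ev h f) + p (e \<otimes> poly_ev h g)"
    using h e by (simp add: poly_ev_add r_distr p_add)
  show "p (e \<otimes> poly_ev h (Polynomial.smult c f)) = cmod c * p (e \<otimes> poly_ev h f)"
    using h e by (simp add: poly_ev_smult smult_mult_right p_smult)
  show "p (e \<otimes> poly_ev h (f * g)) \<le> p (e \<otimes> poly_ev h f) * p (e \<otimes> poly_ev h g)"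
    unfolding mult using h e by (intro p_mult) auto
  have "e \<otimes> poly_ev h (poly_adj f) = adj A (e \<otimes> poly_ev h f)"
    using h e by (simp add: adj_mult poly_ev_adj comm)
  then show "p (e \<otimes> poly_ev h (poly_adj f * f)) = (p (e \<otimes> poly_ev h f))\<^sup>2"
    unfolding mult using h e by (simp add: p_adj_mult)
qed

text \<open>
  The distance to the ideal \<open>J\<close>, as a seminorm on the algebra itself rather than on its quotient.
\<close>

definition quotient_seminorm ::
  "('a, 'm) star_alg_scheme \<Rightarrow> ('a \<Rightarrow> real) \<Rightarrow> 'a set \<Rightarrow> 'a \<Rightarrow> real" where
  "quotient_seminorm A p J x = (INF j\<in>J. p (x \<ominus>\<^bsub>A\<^esub> j))"

lemma le_mult_if_le_approx:
  fixes a b c :: real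
  assumes "\<And>e. 0 < e \<Longrightarrow> a \<le> (b + e) * (c + e)"
  shows "a \<le> b * c"
proof -
  have "((\<lambda>e. (b + e) * (c + e)) \<longlongrightarrow> (b + 0) * (c + 0)) (at_right (0::real))"
    by (intro tendsto_intros)
  then have "a \<le> (b + 0) * (c + 0)"
    by (rule tendsto_lowerbound) (auto intro: eventually_mono[OF eventually_at_right_less] assms)
  then show ?thesis by simp
qed

context cstar_seminormed
begin

lemma quotient_seminorm_le:
  assumes J: "ideal J A" and x: "x \<in> carrier A" "j \<in> J"
  shows "quotient_seminorm A p J x \<le> p (x \<ominus> j)"
  unfolding quotient_seminorm_def using J x
  by (intro cINF_lower bdd_belowI2[of _ 0]) (auto intro!: p_nonneg simp: ideal.Icarr)

lemma quotient_seminorm_greatest: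
  assumes J: "ideal J A" and "\<And>j. j \<in> J \<Longrightarrow> t \<le> p (x \<ominus> j)"
  shows "t \<le> quotient_seminorm A p J x"
  unfolding quotient_seminorm_def using assms additive_subgroup.zero_closed[OF ideal.axioms(1)[OF J]]
  by (intro cINF_greatest) auto

lemma quotient_seminorm_approx:
  assumes J: "ideal J A" and x: "x \<in> carrier A" "0 < e"
  shows "\<exists>j\<in>J. p (x \<ominus> j) < quotient_seminorm A p J x + e"
proof (rule ccontr)
  assume "\<not> ?thesis"
  then have "quotient_seminorm A p J x + e \<le> quotient_seminorm A p J x"
    by (intro quotient_seminorm_greatest[OF J]) (auto simp: not_less)
  then show False using x by simp
qed

lemma quotient_seminorm_le_p:
  assumes J: "ideal J A" and x: "x \<in> carrier A"
  shows "quotient_seminorm A p J x \<le> p x"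
  using quotient_seminorm_le[OF J x, of \<zero>] additive_subgroup.zero_closed[OF ideal.axioms(1)[OF J]] x
  by (simp add: minus_eq)

lemma quotient_seminorm_ideal:
  assumes J: "ideal J A" and x: "x \<in> J"
  shows "quotient_seminorm A p J x = 0"
proof (rule antisym)
  have x': "x \<in> carrier A" by (rule ideal.Icarr[OF J x])
  then show "quotient_seminorm A p J x \<le> 0"
    using quotient_seminorm_le[OF J x' x] by (simp add: minus_eq r_neg)
  show "0 \<le> quotient_seminorm A p J x"
    using x' by (intro quotient_seminorm_greatest[OF J] p_nonneg) (auto simp: ideal.Icarr[OF J])
qed

text \<open>
  With the approximate units above, \<open>\<parallel>x + J\<parallel>\<^sup>2 \<le> \<parallel>x c\<parallel>\<^sup>2 = \<parallel>c\<^sup>* x\<^sup>* x c\<parallel> \<approx> \<parallel>c\<^sup>* (x\<^sup>* x - h) c\<parallel>\<close>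
  for self-adjoint \<open>h \<in> J\<close> and an almost contractive \<open>c \<in> 1 + J\<close> almost annihilated by \<open>h\<close>. A general \<open>j \<in> J\<close>
  may be replaced by its real part \<open>h\<close>, because \<open>x\<^sup>* x\<close> is self-adjoint.
\<close>

lemma quotient_seminorm_square:
  assumes J: "ideal J A" "\<And>x. x \<in> J \<Longrightarrow> adj A x \<in> J" and x: "x \<in> carrier A" and j: "j \<in> J"
  shows "(quotient_seminorm A p J x)\<^sup>2 \<le> p (adj A x \<otimes> x \<ominus> j)"
proof -
  interpret J: ideal J A by fact
  have jc: "j \<in> carrier A" using j by simp
  define t where "t = p (adj A x \<otimes> x \<ominus> j)"
  define h where "h = (1/2) \<odot> (j \<oplus> adj A j)"
  have hJ: "h \<in> J" unfolding h_def using j J by (intro ideal_smult[OF J(1)]) auto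
  have hc: "h \<in> carrier A" using hJ by simp
  have hsa: "adj A h = h" using jc by (simp add: h_def adj_smult adj_add a_comm)
  have half: "(1/2) \<odot> y \<oplus> (1/2) \<odot> y = y" if "y \<in> carrier A" for y
    using smult_add_left[of y "1/2" "1/2"] that by simp
  define y where "y = adj A x \<otimes> x"
  have y: "y \<in> carrier A" "adj A y = y" using x by (simp_all add: y_def adj_mult)
  have th: "p (y \<ominus> h) \<le> t"
  proof -
    have "y \<ominus> h = (1/2) \<odot> ((y \<ominus> j) \<oplus> adj A (y \<ominus> j))"
    proof -
      have "(y \<ominus> j) \<oplus> adj A (y \<ominus> j) = (y \<oplus> y) \<ominus> (j \<oplus> adj A j)"
      proof -
        have adj: "adj A (y \<ominus> j) = y \<ominus> adj A j" "adj A j \<in> carrier A" using y jc by (simp_all add: adj_diff)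
        show ?thesis unfolding adj(1) using y(1) jc adj(2) by algebra
      qed
      then show ?thesis using y jc half[of y] by (simp add: smult_diff smult_add_right h_def)
    qed
    then have "p (y \<ominus> h) \<le> (t + t) / 2"
      using p_add[of "y \<ominus> j" "adj A (y \<ominus> j)"] y jc by (simp add: p_smult t_def y_def[symmetric])
    then show ?thesis by simp
  qed
  have t0: "0 \<le> t" using x jc by (simp add: t_def p_nonneg)
  have "(quotient_seminorm A p J x)\<^sup>2 \<le> (1 + e) * ((1 + e) * t + e)" if e: "0 < e" for e
  proof -
    interpret N: poly_cstar_seminorm "\<lambda>f. p (\<one> \<otimes> poly_ev h f)"
      using hc hsa by (intro poly_ev_cstar_seminorm) auto
    obtain c where c: "poly c 0 = 1" "p (\<one> \<otimes> poly_ev h c) \<le> 1 + e"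
        "p (\<one> \<otimes> poly_ev h ([:0, 1:] * c)) \<le> e"
      using N.approximate_unit[OF e] by blast
    obtain c' where c': "c = pCons 1 c'" using c(1) by (cases c) auto
    define C where "C = poly_ev h c"
    have C: "C \<in> carrier A" "p C \<le> 1 + e" "p (h \<otimes> C) \<le> e"
      using c hc by (simp_all add: C_def poly_ev_mult)
    have C1: "C = \<one> \<oplus> h \<otimes> poly_ev h c'" using hc by (simp add: C_def c')
    have "h \<otimes> poly_ev h c' \<in> J" using hJ hc by (simp add: J.I_r_closed)
    then have j': "\<ominus> (x \<otimes> (h \<otimes> poly_ev h c')) \<in> J" (is "?j \<in> J") using x by (simp add: J.I_l_closed)
    have "x \<otimes> C = x \<ominus> ?j" unfolding C1 using x hc by (simp add: r_distr minus_eq)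
    then have "quotient_seminorm A p J x \<le> p (x \<otimes> C)" using quotient_seminorm_le[OF J(1) x j'] by simp
    moreover have "0 \<le> quotient_seminorm A p J x"
      using x by (intro quotient_seminorm_greatest[OF J(1)] p_nonneg) auto
    ultimately have "(quotient_seminorm A p J x)\<^sup>2 \<le> (p (x \<otimes> C))\<^sup>2" by (intro power_mono)
    also have "\<dots> = p (adj A (x \<otimes> C) \<otimes> (x \<otimes> C))" using x C by (simp add: p_adj_mult)
    also have "adj A (x \<otimes> C) \<otimes> (x \<otimes> C) = adj A C \<otimes> ((y \<ominus> h) \<otimes> C \<oplus> h \<otimes> C)"
    proof -
      have "(y \<ominus> h) \<otimes> C \<oplus> h \<otimes> C = y \<otimes> C" using y hc C(1) by algebra
      then show ?thesis using x C by (simp add: y_def adj_mult m_assoc)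
    qed
    also have "p \<dots> \<le> p (adj A C) * (p (y \<ominus> h) * p C + p (h \<otimes> C))"
    proof (rule order_trans[OF p_mult mult_left_mono])
      show "p ((y \<ominus> h) \<otimes> C \<oplus> h \<otimes> C) \<le> p (y \<ominus> h) * p C + p (h \<otimes> C)"
        using p_add[of "(y \<ominus> h) \<otimes> C" "h \<otimes> C"] p_mult[of "y \<ominus> h" C] y hc C(1) by simp
    qed (use y hc C(1) in \<open>auto intro!: p_nonneg\<close>)
    also have "\<dots> \<le> (1 + e) * (t * (1 + e) + e)"
      using C th t0 e y hc by (intro mult_mono add_mono) (auto intro!: p_nonneg add_nonneg_nonneg mult_nonneg_nonneg)
    finally show ?thesis by (simp add: mult.commute)
  qed
  note bound = this
  have "((\<lambda>e. (1 + e) * ((1 + e) * t + e)) \<longlongrightarrow> (1 + 0) * ((1 + 0) * t + 0)) (at_right (0::real))"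
    by (intro tendsto_intros)
  then have "(quotient_seminorm A p J x)\<^sup>2 \<le> (1 + 0) * ((1 + 0) * t + 0)"
    by (rule tendsto_lowerbound) (auto intro: eventually_mono[OF eventually_at_right_less] bound)
  then show ?thesis by (simp add: t_def)
qed

text \<open>
  The analogue of the theorem that the quotient of a C*-algebra by a closed ideal is a C*-algebra.
  Only the lower bound of the C*-identity is deep; the rest is formal.
\<close>

theorem quotient_cstar_seminorm:
  assumes J: "ideal J A" "\<And>x. x \<in> J \<Longrightarrow> adj A x \<in> J"
  shows "cstar_seminorm A (quotient_seminorm A p J)"
proof -
  interpret J: ideal J A by fact
  let ?q = "quotient_seminorm A p J"
  note ql = quotient_seminorm_le[OF J(1)]
  have nn: "0 \<le> ?q x" if "x \<in> carrier A" for x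
    using that by (intro quotient_seminorm_greatest[OF J(1)] p_nonneg) auto
  have add: "?q (x \<oplus> y) \<le> ?q x + ?q y" if xy: "x \<in> carrier A" "y \<in> carrier A" for x y
  proof (rule field_le_epsilon)
    fix e :: real assume "0 < e"
    then obtain j k where jk: "j \<in> J" "p (x \<ominus> j) < ?q x + e / 2" "k \<in> J" "p (y \<ominus> k) < ?q y + e / 2"
      using quotient_seminorm_approx[OF J(1), of _ "e / 2"] xy by (meson half_gt_zero)
    then have c: "j \<in> carrier A" "k \<in> carrier A" by auto
    have "(x \<oplus> y) \<ominus> (j \<oplus> k) = (x \<ominus> j) \<oplus> (y \<ominus> k)" using xy c by algebra
    then have "?q (x \<oplus> y) \<le> p ((x \<ominus> j) \<oplus> (y \<ominus> k))"
      using ql[of "x \<oplus> y" "j \<oplus> k"] xy jk by simp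
    also have "\<dots> \<le> p (x \<ominus> j) + p (y \<ominus> k)" using xy c by (intro p_add) auto
    finally show "?q (x \<oplus> y) \<le> ?q x + ?q y + e" using jk by simp
  qed
  have smult_le: "?q (c \<odot> x) \<le> cmod c * ?q x" if x: "x \<in> carrier A" for c x
  proof -
    have "?q (c \<odot> x) \<le> (cmod c + e) * (?q x + e)" if e: "0 < e" for e :: real
    proof -
      obtain j where j: "j \<in> J" "p (x \<ominus> j) < ?q x + e"
        using quotient_seminorm_approx[OF J(1) x e] by blast
      then have "j \<in> carrier A" by auto
      then have "?q (c \<odot> x) \<le> p (c \<odot> (x \<ominus> j))"
        using ql[of "c \<odot> x" "c \<odot> j"] ideal_smult[OF J(1) j(1)] x by (simp add: smult_diff)
      also have "\<dots> = cmod c * p (x \<ominus> j)" using x j by (simp add: p_smult)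
      also have "\<dots> \<le> (cmod c + e) * (?q x + e)"
        using j e x nn[OF x] by (intro mult_mono) (auto intro!: p_nonneg)
      finally show ?thesis .
    qed
    then show ?thesis by (rule le_mult_if_le_approx)
  qed
  have mult: "?q (x \<otimes> y) \<le> ?q x * ?q y" if xy: "x \<in> carrier A" "y \<in> carrier A" for x y
  proof -
    have "?q (x \<otimes> y) \<le> (?q x + e) * (?q y + e)" if e: "0 < e" for e :: real
    proof -
      obtain j k where jk: "j \<in> J" "p (x \<ominus> j) < ?q x + e" "k \<in> J" "p (y \<ominus> k) < ?q y + e"
        using quotient_seminorm_approx[OF J(1) _ e] xy by meson
      then have c: "j \<in> carrier A" "k \<in> carrier A" by auto
      have "j \<otimes> y \<oplus> x \<otimes> k \<ominus> j \<otimes> k \<in> J"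
        using xy jk c by (simp add: minus_eq J.I_l_closed J.I_r_closed)
      moreover have "x \<otimes> y \<ominus> (j \<otimes> y \<oplus> x \<otimes> k \<ominus> j \<otimes> k) = (x \<ominus> j) \<otimes> (y \<ominus> k)"
        using xy c by algebra
      ultimately have "?q (x \<otimes> y) \<le> p ((x \<ominus> j) \<otimes> (y \<ominus> k))"
        using ql[of "x \<otimes> y"] xy by (metis m_closed)
      also have "\<dots> \<le> p (x \<ominus> j) * p (y \<ominus> k)" using xy c by (intro p_mult) auto
      also have "\<dots> \<le> (?q x + e) * (?q y + e)"
        using jk e xy c nn[of x] nn[of y] by (intro mult_mono) (auto intro!: p_nonneg)
      finally show ?thesis .
    qed
    then show ?thesis by (rule le_mult_if_le_approx)
  qed
  have adj: "?q (adj A x) \<le> ?q x" if x: "x \<in> carrier A" for x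
  proof (rule quotient_seminorm_greatest[OF J(1)])
    fix j assume j: "j \<in> J"
    have "p (adj A x \<ominus> adj A j) = p (x \<ominus> j)" using x j p_adj[of "x \<ominus> j"] by (simp add: adj_diff)
    then show "?q (adj A x) \<le> p (x \<ominus> j)" using ql[of "adj A x" "adj A j"] x j J by simp
  qed
  show ?thesis
    by (intro cstar_seminormI nn add smult_le mult adj quotient_seminorm_greatest[OF J(1)]
        quotient_seminorm_square[OF J])
qed

text \<open>
  For projections \<open>q\<^sub>j\<close> with sum \<open>1\<close>, the compressions \<open>q\<^sub>i q\<^sub>j q\<^sub>i\<close> with \<open>j \<noteq> i\<close> are positive elements of the
  corner of \<open>q\<^sub>i\<close> and have sum \<open>0\<close>; hence each of them is also negative, and its norm vanishes. But it
  equals \<open>(q\<^sub>j q\<^sub>i)\<^sup>* (q\<^sub>j q\<^sub>i)\<close>.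
\<close>

lemma projections_sum_one_orthogonal:
  assumes I: "finite I" and q: "\<And>i. i \<in> I \<Longrightarrow> q i \<in> carrier A"
    and sa: "\<And>i. i \<in> I \<Longrightarrow> adj A (q i) = q i" and idem: "\<And>i. i \<in> I \<Longrightarrow> q i \<otimes> q i = q i"
    and sum: "lincomb A I (\<lambda>_. 1) q = \<one>"
    and ij: "i \<in> I" "j \<in> I" "i \<noteq> j"
  shows "p (q i \<otimes> q j) = 0"
proof -
  define a where "a k = q i \<otimes> q k \<otimes> q i" for k
  define K where "K = I - {i, j}"
  define m where "m = real (card K) + 1"
  have K: "finite K" "\<And>k. k \<in> K \<Longrightarrow> k \<in> I" "\<And>k. k \<in> K \<Longrightarrow> k \<noteq> i" using I by (auto simp: K_def)
  have ac: "k \<in> I \<Longrightarrow> a k \<in> carrier A" for k using q ij by (simp add: a_def)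
  have qi: "q i \<in> carrier A" "adj A (q i) = q i" "q i \<otimes> q i = q i" using q sa idem ij by auto
  have asa: "k \<in> I \<Longrightarrow> adj A (a k) = a k" for k using q qi sa by (simp add: a_def adj_mult m_assoc)
  have qa: "k \<in> I \<Longrightarrow> q i \<otimes> a k = a k" "k \<in> I \<Longrightarrow> a k \<otimes> q i = a k" for k
    using q qi by (simp_all add: a_def m_assoc[symmetric]) (simp add: m_assoc)
  \<comment> \<open>the norm of a projection is \<open>0\<close> or \<open>1\<close>\<close>
  have p1: "p (\<one> \<ominus> q k) \<le> 1" if k: "k \<in> I" for k
  proof -
    have "adj A (\<one> \<ominus> q k) \<otimes> (\<one> \<ominus> q k) = \<one> \<ominus> q k \<ominus> q k \<oplus> q k \<otimes> q k"
    proof -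
      have "adj A (\<one> \<ominus> q k) = \<one> \<ominus> q k" using q[OF k] sa[OF k] by (simp add: adj_diff)
      then show ?thesis using q[OF k]
        by (simp add: minus_eq l_distr r_distr l_minus r_minus a_ac minus_add)
    qed
    also have "\<dots> = \<one> \<ominus> q k"
      using q[OF k] by (simp add: idem[OF k] minus_eq a_assoc l_neg)
    finally have "p (\<one> \<ominus> q k) = (p (\<one> \<ominus> q k))\<^sup>2" using q[OF k] p_adj_mult[of "\<one> \<ominus> q k"] by simp
    then have "p (\<one> \<ominus> q k) = 0 \<or> p (\<one> \<ominus> q k) = 1" by (simp add: power2_eq_square)
    then show ?thesis by auto
  qed
  have pqi: "p (q i) \<le> 1"
  proof -
    have "p (q i) = (p (q i))\<^sup>2" using p_adj_mult[of "q i"] qi by simp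
    then have "p (q i) = 0 \<or> p (q i) = 1" by (simp add: power2_eq_square)
    then show ?thesis by auto
  qed
  \<comment> \<open>positivity of \<open>a k\<close> in the corner, where \<open>q i\<close> is the unit\<close>
  have pos: "p (q i \<ominus> a k) \<le> 1" if k: "k \<in> I" for k
  proof -
    have "q i \<otimes> (\<one> \<ominus> q k) \<otimes> q i = q i \<otimes> q i \<ominus> q i \<otimes> q k \<otimes> q i" using q[OF k] qi(1) by algebra
    then have eq: "q i \<ominus> a k = q i \<otimes> (\<one> \<ominus> q k) \<otimes> q i" using qi by (simp add: a_def)
    have c: "\<one> \<ominus> q k \<in> carrier A" using q[OF k] by simp
    have "p (q i \<ominus> a k) \<le> p (q i \<otimes> (\<one> \<ominus> q k)) * p (q i)"
      unfolding eq using c qi(1) by (intro p_mult) auto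
    also have "\<dots> \<le> p (q i) * p (\<one> \<ominus> q k) * p (q i)"
      using c qi(1) by (intro mult_right_mono p_mult p_nonneg)
    also have "\<dots> \<le> 1 * 1 * 1"
      using pqi p1[OF k] q[OF k] qi by (intro mult_mono) (auto intro!: p_nonneg mult_nonneg_nonneg)
    finally show ?thesis by simp
  qed
  have sumK: "lincomb A K (\<lambda>_. 1) a = \<ominus> a j"
  proof -
    have aI: "a ` I \<subseteq> carrier A" using ac by auto
    have "q i \<otimes> lincomb A I (\<lambda>_. 1) q \<otimes> q i = lincomb A I (\<lambda>_. 1) a"
      using q qi(1) by (subst lincomb_mult_left, force, simp, subst lincomb_mult_right) (auto simp: a_def[abs_def])
    then have s: "lincomb A I (\<lambda>_. 1) a = q i" using sum qi by simp
    have "I = insert i (insert j K)" "j \<notin> K" "i \<notin> insert j K" using ij by (auto simp: K_def)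
    then have "lincomb A I (\<lambda>_. 1) a = a i \<oplus> (a j \<oplus> lincomb A K (\<lambda>_. 1) a)"
      using aI K(1) by (simp add: lincomb_insert)
    moreover have "a i = q i" using qi by (simp add: a_def)
    ultimately have "q i \<oplus> (a j \<oplus> lincomb A K (\<lambda>_. 1) a) = q i" using s by simp
    moreover have "a j \<in> carrier A" "lincomb A K (\<lambda>_. 1) a \<in> carrier A" using ac ij K by auto
    ultimately have "a j \<oplus> lincomb A K (\<lambda>_. 1) a = \<zero>"
      using qi(1) by (metis add.r_cancel_one' add.m_closed add.m_comm)
    then show ?thesis
      by (metis \<open>a j \<in> carrier A\<close> \<open>lincomb A K (\<lambda>_. 1) a \<in> carrier A\<close> a_comm minus_equality)
  qed
  have swap: "(x \<ominus> y) \<oplus> (u \<ominus> v) = (x \<oplus> u) \<ominus> (y \<oplus> v)"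
    if "x \<in> carrier A" "y \<in> carrier A" "u \<in> carrier A" "v \<in> carrier A" for x y u v
    using that by algebra
  have "lincomb A K (\<lambda>_. 1) (\<lambda>k. q i \<ominus> a k) = of_nat (card K) \<odot> q i \<ominus> lincomb A K (\<lambda>_. 1) a"
    using K(1,2)
  proof (induction K)
    case empty then show ?case using qi by (simp add: minus_eq)
  next
    case (insert k K)
    then have c: "a k \<in> carrier A" "a ` K \<subseteq> carrier A" "(\<lambda>k. q i \<ominus> a k) ` K \<subseteq> carrier A" 
      "lincomb A K (\<lambda>_. 1) a \<in> carrier A" using ac qi(1) by auto
    have "lincomb A (insert k K) (\<lambda>_. 1) (\<lambda>k. q i \<ominus> a k) = (q i \<ominus> a k) \<oplus> (of_nat (card K) \<odot> q i \<ominus> lincomb A K (\<lambda>_. 1) a)"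
      using insert c qi(1) by (simp add: lincomb_insert)
    also have "\<dots> = (q i \<oplus> of_nat (card K) \<odot> q i) \<ominus> (a k \<oplus> lincomb A K (\<lambda>_. 1) a)"
      using c(1,4) qi(1) by (intro swap) auto
    also have "q i \<oplus> of_nat (card K) \<odot> q i = of_nat (card (insert k K)) \<odot> q i"
      using insert(1,2) qi(1) by (simp add: smult_add_left)
    also have "a k \<oplus> lincomb A K (\<lambda>_. 1) a = lincomb A (insert k K) (\<lambda>_. 1) a"
      using insert(1,2) c by (simp add: lincomb_insert)
    finally show ?case .
  qed
  \<comment> \<open>negativity of \<open>a j\<close>, at the scale \<open>card K\<close>, as minus the sum of the other compressions\<close>
  then have "of_nat (card K) \<odot> q i \<oplus> a j = lincomb A K (\<lambda>_. 1) (\<lambda>k. q i \<ominus> a k)"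
    using sumK ac[OF ij(2)] by (simp add: minus_eq)
  also have "p \<dots> \<le> (\<Sum>k\<in>K. cmod 1 * p (q i \<ominus> a k))"
    using ac K qi(1) by (intro p_lincomb) auto
  also have "\<dots> \<le> (\<Sum>k\<in>K. 1)" using pos K by (intro sum_mono) auto
  finally have neg0: "p (of_nat (card K) \<odot> q i \<oplus> a j) \<le> real (card K)" by simp
  define N where "N f = p (q i \<otimes> poly_ev (a j) f)" for f
  interpret N: poly_cstar_seminorm N
    unfolding N_def using ac asa qi qa ij by (intro poly_ev_cstar_seminorm) auto
  have aj: "a j \<in> carrier A" using ac ij by auto
  define b where "b = [:0, 1 / complex_of_real m:]"
  have m: "m \<ge> 1" by (simp add: m_def)
  have ev: "q i \<otimes> poly_ev (a j) (1 + Polynomial.smult c [:0, 1:]) = q i \<oplus> c \<odot> a j" for c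
    using aj qi qa(1)[OF ij(2)] by (simp add: one_pCons r_distr smult_mult_right m_assoc[symmetric])
  have b': "b = Polynomial.smult (1 / complex_of_real m) [:0, 1:]" by (simp add: b_def)
  have "N b = 0"
  proof (rule N.zero_if_pos_and_neg)
    show "poly_adj b = b" by (simp add: b_def map_poly_pCons)
    have "1 - b = 1 + Polynomial.smult (- (1 / complex_of_real m)) [:0, 1:]"
      by (simp add: b_def one_pCons)
    then have "N (1 - b) = p (q i \<oplus> (- (1 / complex_of_real m)) \<odot> a j)"
      unfolding N_def by (simp only: ev)
    also have "q i \<oplus> (- (1 / complex_of_real m)) \<odot> a j =
        (1 / complex_of_real m) \<odot> ((complex_of_real m - 1) \<odot> q i \<oplus> (q i \<ominus> a j))"
    proof -
      have "(complex_of_real m - 1) \<odot> q i \<oplus> (q i \<ominus> a j) = complex_of_real m \<odot> q i \<ominus> a j"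
        using aj qi(1) smult_add_left[of "q i" "complex_of_real m - 1" 1]
        by (simp add: minus_eq a_assoc[symmetric])
      then show ?thesis using m aj qi(1)
        by (simp only:) (simp add: minus_eq minus_eq_smult smult_add_right smult_smult)
    qed
    also have "p \<dots> = 1 / m * p ((complex_of_real m - 1) \<odot> q i \<oplus> (q i \<ominus> a j))"
      using m aj qi(1) by (subst p_smult) (auto simp: norm_divide)
    also have "\<dots> \<le> 1 / m * ((m - 1) + 1)"
    proof (intro mult_left_mono order_trans[OF p_add] add_mono pos ij)
      have "p ((complex_of_real m - 1) \<odot> q i) = (m - 1) * p (q i)"
        using qi m by (simp add: p_smult m_def)
      then show "p ((complex_of_real m - 1) \<odot> q i) \<le> m - 1" using pqi m by (simp add: mult_left_le)
    qed (use m aj qi in auto)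
    finally show "N (1 - b) \<le> 1" using m by simp
    have "N (1 + b) = p (q i \<oplus> (1 / complex_of_real m) \<odot> a j)"
      unfolding N_def b' by (simp only: ev)
    also have "q i \<oplus> (1 / complex_of_real m) \<odot> a j =
        (1 / complex_of_real m) \<odot> (q i \<oplus> (of_nat (card K) \<odot> q i \<oplus> a j))"
    proof -
      have "q i \<oplus> (of_nat (card K) \<odot> q i \<oplus> a j) = complex_of_real m \<odot> q i \<oplus> a j"
        using aj qi(1) smult_add_left[of "q i" 1 "of_nat (card K)"]
        by (simp add: a_assoc[symmetric] m_def add.commute)
      then show ?thesis using m aj qi(1) by (simp add: smult_add_right smult_smult)
    qed
    also have "p \<dots> = 1 / m * p (q i \<oplus> (of_nat (card K) \<odot> q i \<oplus> a j))"
      using m aj qi(1) by (subst p_smult) (auto simp: norm_divide)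
    also have "\<dots> \<le> 1 / m * (1 + real (card K))"
      using m aj qi(1) pqi neg0 p_add[of "q i" "of_nat (card K) \<odot> q i \<oplus> a j"]
      by (intro mult_left_mono) auto
    also have "\<dots> = 1" using m by (simp add: m_def add.commute)
    finally show "N (1 + b) \<le> 1" .
  qed
  then have "p (a j) = 0"
    using m N.smult[of "1 / complex_of_real m" "[:0, 1:]"] aj qi(1) qa(1)[OF ij(2)] by (simp add: b' N_def norm_divide)
  moreover have "a j = adj A (q j \<otimes> q i) \<otimes> (q j \<otimes> q i)"
    using q[OF ij(2)] sa[OF ij(2)] idem[OF ij(2)] qi
    by (simp add: a_def adj_mult m_assoc) (simp add: m_assoc[symmetric])
  ultimately have "(p (q j \<otimes> q i))\<^sup>2 = 0" using q ij p_adj_mult[of "q j \<otimes> q i"] by simp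
  moreover have "adj A (q j \<otimes> q i) = q i \<otimes> q j" using q sa ij by (simp add: adj_mult)
  ultimately show ?thesis using p_adj[of "q j \<otimes> q i"] q ij by simp
qed

end

section \<open>Universal seminorms, quotients and completions\<close>

lemma universal_seminorm_upper:
  assumes "x \<in> carrier A" "cstar_seminorm A p" "\<And>r. r \<in> R \<Longrightarrow> p r = 0"
    and bdd: "\<And>x. x \<in> carrier A \<Longrightarrow> \<exists>K. \<forall>p. cstar_seminorm A p \<longrightarrow> (\<forall>r\<in>R. p r = 0) \<longrightarrow> p x \<le> K"
  shows "p x \<le> universal_seminorm A R x"
  unfolding universal_seminorm_def
proof (rule cSUP_upper)
  obtain K where "\<forall>p. cstar_seminorm A p \<longrightarrow> (\<forall>r\<in>R. p r = 0) \<longrightarrow> p x \<le> K" using bdd assms(1) by blast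
  then show "bdd_above ((\<lambda>p. p x) ` {p. cstar_seminorm A p \<and> (\<forall>r\<in>R. p r = 0)})"
    by (intro bdd_aboveI2[of _ _ K]) auto
qed (use assms in auto)

lemma universal_seminorm_least:
  assumes "\<And>p. cstar_seminorm A p \<Longrightarrow> (\<And>r. r \<in> R \<Longrightarrow> p r = 0) \<Longrightarrow> p x \<le> t"
  shows "universal_seminorm A R x \<le> t"
  unfolding universal_seminorm_def
proof (rule cSUP_least)
  have "(\<lambda>_. 0) \<in> {p. cstar_seminorm A p \<and> (\<forall>r\<in>R. p r = 0)}" by (simp add: cstar_seminorm_def)
  then show "{p. cstar_seminorm A p \<and> (\<forall>r\<in>R. p r = 0)} \<noteq> {}" by blast
qed (use assms in auto)

text \<open>
  A pointwise supremum of C*-seminorms is one: squaring is monotone on nonnegative reals, so it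
  commutes with the supremum in the C*-identity.
\<close>

lemma universal_seminorm_cstar:
  assumes A: "star_algebra A"
    and bdd: "\<And>x. x \<in> carrier A \<Longrightarrow> \<exists>K. \<forall>p. cstar_seminorm A p \<longrightarrow> (\<forall>r\<in>R. p r = 0) \<longrightarrow> p x \<le> K"
  shows "cstar_seminorm A (universal_seminorm A R)"
    and "r \<in> R \<Longrightarrow> r \<in> carrier A \<Longrightarrow> universal_seminorm A R r = 0"
proof -
  interpret A: star_algebra A by fact
  let ?q = "universal_seminorm A R"
  note up = universal_seminorm_upper[where R = R, OF _ _ _ bdd]
  have zero: "cstar_seminorm A (\<lambda>_. 0)" by (simp add: cstar_seminorm_def)
  have nn: "0 \<le> ?q x" if "x \<in> carrier A" for x using up[OF that zero] by simp
  have int: "cstar_seminormed A p" if "cstar_seminorm A p" for p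
    using A that by (rule cstar_seminormedI)
  show "?q r = 0" if "r \<in> R" "r \<in> carrier A"
    using nn[OF that(2)] universal_seminorm_least[of A R r 0] that by (intro antisym) auto
  have add: "?q (x \<oplus>\<^bsub>A\<^esub> y) \<le> ?q x + ?q y" if xy: "x \<in> carrier A" "y \<in> carrier A" for x y
  proof (rule universal_seminorm_least)
    fix p assume p: "cstar_seminorm A p" "\<And>r. r \<in> R \<Longrightarrow> p r = 0"
    interpret p: cstar_seminormed A p using p by (intro int)
    show "p (x \<oplus>\<^bsub>A\<^esub> y) \<le> ?q x + ?q y"
      using p.p_add[OF xy] up[OF xy(1) p] up[OF xy(2) p] by linarith
  qed
  have smult_le: "?q (c \<odot>\<^bsub>A\<^esub> x) \<le> cmod c * ?q x" if x: "x \<in> carrier A" for c x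
  proof (rule universal_seminorm_least)
    fix p assume p: "cstar_seminorm A p" "\<And>r. r \<in> R \<Longrightarrow> p r = 0"
    interpret p: cstar_seminormed A p using p by (intro int)
    show "p (c \<odot>\<^bsub>A\<^esub> x) \<le> cmod c * ?q x"
      using p.p_smult[OF x] up[OF x p] by (simp add: mult_left_mono)
  qed
  have mult: "?q (x \<otimes>\<^bsub>A\<^esub> y) \<le> ?q x * ?q y" if xy: "x \<in> carrier A" "y \<in> carrier A" for x y
  proof (rule universal_seminorm_least)
    fix p assume p: "cstar_seminorm A p" "\<And>r. r \<in> R \<Longrightarrow> p r = 0"
    interpret p: cstar_seminormed A p using p by (intro int)
    have "p x * p y \<le> ?q x * ?q y"
      using up[OF xy(1) p] up[OF xy(2) p] nn xy by (intro mult_mono) (auto simp: p.p_nonneg)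
    then show "p (x \<otimes>\<^bsub>A\<^esub> y) \<le> ?q x * ?q y" using p.p_mult[OF xy] by linarith
  qed
  have adj: "?q (adj A x) \<le> ?q x" if x: "x \<in> carrier A" for x
  proof (rule universal_seminorm_least)
    fix p assume p: "cstar_seminorm A p" "\<And>r. r \<in> R \<Longrightarrow> p r = 0"
    interpret p: cstar_seminormed A p using p by (intro int)
    show "p (adj A x) \<le> ?q x" using up[OF x p] x by simp
  qed
  have square: "(?q x)\<^sup>2 \<le> ?q (adj A x \<otimes>\<^bsub>A\<^esub> x)" if x: "x \<in> carrier A" for x
  proof -
    have xx: "adj A x \<otimes>\<^bsub>A\<^esub> x \<in> carrier A" using x by simp
    have "?q x \<le> sqrt (?q (adj A x \<otimes>\<^bsub>A\<^esub> x))"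
    proof (rule universal_seminorm_least)
      fix p assume p: "cstar_seminorm A p" "\<And>r. r \<in> R \<Longrightarrow> p r = 0"
      interpret p: cstar_seminormed A p using p by (intro int)
      show "p x \<le> sqrt (?q (adj A x \<otimes>\<^bsub>A\<^esub> x))"
        using up[OF xx p] by (intro real_le_rsqrt) (simp add: p.p_adj_mult x)
    qed
    then have "(?q x)\<^sup>2 \<le> (sqrt (?q (adj A x \<otimes>\<^bsub>A\<^esub> x)))\<^sup>2" using nn[OF x] by (intro power_mono)
    then show ?thesis using nn[OF xx] by simp
  qed
  show "cstar_seminorm A ?q" by (intro A.cstar_seminormI nn add smult_le mult adj square)
qed

subsection \<open>Quotients\<close>

lemma (in star_algebra) rcos_eq_iff:
  assumes J: "ideal J A" and xy: "x \<in> carrier A" "y \<in> carrier A"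
  shows "J +> x = J +> y \<longleftrightarrow> x \<ominus> y \<in> J"
  using quotient_eq_iff_same_a_r_cos[OF J xy] by simp

lemma (in star_algebra) rcos_zero_iff:
  assumes J: "ideal J A" and x: "x \<in> carrier A"
  shows "J +> x = J \<longleftrightarrow> x \<in> J"
proof -
  interpret J: ideal J A by fact
  show ?thesis using rcos_eq_iff[OF J x zero_closed] J.a_rcos_const[OF J.zero_closed] x
    by (simp add: minus_eq)
qed

text \<open>
  The scalar multiplication and the adjoint of a quotient algebra are unions over representatives;
  stability of the ideal makes all members of the union equal.
\<close>

locale star_ideal = star_algebra A + ideal J A
  for A :: "('a, 'm) normed_star_alg_scheme" (structure) and J +
  assumes adj_ideal: "x \<in> J \<Longrightarrow> adj A x \<in> J"
begin

abbreviation "Q \<equiv> quotient_alg A J"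

lemma rcos_mem: "y \<in> J +> x \<longleftrightarrow> (\<exists>j\<in>J. y = j \<oplus> x)"
  by (auto simp: a_r_coset_def')

lemma quotient_carrier: "carrier Q = (\<lambda>x. J +> x) ` carrier A"
  by (auto simp: quotient_alg_def FactRing_def A_RCOSETS_def')

lemma quotient_zero: "\<zero>\<^bsub>Q\<^esub> = J"
  by (simp add: quotient_alg_def FactRing_def)

lemma rcos_star_hom: "(\<lambda>x. J +> x) \<in> star_hom A Q"
  unfolding star_hom_def
proof (intro CollectI conjI ring_hom_memI ballI allI)
  fix x y and c :: complex assume x: "x \<in> carrier A"
  show "J +> x \<in> carrier Q" using x by (simp add: quotient_carrier)
  show "J +> (x \<otimes> y) = (J +> x) \<otimes>\<^bsub>Q\<^esub> (J +> y)" if "y \<in> carrier A"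
    using that x by (simp add: quotient_alg_def FactRing_def rcoset_mult_add)
  show "J +> (x \<oplus> y) = (J +> x) \<oplus>\<^bsub>Q\<^esub> (J +> y)" if "y \<in> carrier A"
    using that x by (simp add: quotient_alg_def FactRing_def a_rcos_sum)
  show "J +> (c \<odot> x) = c \<odot>\<^bsub>Q\<^esub> (J +> x)"
  proof -
    have "J +> (c \<odot> y) = J +> (c \<odot> x)" if y: "y \<in> J +> x" for y
    proof -
      obtain j where j: "j \<in> J" "y = j \<oplus> x" using y rcos_mem by auto
      have "c \<odot> y \<ominus> c \<odot> x = c \<odot> j" using j x
        by (simp add: smult_add_right minus_eq a_assoc r_neg)
      then show ?thesis using j x ideal_smult[OF is_ideal j(1), of c] by (simp add: rcos_eq_iff[OF is_ideal])
    qed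
    then have "(\<Union>y\<in>J +> x. J +> (c \<odot> y)) = J +> (c \<odot> x)" using x by (intro UN_constant_eq[OF a_rcos_self]) blast+
    then show ?thesis by (simp add: quotient_alg_def)
  qed
  show "J +> adj A x = adj Q (J +> x)"
  proof -
    have "J +> adj A y = J +> adj A x" if y: "y \<in> J +> x" for y
    proof -
      obtain j where j: "j \<in> J" "y = j \<oplus> x" using y rcos_mem by auto
      have "adj A y \<ominus> adj A x = adj A j" using j x
        by (simp add: adj_add minus_eq a_assoc r_neg)
      then show ?thesis using j x adj_ideal[OF j(1)] by (simp add: rcos_eq_iff[OF is_ideal])
    qed
    then have "(\<Union>y\<in>J +> x. J +> adj A y) = J +> adj A x" using x by (intro UN_constant_eq[OF a_rcos_self]) blast+
    then show ?thesis by (simp add: quotient_alg_def)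
  qed
next
  show "J +> \<one> = \<one>\<^bsub>Q\<^esub>" by (simp add: quotient_alg_def FactRing_def)
qed

lemma quotient_star_algebra: "star_algebra Q"
proof (rule star_algebra_image[OF star_algebra_axioms rcos_star_hom])
  show "J +> \<zero> = \<zero>\<^bsub>Q\<^esub>" by (simp add: rcos_zero_iff[OF is_ideal] quotient_zero)
qed (simp add: quotient_carrier)

text \<open>
  The norm of a coset is an infimum over its elements, hence the distance to the ideal, so that the
  theorem on quotient seminorms applies to quotient algebras.
\<close>

lemma quotient_nrm:
  assumes x: "x \<in> carrier A"
  shows "nrm Q (J +> x) = quotient_seminorm A (nrm A) J x"
proof -
  have "J +> x = (\<lambda>j. x \<ominus> j) ` J"
  proof safe
    fix y assume "y \<in> J +> x"
    then obtain j where j: "j \<in> J" "y = j \<oplus> x" using rcos_mem by auto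
    then have "y = x \<ominus> (\<ominus> j)" using x by (simp add: minus_eq a_comm)
    then show "y \<in> (\<lambda>j. x \<ominus> j) ` J" using j by auto
  next
    fix j assume "j \<in> J"
    then have "x \<ominus> j = \<ominus> j \<oplus> x" "\<ominus> j \<in> J" using x by (auto simp: minus_eq a_comm)
    then show "x \<ominus> j \<in> J +> x" using rcos_mem by blast
  qed
  then show ?thesis by (simp add: quotient_alg_def quotient_seminorm_def image_image)
qed

lemma quotient_nrm_cstar:
  assumes "cstar_seminorm A (nrm A)"
  shows "cstar_seminorm Q (nrm Q)"
proof -
  interpret p: cstar_seminormed A "nrm A" using star_algebra_axioms assms by (rule cstar_seminormedI)
  have q: "cstar_seminorm A (quotient_seminorm A (nrm A) J)"
    using p.quotient_cstar_seminorm[OF is_ideal adj_ideal] by blast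
  then interpret q: cstar_seminormed A "quotient_seminorm A (nrm A) J"
    by unfold_locales
  note h = star_homD(2-6)[OF rcos_star_hom, symmetric]
  show ?thesis unfolding cstar_seminorm_def quotient_carrier
    by (auto simp: h quotient_nrm q.p_nonneg q.p_add q.p_smult q.p_mult q.p_adj_mult)
qed

end

lemma closed_star_idealD:
  assumes "star_algebra A" "closed_star_ideal A J"
  shows "star_ideal A J"
  using assms by (simp add: star_ideal_def closed_star_ideal_def star_ideal_axioms_def)

lemma generated_ideal_closed:
  assumes A: "star_algebra A" and p: "\<And>x y. x \<in> carrier A \<Longrightarrow> y \<in> carrier A \<Longrightarrow> 0 \<le> nrm A (x \<ominus>\<^bsub>A\<^esub> y)"
    and S: "S \<subseteq> carrier A"
  shows "closed_star_ideal A (generated_ideal A S)" "S \<subseteq> generated_ideal A S"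
    "closed_star_ideal A J \<Longrightarrow> S \<subseteq> J \<Longrightarrow> generated_ideal A S \<subseteq> J"
proof -
  interpret A: star_algebra A by fact
  let ?F = "{J. closed_star_ideal A J \<and> S \<subseteq> J}"
  have "closed_star_ideal A (carrier A)"
    unfolding closed_star_ideal_def using A.oneideal by auto
  then have ne: "?F \<noteq> {}" using S by blast
  have "ideal (\<Inter> ?F) A" using ne by (intro A.i_Intersect) (auto simp: closed_star_ideal_def)
  moreover have "\<forall>x\<in>\<Inter> ?F. adj A x \<in> \<Inter> ?F" by (auto simp: closed_star_ideal_def)
  moreover have "x \<in> \<Inter> ?F" if x: "x \<in> carrier A" "\<forall>e>0. \<exists>y\<in>\<Inter> ?F. nrm A (x \<ominus>\<^bsub>A\<^esub> y) < e" for x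
  proof
    fix J assume J: "J \<in> ?F"
    then have "\<forall>e>0. \<exists>y\<in>J. nrm A (x \<ominus>\<^bsub>A\<^esub> y) < e" using x(2) by (meson InterD)
    then show "x \<in> J" using x(1) J unfolding closed_star_ideal_def by blast
  qed
  ultimately show "closed_star_ideal A (generated_ideal A S)"
    unfolding generated_ideal_def closed_star_ideal_def[of A "\<Inter> ?F"] by blast
qed (auto simp: generated_ideal_def)

subsection \<open>Completions\<close>

definition completion :: "('a, 'm) star_alg_scheme \<Rightarrow> ('a \<Rightarrow> real) \<Rightarrow> (nat \<Rightarrow> 'a) set normed_star_alg" where
  "completion A p = quotient_alg (cauchy_alg A p) (null_seqs A p)"

definition completion_emb :: "('a, 'm) star_alg_scheme \<Rightarrow> ('a \<Rightarrow> real) \<Rightarrow> 'a \<Rightarrow> (nat \<Rightarrow> 'a) set" where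
  "completion_emb A p x = null_seqs A p +>\<^bsub>cauchy_alg A p\<^esub> (\<lambda>k. x)"

lemma universal_cstar_completion:
  "universal_cstar A R = completion A (universal_seminorm A R)"
  "universal_emb A R = completion_emb A (universal_seminorm A R)"
  by (simp_all add: universal_cstar_def completion_def universal_emb_def completion_emb_def fun_eq_iff)

context cstar_seminormed
begin

abbreviation "C \<equiv> cauchy_alg A p"

lemma cauchy_carrier:
  "s \<in> carrier C \<longleftrightarrow> (\<forall>k. s k \<in> carrier A) \<and> (\<forall>e>0. \<exists>N. \<forall>m\<ge>N. \<forall>k\<ge>N. p (s m \<ominus> s k) < e)"
  by (simp add: cauchy_alg_def)

lemma cauchy_ops [simp]:
  "s \<otimes>\<^bsub>C\<^esub> t = (\<lambda>k. s k \<otimes> t k)" "\<one>\<^bsub>C\<^esub> = (\<lambda>k. \<one>)" "\<zero>\<^bsub>C\<^esub> = (\<lambda>k. \<zero>)"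
  "s \<oplus>\<^bsub>C\<^esub> t = (\<lambda>k. s k \<oplus> t k)" "c \<odot>\<^bsub>C\<^esub> s = (\<lambda>k. c \<odot> s k)" "adj C s = (\<lambda>k. adj A (s k))"
  by (simp_all add: cauchy_alg_def)

lemma cauchyD: "s \<in> carrier C \<Longrightarrow> s k \<in> carrier A"
  by (simp add: cauchy_carrier)

lemma cauchy_dist_eventually:
  assumes "s \<in> carrier C" "0 < e"
  shows "\<exists>N. \<forall>m\<ge>N. \<forall>k\<ge>N. p (s m \<ominus> s k) < e"
  using assms by (simp add: cauchy_carrier)

lemma cauchy_norm_tendsto:
  assumes s: "s \<in> carrier C"
  shows "(\<lambda>k. p (s k)) \<longlonglongrightarrow> nrm C s"
proof -
  have "Cauchy (\<lambda>k. p (s k))"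
  proof (rule metric_CauchyI)
    fix e :: real assume "0 < e"
    then obtain N where N: "\<forall>m\<ge>N. \<forall>k\<ge>N. p (s m \<ominus> s k) < e" using cauchy_dist_eventually[OF s] by blast
    have "dist (p (s m)) (p (s n)) < e" if "m \<ge> N" "n \<ge> N" for m n
      using p_diff_ge[OF cauchyD[OF s] cauchyD[OF s], of m n] N that
      unfolding dist_real_def by (meson le_less_trans)
    then show "\<exists>M. \<forall>m\<ge>M. \<forall>n\<ge>M. dist (p (s m)) (p (s n)) < e" by blast
  qed
  then have "convergent (\<lambda>k. p (s k))" by (rule Cauchy_convergent)
  then show ?thesis by (simp add: cauchy_alg_def convergent_LIMSEQ_iff)
qed

lemma cauchy_bounded:
  assumes s: "s \<in> carrier C"
  shows "\<exists>K>0. \<forall>k. p (s k) \<le> K"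
proof -
  have "Bseq (\<lambda>k. p (s k))" using cauchy_norm_tendsto[OF s] by (rule convergentI[THEN convergent_imp_Bseq])
  then obtain K where "K > 0" "\<forall>k. norm (p (s k)) \<le> K" by (auto simp: Bseq_def)
  then show ?thesis by (intro exI[of _ K]) (auto simp: abs_le_iff)
qed

lemma cauchy_closed:
  assumes s: "s \<in> carrier C" and t: "t \<in> carrier C"
  shows "(\<lambda>k. s k \<oplus> t k) \<in> carrier C" "(\<lambda>k. s k \<otimes> t k) \<in> carrier C"
    "(\<lambda>k. c \<odot> s k) \<in> carrier C" "(\<lambda>k. adj A (s k)) \<in> carrier C"
proof -
  note sc = cauchyD[OF s] and tc = cauchyD[OF t]
  show "(\<lambda>k. s k \<oplus> t k) \<in> carrier C" unfolding cauchy_carrier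
  proof (intro conjI allI impI)
    fix e :: real assume "0 < e"
    then obtain M N where MN: "\<forall>m\<ge>M. \<forall>k\<ge>M. p (s m \<ominus> s k) < e/2" "\<forall>m\<ge>N. \<forall>k\<ge>N. p (t m \<ominus> t k) < e/2"
      using cauchy_dist_eventually[OF s, of "e/2"] cauchy_dist_eventually[OF t, of "e/2"] by auto
    have "p ((s m \<oplus> t m) \<ominus> (s k \<oplus> t k)) < e" if "m \<ge> max M N" "k \<ge> max M N" for m k
    proof -
      have "(s m \<oplus> t m) \<ominus> (s k \<oplus> t k) = (s m \<ominus> s k) \<oplus> (t m \<ominus> t k)" 
        using sc[of m] sc[of k] tc[of m] tc[of k] by algebra
      then have "p ((s m \<oplus> t m) \<ominus> (s k \<oplus> t k)) \<le> p (s m \<ominus> s k) + p (t m \<ominus> t k)"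
        using p_add[of "s m \<ominus> s k" "t m \<ominus> t k"] sc tc by simp
      moreover have "p (s m \<ominus> s k) < e/2" "p (t m \<ominus> t k) < e/2" using MN that by auto
      ultimately show ?thesis by simp
    qed
    then show "\<exists>N. \<forall>m\<ge>N. \<forall>k\<ge>N. p ((s m \<oplus> t m) \<ominus> (s k \<oplus> t k)) < e" by blast
  qed (use sc tc in simp)
  show "(\<lambda>k. s k \<otimes> t k) \<in> carrier C" unfolding cauchy_carrier
  proof (intro conjI allI impI)
    fix e :: real assume e: "0 < e"
    obtain K L where KL: "K > 0" "\<And>k. p (s k) \<le> K" "L > 0" "\<And>k. p (t k) \<le> L"
      using cauchy_bounded[OF s] cauchy_bounded[OF t] by auto
    obtain M N where MN: "\<forall>m\<ge>M. \<forall>k\<ge>M. p (s m \<ominus> s k) < e/(2*L)" "\<forall>m\<ge>N. \<forall>k\<ge>N. p (t m \<ominus> t k) < e/(2*K)"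
      using cauchy_dist_eventually[OF s, of "e/(2*L)"] cauchy_dist_eventually[OF t, of "e/(2*K)"] e KL by auto
    have "p (s m \<otimes> t m \<ominus> s k \<otimes> t k) < e" if "m \<ge> max M N" "k \<ge> max M N" for m k
    proof -
      have lt: "p (s m \<ominus> s k) < e/(2*L)" "p (t m \<ominus> t k) < e/(2*K)" using MN that by auto
      have "s m \<otimes> t m \<ominus> s k \<otimes> t k = (s m \<ominus> s k) \<otimes> t m \<oplus> s k \<otimes> (t m \<ominus> t k)" 
        using sc[of m] sc[of k] tc[of m] tc[of k] by algebra
      then have "p (s m \<otimes> t m \<ominus> s k \<otimes> t k) \<le> p ((s m \<ominus> s k) \<otimes> t m) + p (s k \<otimes> (t m \<ominus> t k))"
        using p_add[of "(s m \<ominus> s k) \<otimes> t m" "s k \<otimes> (t m \<ominus> t k)"] sc tc by simp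
      also have "\<dots> \<le> p (s m \<ominus> s k) * p (t m) + p (s k) * p (t m \<ominus> t k)"
        using sc tc by (intro add_mono p_mult) auto
      also have "\<dots> \<le> p (s m \<ominus> s k) * L + K * p (t m \<ominus> t k)"
        using sc tc KL by (intro add_mono mult_mono) (auto intro: p_nonneg)
      also have "\<dots> < e/(2*L) * L + K * (e/(2*K))"
        using lt KL by (intro add_strict_mono mult_strict_left_mono mult_strict_right_mono) auto
      also have "\<dots> = e" using KL by simp
      finally show ?thesis .
    qed
    then show "\<exists>N. \<forall>m\<ge>N. \<forall>k\<ge>N. p (s m \<otimes> t m \<ominus> s k \<otimes> t k) < e" by blast
  qed (use sc tc in simp)
  show "(\<lambda>k. c \<odot> s k) \<in> carrier C" unfolding cauchy_carrier
  proof (intro conjI allI impI)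
    fix e :: real assume e: "0 < e"
    obtain N where N: "\<forall>m\<ge>N. \<forall>k\<ge>N. p (s m \<ominus> s k) < e/(cmod c + 1)"
      using cauchy_dist_eventually[OF s, of "e/(cmod c + 1)"] e by (auto simp: add_nonneg_pos)
    have "p (c \<odot> s m \<ominus> c \<odot> s k) < e" if "m \<ge> N" "k \<ge> N" for m k
    proof -
      have "p (c \<odot> s m \<ominus> c \<odot> s k) = cmod c * p (s m \<ominus> s k)"
        using sc by (simp add: smult_diff[symmetric] p_smult)
      also have "\<dots> \<le> (cmod c + 1) * p (s m \<ominus> s k)"
        using sc by (intro mult_right_mono p_nonneg) auto
      also have "\<dots> < (cmod c + 1) * (e/(cmod c + 1))"
        using N that by (intro mult_strict_left_mono) (auto simp: add_nonneg_pos)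
      also have "\<dots> = e" using norm_ge_zero[of c] by (simp add: add_nonneg_eq_0_iff)
      finally show ?thesis .
    qed
    then show "\<exists>N. \<forall>m\<ge>N. \<forall>k\<ge>N. p (c \<odot> s m \<ominus> c \<odot> s k) < e" by blast
  qed (use sc in simp)
  have "p (adj A (s m) \<ominus> adj A (s k)) = p (s m \<ominus> s k)" for m k
    using sc p_adj[of "s m \<ominus> s k"] by (simp add: adj_diff)
  then show "(\<lambda>k. adj A (s k)) \<in> carrier C" using s by (simp add: cauchy_carrier)
qed

lemma const_cauchy: "x \<in> carrier A \<Longrightarrow> (\<lambda>k. x) \<in> carrier C"
  by (simp add: cauchy_carrier minus_eq r_neg)

lemma cauchy_star_algebra: "star_algebra C"
proof -
  note c = cauchy_closed cauchyD const_cauchy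
  have "ring C"
  proof (intro ringI abelian_groupI monoidI)
    fix s assume s: "s \<in> carrier C"
    show "\<exists>t\<in>carrier C. t \<oplus>\<^bsub>C\<^esub> s = \<zero>\<^bsub>C\<^esub>"
    proof
      show "(\<lambda>k. (-1) \<odot> s k) \<in> carrier C" using cauchy_closed(3)[OF s s] .
      show "(\<lambda>k. (-1) \<odot> s k) \<oplus>\<^bsub>C\<^esub> s = \<zero>\<^bsub>C\<^esub>"
        using cauchyD[OF s] by (simp add: minus_eq_smult[symmetric] l_neg)
    qed
  qed (auto simp: c a_ac m_assoc l_distr r_distr fun_eq_iff)
  then interpret C: ring C .
  show ?thesis
    by unfold_locales (auto simp: c fun_eq_iff smult_add_left smult_add_right smult_smult
      smult_mult_left smult_mult_right adj_add adj_mult adj_smult)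
qed

lemma cauchy_minus: assumes "s \<in> carrier C" "t \<in> carrier C" shows "s \<ominus>\<^bsub>C\<^esub> t = (\<lambda>k. s k \<ominus> t k)"
proof -
  interpret C: star_algebra C by (rule cauchy_star_algebra)
  show ?thesis using assms cauchyD[OF assms(1)] cauchyD[OF assms(2)]
    by (simp add: C.minus_eq C.minus_eq_smult minus_eq minus_eq_smult)
qed

lemma cauchy_nrm_cstar: "cstar_seminorm C (nrm C)"
  unfolding cstar_seminorm_def
proof (intro conjI ballI allI)
  interpret C: star_algebra C by (rule cauchy_star_algebra)
  note L = cauchy_norm_tendsto
  fix s t c assume s: "s \<in> carrier C"
  show "0 \<le> nrm C s"
    by (rule LIMSEQ_le_const[OF L[OF s]]) (auto simp: p_nonneg cauchyD[OF s])
  have "(\<lambda>k. p (c \<odot> s k)) \<longlonglongrightarrow> nrm C (c \<odot>\<^bsub>C\<^esub> s)" using L[OF C.smult_closed[OF s, of c]] by simp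
  then show "nrm C (c \<odot>\<^bsub>C\<^esub> s) = cmod c * nrm C s"
    by (rule LIMSEQ_unique) (use tendsto_mult_left[OF L[OF s], of "cmod c"] in \<open>simp add: p_smult cauchyD[OF s]\<close>)
  have "(\<lambda>k. p (adj A (s k) \<otimes> s k)) \<longlonglongrightarrow> nrm C (adj C s \<otimes>\<^bsub>C\<^esub> s)"
    using L[OF C.m_closed[OF C.adj_closed[OF s] s]] by simp
  then show "nrm C (adj C s \<otimes>\<^bsub>C\<^esub> s) = (nrm C s)\<^sup>2"
    by (rule LIMSEQ_unique) (use tendsto_power[OF L[OF s], of 2] in \<open>simp add: p_adj_mult cauchyD[OF s]\<close>)
  assume t: "t \<in> carrier C"
  show "nrm C (s \<oplus>\<^bsub>C\<^esub> t) \<le> nrm C s + nrm C t"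
    by (rule LIMSEQ_le[OF L[OF C.a_closed[OF s t]] tendsto_add[OF L[OF s] L[OF t]]])
       (auto simp: p_add cauchyD[OF s] cauchyD[OF t])
  show "nrm C (s \<otimes>\<^bsub>C\<^esub> t) \<le> nrm C s * nrm C t"
    by (rule LIMSEQ_le[OF L[OF C.m_closed[OF s t]] tendsto_mult[OF L[OF s] L[OF t]]])
       (auto simp: p_mult cauchyD[OF s] cauchyD[OF t])
qed

lemma null_seqs_eq: "null_seqs A p = {s \<in> carrier C. nrm C s = 0}"
  using cauchy_norm_tendsto by (auto simp: null_seqs_def intro: LIMSEQ_unique) (metis)

lemma null_seqs_ideal: "star_ideal C (null_seqs A p)"
proof -
  interpret C: cstar_seminormed C "nrm C"
    by (rule cstar_seminormedI[OF cauchy_star_algebra cauchy_nrm_cstar])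
  have nn: "nrm C s \<le> 0 \<Longrightarrow> s \<in> carrier C \<Longrightarrow> nrm C s = 0" for s using C.p_nonneg[of s] by simp
  have "ideal (null_seqs A p) C"
  proof (rule idealI[OF C.ring_axioms])
    show "subgroup (null_seqs A p) (add_monoid C)"
    proof
      fix s t assume st: "s \<in> null_seqs A p" "t \<in> null_seqs A p"
      then show "s \<otimes>\<^bsub>add_monoid C\<^esub> t \<in> null_seqs A p"
        using C.p_add[of s t] nn[of "s \<oplus>\<^bsub>C\<^esub> t"] by (simp del: cauchy_ops add: null_seqs_eq)
      from st show "inv\<^bsub>add_monoid C\<^esub> s \<in> null_seqs A p"
        using C.p_minus[of s] by (simp del: cauchy_ops add: null_seqs_eq a_inv_def[symmetric])
    qed (auto simp: null_seqs_eq simp del: cauchy_ops)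
  next
    fix s t assume st: "s \<in> null_seqs A p" "t \<in> carrier C"
    then show "t \<otimes>\<^bsub>C\<^esub> s \<in> null_seqs A p" "s \<otimes>\<^bsub>C\<^esub> t \<in> null_seqs A p"
      using C.p_mult[of s t] C.p_mult[of t s] nn[of "s \<otimes>\<^bsub>C\<^esub> t"] nn[of "t \<otimes>\<^bsub>C\<^esub> s"]
      by (simp_all del: cauchy_ops add: null_seqs_eq)
  qed
  then show ?thesis using C.star_algebra_axioms
    by (auto simp: star_ideal_def star_ideal_axioms_def null_seqs_eq simp del: cauchy_ops)
qed

lemma completion_facts:
  shows "star_algebra (completion A p)"
    and "cstar_seminorm (completion A p) (nrm (completion A p))"
    and "(\<lambda>s. null_seqs A p +>\<^bsub>C\<^esub> s) \<in> star_hom C (completion A p)"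
    and "carrier (completion A p) = (\<lambda>s. null_seqs A p +>\<^bsub>C\<^esub> s) ` carrier C"
    and "\<zero>\<^bsub>completion A p\<^esub> = null_seqs A p"
    and "completion_emb A p \<in> star_hom A (completion A p)"
proof -
  interpret N: star_ideal C "null_seqs A p" by (rule null_seqs_ideal)
  show "star_algebra (completion A p)" 
    "cstar_seminorm (completion A p) (nrm (completion A p))"
    "carrier (completion A p) = (\<lambda>s. null_seqs A p +>\<^bsub>C\<^esub> s) ` carrier C"
    "\<zero>\<^bsub>completion A p\<^esub> = null_seqs A p"
    unfolding completion_def
    using N.quotient_star_algebra N.quotient_nrm_cstar[OF cauchy_nrm_cstar] N.quotient_carrier N.quotient_zero by auto
  show h: "(\<lambda>s. null_seqs A p +>\<^bsub>C\<^esub> s) \<in> star_hom C (completion A p)"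
    unfolding completion_def by (rule N.rcos_star_hom)
  have "(\<lambda>x k. x) \<in> star_hom A C" by (auto simp: star_hom_def intro!: ring_hom_memI const_cauchy)
  from star_hom_comp[OF this h] show "completion_emb A p \<in> star_hom A (completion A p)"
    by (simp add: completion_emb_def[abs_def])
qed

text \<open>
  Null sequences do not change limits of norms, so the infimum over a coset is over a constant.
\<close>

lemma completion_nrm:
  assumes s: "s \<in> carrier C"
  shows "nrm (completion A p) (null_seqs A p +>\<^bsub>C\<^esub> s) = nrm C s"
proof -
  interpret C: cstar_seminormed C "nrm C"
    by (rule cstar_seminormedI[OF cauchy_star_algebra cauchy_nrm_cstar])
  interpret N: star_ideal C "null_seqs A p" by (rule null_seqs_ideal)
  have "nrm C (s \<ominus>\<^bsub>C\<^esub> j) = nrm C s" if "j \<in> null_seqs A p" for j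
  proof -
    have j: "j \<in> carrier C" "nrm C j = 0" using that unfolding null_seqs_eq by blast+
    have "s \<ominus>\<^bsub>C\<^esub> (s \<ominus>\<^bsub>C\<^esub> j) = j" using s j(1) by (simp add: C.minus_eq C.minus_add C.a_assoc[symmetric] C.r_neg del: cauchy_ops)
    then show ?thesis using C.p_diff_ge[of s "s \<ominus>\<^bsub>C\<^esub> j"] s j by (simp del: cauchy_ops)
  qed
  then have "quotient_seminorm C (nrm C) (null_seqs A p) s = (INF j\<in>null_seqs A p. nrm C s)"
    unfolding quotient_seminorm_def by (intro INF_cong) auto
  also have "\<dots> = nrm C s" using N.zero_closed by (intro cINF_const) auto
  finally show ?thesis unfolding completion_def using N.quotient_nrm[OF s] by simp
qed

lemma completion_emb_nrm:
  assumes "x \<in> carrier A"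
  shows "nrm (completion A p) (completion_emb A p x) = p x"
  unfolding completion_emb_def completion_nrm[OF const_cauchy[OF assms]]
  using cauchy_norm_tendsto[OF const_cauchy[OF assms]] by (simp add: LIMSEQ_const_iff)

lemma completion_zero_iff:
  assumes s: "s \<in> carrier C"
  shows "null_seqs A p +>\<^bsub>C\<^esub> s = \<zero>\<^bsub>completion A p\<^esub> \<longleftrightarrow> nrm C s = 0"
proof -
  interpret N: star_ideal C "null_seqs A p" by (rule null_seqs_ideal)
  show ?thesis using N.rcos_zero_iff[OF N.is_ideal s] s unfolding completion_facts(5) null_seqs_eq by blast
qed

lemma completion_nrm_zero:
  assumes X: "X \<in> carrier (completion A p)" "nrm (completion A p) X = 0"
  shows "X = \<zero>\<^bsub>completion A p\<^esub>"
proof -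
  obtain s where s: "s \<in> carrier C" "X = null_seqs A p +>\<^bsub>C\<^esub> s" using X(1) completion_facts(4) by blast
  then show ?thesis using X(2) completion_nrm[OF s(1)] completion_zero_iff[OF s(1)] by (simp only:)
qed

end

subsection \<open>The quotient of a completion\<close>

lemma (in star_algebra) diff_eq_zero_iff:
  assumes "x \<in> carrier A" "y \<in> carrier A"
  shows "x \<ominus> y = \<zero> \<longleftrightarrow> x = y"
proof
  assume "x \<ominus> y = \<zero>"
  moreover have "x = (x \<ominus> y) \<oplus> y" using assms by algebra
  ultimately show "x = y" using assms by (metis l_zero)
qed (use assms in \<open>simp add: minus_eq r_neg\<close>)

lemma star_hom_eq_iff:
  assumes "star_algebra A" "star_algebra B" "h \<in> star_hom A B" "x \<in> carrier A" "y \<in> carrier A"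
  shows "h x = h y \<longleftrightarrow> h (x \<ominus>\<^bsub>A\<^esub> y) = \<zero>\<^bsub>B\<^esub>"
proof -
  interpret A: star_algebra A by fact
  interpret B: star_algebra B by fact
  show ?thesis using star_homD(1)[OF assms(3)] assms(4,5)
    by (simp add: star_hom_diff[OF assms] B.diff_eq_zero_iff)
qed

lemma star_hom_factor:
  assumes C: "star_algebra C" and A: "star_algebra A" and B: "star_algebra B"
    and f: "f \<in> star_hom C A" "f ` carrier C = carrier A" and g: "g \<in> star_hom C B"
    and ker: "\<And>x. x \<in> carrier C \<Longrightarrow> f x = \<zero>\<^bsub>A\<^esub> \<Longrightarrow> g x = \<zero>\<^bsub>B\<^esub>"
  shows "\<exists>h\<in>star_hom A B. \<forall>x\<in>carrier C. h (f x) = g x"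
proof -
  interpret C: star_algebra C by fact
  define h where "h a = g (SOME x. x \<in> carrier C \<and> f x = a)" for a
  have hf: "h (f x) = g x" if x: "x \<in> carrier C" for x
  proof -
    have "(SOME y. y \<in> carrier C \<and> f y = f x) \<in> carrier C \<and> f (SOME y. y \<in> carrier C \<and> f y = f x) = f x"
      by (rule someI[of _ x]) (simp add: x)
    moreover have "g y = g x" if "y \<in> carrier C" "f y = f x" for y
      using that x ker[of "y \<ominus>\<^bsub>C\<^esub> x"] star_hom_eq_iff[OF C A f(1), of y x] star_hom_eq_iff[OF C B g, of y x]
      by simp
    ultimately show ?thesis by (simp add: h_def)
  qed
  note fs = star_homD(2-6)[OF f(1), symmetric]
  have "h \<in> star_hom A B"
    unfolding star_hom_def f(2)[symmetric]
    by (auto simp: fs hf star_homD[OF g] f(2)[symmetric] intro!: ring_hom_memI)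
  then show ?thesis using hf by blast
qed

lemma star_iso_factor:
  assumes C: "star_algebra C" and A: "star_algebra A" and B: "star_algebra B"
    and f: "f \<in> star_hom C A" "f ` carrier C = carrier A"
    and g: "g \<in> star_hom C B" "g ` carrier C = carrier B"
    and ker: "\<And>x. x \<in> carrier C \<Longrightarrow> f x = \<zero>\<^bsub>A\<^esub> \<longleftrightarrow> g x = \<zero>\<^bsub>B\<^esub>"
  shows "\<exists>h\<in>star_iso A B. \<forall>x\<in>carrier C. h (f x) = g x"
proof -
  interpret C: star_algebra C by fact
  obtain h where h: "h \<in> star_hom A B" "\<And>x. x \<in> carrier C \<Longrightarrow> h (f x) = g x"
    using star_hom_factor[OF C A B f g(1)] ker by blast
  have "inj_on h (f ` carrier C)"
  proof (rule inj_onI, clarsimp)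
    fix x y assume "x \<in> carrier C" "y \<in> carrier C" "h (f x) = h (f y)"
    then show "f x = f y"
      using h(2) ker[of "x \<ominus>\<^bsub>C\<^esub> y"] star_hom_eq_iff[OF C A f(1), of x y] star_hom_eq_iff[OF C B g(1), of x y]
      by simp
  qed
  moreover have "h ` f ` carrier C = carrier B" using h(2) g(2) by (simp add: image_image)
  ultimately have "bij_betw h (carrier A) (carrier B)" unfolding f(2) bij_betw_def by simp
  then have "h \<in> star_iso A B" using h(1) by (auto simp: star_iso_def ring_iso_def star_hom_def)
  then show ?thesis using h by blast
qed

text \<open>
  A Cauchy sequence in the image is lifted after passing to a subsequence with summable steps; each
  step has a lift of almost the same size by assumption, and the lifted steps are summed up.
\<close>

lemma cauchy_lift:
  assumes F: "cstar_seminormed F p" and E: "cstar_seminormed E q"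
    and \<Phi>: "\<Phi> \<in> star_hom F E" "\<Phi> ` carrier F = carrier E"
    and lift: "\<And>t e. t \<in> carrier E \<Longrightarrow> 0 < e \<Longrightarrow> \<exists>x\<in>carrier F. \<Phi> x = t \<and> p x < q t + e"
    and t: "t \<in> carrier (cauchy_alg E q)"
  shows "\<exists>s\<in>carrier (cauchy_alg F p). \<forall>e>0. \<exists>N. \<forall>k\<ge>N. q (\<Phi> (s k) \<ominus>\<^bsub>E\<^esub> t k) < e"
proof -
  interpret F: cstar_seminormed F p by fact
  interpret E: cstar_seminormed E q by fact
  note tc = E.cauchyD[OF t]
  have "\<exists>N\<ge>n. \<forall>m\<ge>N. \<forall>k\<ge>N. q (t m \<ominus>\<^bsub>E\<^esub> t k) < (1/2)^n" for n
  proof -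
    obtain N where N: "\<forall>m\<ge>N. \<forall>k\<ge>N. q (t m \<ominus>\<^bsub>E\<^esub> t k) < (1/2)^n"
      using E.cauchy_dist_eventually[OF t, of "(1/2)^n"] by auto
    then show ?thesis by (intro exI[of _ "max N n"]) auto
  qed
  then obtain M where M: "\<And>n. M n \<ge> n" "\<And>n m k. m \<ge> M n \<Longrightarrow> k \<ge> M n \<Longrightarrow> q (t m \<ominus>\<^bsub>E\<^esub> t k) < (1/2)^n"
    by metis
  \<comment> \<open>an increasing sequence of indices beyond \<open>M\<close>\<close>
  define r where "r n = (\<Sum>i\<le>n. M i)" for n
  have rM: "r n \<ge> M n" "r (Suc n) \<ge> M n" "r n \<ge> n" for n
  proof -
    show "r n \<ge> M n" unfolding r_def by (intro member_le_sum) auto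
    then show "r n \<ge> n" using M(1)[of n] by simp
    have "r (Suc n) \<ge> r n" by (simp add: r_def)
    then show "r (Suc n) \<ge> M n" using \<open>r n \<ge> M n\<close> by simp
  qed
  have "\<exists>s. \<forall>n. (s n \<in> carrier F \<and> \<Phi> (s n) = t (r n)) \<and> p (s (Suc n) \<ominus>\<^bsub>F\<^esub> s n) < 2 * (1/2)^n"
  proof (rule dependent_nat_choice)
    show "\<exists>x. x \<in> carrier F \<and> \<Phi> x = t (r 0)" using lift[OF tc, of 1 "r 0"] by auto
  next
    fix x n assume x: "x \<in> carrier F \<and> \<Phi> x = t (r n)"
    obtain d where d: "d \<in> carrier F" "\<Phi> d = t (r (Suc n)) \<ominus>\<^bsub>E\<^esub> t (r n)"
        "p d < q (t (r (Suc n)) \<ominus>\<^bsub>E\<^esub> t (r n)) + (1/2)^n"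
      using lift[of "t (r (Suc n)) \<ominus>\<^bsub>E\<^esub> t (r n)" "(1/2)^n"] tc by auto
    have "\<Phi> (x \<oplus>\<^bsub>F\<^esub> d) = t (r n) \<oplus>\<^bsub>E\<^esub> (t (r (Suc n)) \<ominus>\<^bsub>E\<^esub> t (r n))"
      using star_homD(2)[OF \<Phi>(1)] x d by simp
    also have "\<dots> = t (r (Suc n))" using tc[of "r n"] tc[of "r (Suc n)"] by algebra
    finally have "\<Phi> (x \<oplus>\<^bsub>F\<^esub> d) = t (r (Suc n))" .
    moreover have "(x \<oplus>\<^bsub>F\<^esub> d) \<ominus>\<^bsub>F\<^esub> x = d" using x d(1) by algebra
    ultimately show "\<exists>y. (y \<in> carrier F \<and> \<Phi> y = t (r (Suc n))) \<and> p (y \<ominus>\<^bsub>F\<^esub> x) < 2 * (1/2)^n"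
      using x d(1,3) M(2)[OF rM(2) rM(1), of n]
      by (intro exI[of _ "x \<oplus>\<^bsub>F\<^esub> d"]) simp
  qed
  then obtain s where s: "\<And>n. s n \<in> carrier F" "\<And>n. \<Phi> (s n) = t (r n)"
    "\<And>n. p (s (Suc n) \<ominus>\<^bsub>F\<^esub> s n) < 2 * (1/2)^n" by blast
  have tail: "p (s (n + d) \<ominus>\<^bsub>F\<^esub> s n) \<le> 4 * (1/2)^n - 4 * (1/2)^(n+d)" for n d
  proof (induction d)
    case 0
    then show ?case using s(1) by (simp add: F.r_neg F.minus_eq)
  next
    case (Suc d)
    then show ?case using F.p_triangle[of "s (Suc (n + d))" "s (n + d)" "s n"] s(1) s(3)[of "n + d"] by simp
  qed
  have small: "\<exists>N. \<forall>n\<ge>N. 8 * (1/2)^n < e" if "0 < e" for e :: real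
  proof -
    have "(\<lambda>n. 8 * (1/2)^n :: real) \<longlonglongrightarrow> 8 * 0" by (intro tendsto_intros LIMSEQ_power_zero) auto
    then have "eventually (\<lambda>n. 8 * (1/2)^n < e) sequentially" using that by (intro order_tendstoD) auto
    then show ?thesis by (simp add: eventually_sequentially)
  qed
  have tail': "p (s m \<ominus>\<^bsub>F\<^esub> s n) \<le> 4 * (1/2)^n" if "n \<le> m" for m n
    using tail[of n "m - n"] that by (smt (verit) le_add_diff_inverse zero_le_power divide_nonneg_nonneg)
  have "s \<in> carrier (cauchy_alg F p)"
    unfolding F.cauchy_carrier
  proof (intro conjI allI impI s)
    fix e :: real assume "0 < e"
    then obtain N where N: "\<forall>n\<ge>N. 8 * (1/2)^n < e" using small by blast
    have "p (s m \<ominus>\<^bsub>F\<^esub> s k) < e" if "m \<ge> N" "k \<ge> N" for m k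
    proof -
      have "p (s m \<ominus>\<^bsub>F\<^esub> s k) \<le> p (s m \<ominus>\<^bsub>F\<^esub> s N) + p (s N \<ominus>\<^bsub>F\<^esub> s k)" using s(1) by (intro F.p_triangle)
      also have "p (s N \<ominus>\<^bsub>F\<^esub> s k) = p (s k \<ominus>\<^bsub>F\<^esub> s N)" using s(1) by (intro F.p_diff_commute)
      also have "p (s m \<ominus>\<^bsub>F\<^esub> s N) + p (s k \<ominus>\<^bsub>F\<^esub> s N) \<le> 4 * (1/2)^N + 4 * (1/2)^N"
        using that by (intro add_mono tail')
      also have "\<dots> < e" using N by simp
      finally show ?thesis .
    qed
    then show "\<exists>N. \<forall>m\<ge>N. \<forall>k\<ge>N. p (s m \<ominus>\<^bsub>F\<^esub> s k) < e" by blast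
  qed
  moreover have "\<exists>N. \<forall>k\<ge>N. q (\<Phi> (s k) \<ominus>\<^bsub>E\<^esub> t k) < e" if e: "0 < e" for e
  proof -
    obtain N where "\<forall>m\<ge>N. \<forall>k\<ge>N. q (t m \<ominus>\<^bsub>E\<^esub> t k) < e" using E.cauchy_dist_eventually[OF t e] by blast
    then show ?thesis using rM(3) s(2) by (metis order_trans)
  qed
  ultimately show ?thesis by blast
qed

text \<open>
  Both sides are quotients of the algebra of Cauchy sequences in \<open>F\<close>: apply \<open>\<Phi>\<close> termwise, or pass to
  the class modulo \<open>J\<close>. So it is enough to compare kernels. The first kernel induces a closed ideal of
  the completion containing \<open>S\<close>, hence \<open>J\<close>. Conversely, if \<open>q (\<Phi> (s k))\<close> tends to \<open>0\<close>, then late terms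
  of \<open>s\<close> are close to the kernel of \<open>\<Phi>\<close>, as \<open>q\<close> is the quotient seminorm, and \<open>J\<close> is closed.
\<close>

theorem completion_quotient_iso:
  assumes F: "cstar_seminormed F p" and E: "cstar_seminormed E q"
    and \<Phi>: "\<Phi> \<in> star_hom F E" "\<Phi> ` carrier F = carrier E"
    and q: "\<And>x. x \<in> carrier F \<Longrightarrow> q (\<Phi> x) = quotient_seminorm F p {y \<in> carrier F. \<Phi> y = \<zero>\<^bsub>E\<^esub>} x"
    and S: "S \<subseteq> carrier F" "\<And>x. x \<in> S \<Longrightarrow> \<Phi> x = \<zero>\<^bsub>E\<^esub>"
    and J_def: "J = generated_ideal (completion F p) (completion_emb F p ` S)"
    and J: "\<And>x. x \<in> carrier F \<Longrightarrow> \<Phi> x = \<zero>\<^bsub>E\<^esub> \<Longrightarrow> completion_emb F p x \<in> J"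
  shows "\<exists>\<phi>\<in>star_iso (completion E q) (quotient_alg (completion F p) J).
    \<forall>x\<in>carrier F. \<phi> (completion_emb E q (\<Phi> x)) = J +>\<^bsub>completion F p\<^esub> completion_emb F p x"
proof -
  interpret F: cstar_seminormed F p by fact
  interpret E: cstar_seminormed E q by fact
  let ?A = "completion F p" and ?B = "completion E q" and ?C = "cauchy_alg F p" and ?D = "cauchy_alg E q"
  let ?K = "{y \<in> carrier F. \<Phi> y = \<zero>\<^bsub>E\<^esub>}"
  let ?a = "\<lambda>s. null_seqs F p +>\<^bsub>?C\<^esub> s" and ?b = "\<lambda>s. null_seqs E q +>\<^bsub>?D\<^esub> s"
  note \<Phi>D = star_homD[OF \<Phi>(1)]
  have zero: "\<Phi> \<zero>\<^bsub>F\<^esub> = \<zero>\<^bsub>E\<^esub>" by (rule star_hom_zero[OF F.star_algebra_axioms E.star_algebra_axioms \<Phi>(1)])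
  note diff = star_hom_diff[OF F.star_algebra_axioms E.star_algebra_axioms \<Phi>(1)]
  have "ring_hom_ring F E \<Phi>"
    using \<Phi>(1) F.ring_axioms E.ring_axioms by (intro ring_hom_ringI2) (auto simp: star_hom_def)
  then have K: "ideal ?K F" using ring_hom_ring.kernel_is_ideal[of F E \<Phi>] by (simp add: a_kernel_def')
  have qle: "q (\<Phi> x) \<le> p x" if "x \<in> carrier F" for x
    using F.quotient_seminorm_le_p[OF K that] q[OF that] by simp
  have lift: "\<exists>x\<in>carrier F. \<Phi> x = t \<and> p x < q t + e" if t: "t \<in> carrier E" and e: "0 < e" for t e
  proof -
    obtain y where y: "y \<in> carrier F" "\<Phi> y = t" using t \<Phi>(2) by (metis imageE)
    obtain j where j: "j \<in> ?K" "p (y \<ominus>\<^bsub>F\<^esub> j) < q t + e"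
      using F.quotient_seminorm_approx[OF K y(1) e] q[OF y(1)] y(2) by auto
    then have "\<Phi> (y \<ominus>\<^bsub>F\<^esub> j) = t" using y diff t by (simp add: E.minus_eq)
    then show ?thesis using y j by (intro bexI[of _ "y \<ominus>\<^bsub>F\<^esub> j"]) auto
  qed
  have A: "star_algebra ?A" and B: "star_algebra ?B" by (rule F.completion_facts E.completion_facts)+
  interpret A: cstar_seminormed ?A "nrm ?A"
    by (rule cstar_seminormedI[OF F.completion_facts(1,2)])
  interpret B: cstar_seminormed ?B "nrm ?B"
    by (rule cstar_seminormedI[OF E.completion_facts(1,2)])
  interpret C: cstar_seminormed ?C "nrm ?C"
    by (rule cstar_seminormedI[OF F.cauchy_star_algebra F.cauchy_nrm_cstar])
  have \<Phi>s: "(\<lambda>k. \<Phi> (s k)) \<in> carrier ?D" if s: "s \<in> carrier ?C" for s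
    unfolding E.cauchy_carrier
  proof (intro conjI allI impI)
    fix e :: real assume "0 < e"
    then obtain N where N: "\<forall>m\<ge>N. \<forall>k\<ge>N. p (s m \<ominus>\<^bsub>F\<^esub> s k) < e" using F.cauchy_dist_eventually[OF s] by blast
    have "q (\<Phi> (s m) \<ominus>\<^bsub>E\<^esub> \<Phi> (s k)) < e" if "m \<ge> N" "k \<ge> N" for m k
      using N that qle[of "s m \<ominus>\<^bsub>F\<^esub> s k"] F.cauchyD[OF s] by (simp add: diff) (meson le_less_trans)
    then show "\<exists>N. \<forall>m\<ge>N. \<forall>k\<ge>N. q (\<Phi> (s m) \<ominus>\<^bsub>E\<^esub> \<Phi> (s k)) < e" by blast
  qed (simp add: \<Phi>D F.cauchyD[OF s])
  define \<Theta> where "\<Theta> s = ?b (\<lambda>k. \<Phi> (s k))" for s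
  have "(\<lambda>s k. \<Phi> (s k)) \<in> star_hom ?C ?D"
    unfolding star_hom_def by (auto simp: \<Phi>s \<Phi>D F.cauchyD intro!: ring_hom_memI)
  then have \<Theta>: "\<Theta> \<in> star_hom ?C ?B"
    unfolding \<Theta>_def[abs_def] using E.completion_facts(3) by (rule star_hom_comp)
  have \<Theta>_nrm: "nrm ?B (\<Theta> s) = nrm ?D (\<lambda>k. \<Phi> (s k))" if "s \<in> carrier ?C" for s
    unfolding \<Theta>_def by (rule E.completion_nrm[OF \<Phi>s[OF that]])
  have \<Theta>_le: "nrm ?B (\<Theta> s) \<le> nrm ?A (?a s)" if s: "s \<in> carrier ?C" for s
    unfolding \<Theta>_nrm[OF s] F.completion_nrm[OF s]
    using E.cauchy_norm_tendsto[OF \<Phi>s[OF s]] F.cauchy_norm_tendsto[OF s]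
    by (rule LIMSEQ_le) (auto intro: qle F.cauchyD[OF s])
  have \<Theta>_surj: "\<Theta> ` carrier ?C = carrier ?B"
  proof (intro equalityI subsetI)
    fix Y assume "Y \<in> carrier ?B"
    then obtain t where t: "t \<in> carrier ?D" "Y = ?b t" using E.completion_facts(4) by blast
    obtain s where s: "s \<in> carrier ?C" "\<forall>e>0. \<exists>N. \<forall>k\<ge>N. q (\<Phi> (s k) \<ominus>\<^bsub>E\<^esub> t k) < e"
      using cauchy_lift[OF F E \<Phi> lift t(1)] by blast
    have d: "(\<lambda>k. \<Phi> (s k) \<ominus>\<^bsub>E\<^esub> t k) = (\<lambda>k. \<Phi> (s k)) \<ominus>\<^bsub>?D\<^esub> t" by (simp add: E.cauchy_minus[OF \<Phi>s[OF s(1)] t(1)])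
    interpret D: star_algebra ?D by (rule E.cauchy_star_algebra)
    have dc: "(\<lambda>k. \<Phi> (s k)) \<ominus>\<^bsub>?D\<^esub> t \<in> carrier ?D" using \<Phi>s[OF s(1)] t(1) by (rule D.minus_closed)
    have "(\<lambda>k. q (\<Phi> (s k) \<ominus>\<^bsub>E\<^esub> t k)) \<longlonglongrightarrow> 0"
      unfolding LIMSEQ_iff using s(2) \<Phi>D(1)[OF F.cauchyD[OF s(1)]] E.cauchyD[OF t(1)] by (simp add: E.p_nonneg)
    then have "nrm ?D ((\<lambda>k. \<Phi> (s k)) \<ominus>\<^bsub>?D\<^esub> t) = 0"
      using E.cauchy_norm_tendsto[OF dc] LIMSEQ_unique unfolding d[symmetric] by blast
    then have "?b ((\<lambda>k. \<Phi> (s k)) \<ominus>\<^bsub>?D\<^esub> t) = \<zero>\<^bsub>?B\<^esub>" using E.completion_zero_iff[OF dc] by blast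
    then have "\<Theta> s = Y"
      using star_hom_eq_iff[OF E.cauchy_star_algebra B E.completion_facts(3) \<Phi>s[OF s(1)] t(1)] unfolding \<Theta>_def t(2) by simp
    then show "Y \<in> \<Theta> ` carrier ?C" using s(1) by blast
  qed (use star_homD(1)[OF \<Theta>] in blast)
  have a_emb: "?a (\<lambda>k. x) = completion_emb F p x" for x by (simp add: completion_emb_def)
  have \<Theta>_emb: "\<Theta> (\<lambda>k. x) = completion_emb E q (\<Phi> x)" for x by (simp add: completion_emb_def \<Theta>_def)
  have aC: "s \<in> carrier ?C \<Longrightarrow> ?a s \<in> carrier ?A" for s using F.completion_facts(4) by blast
  have a_surj: "?a ` carrier ?C = carrier ?A" using F.completion_facts(4) by simp
  obtain th where th: "th \<in> star_hom ?A ?B" "\<And>s. s \<in> carrier ?C \<Longrightarrow> th (?a s) = \<Theta> s"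
  proof -
    have "\<Theta> s = \<zero>\<^bsub>?B\<^esub>" if "s \<in> carrier ?C" "?a s = \<zero>\<^bsub>?A\<^esub>" for s
    proof (rule E.completion_nrm_zero)
      show "\<Theta> s \<in> carrier ?B" using star_homD(1)[OF \<Theta>] that by blast
      then show "nrm ?B (\<Theta> s) = 0" using \<Theta>_le[OF that(1)] B.p_nonneg unfolding that(2) by (simp add: antisym)
    qed
    then show ?thesis
      using star_hom_factor[OF C.star_algebra_axioms A B F.completion_facts(3) a_surj \<Theta>] that by blast
  qed
  have th_le: "nrm ?B (th X) \<le> nrm ?A X" if "X \<in> carrier ?A" for X
  proof -
    have "X \<in> ?a ` carrier ?C" using that unfolding a_surj .
    then obtain s where "s \<in> carrier ?C" "X = ?a s" by (elim imageE)
    then show ?thesis using th(2) \<Theta>_le by simp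
  qed
  have emb: "completion_emb F p x \<in> carrier ?A" if "x \<in> carrier F" for x
    using star_homD(1)[OF F.completion_facts(6) that] .
  have SA: "completion_emb F p ` S \<subseteq> carrier ?A" using S(1) emb by blast
  have nn: "0 \<le> nrm ?A (X \<ominus>\<^bsub>?A\<^esub> Y)" if "X \<in> carrier ?A" "Y \<in> carrier ?A" for X Y
    using that by (intro A.p_nonneg A.minus_closed)
  have Jc: "closed_star_ideal ?A J"
    unfolding J_def by (rule generated_ideal_closed(1)[OF A nn SA])
  have Jmin: "J \<subseteq> I" if "closed_star_ideal ?A I" "completion_emb F p ` S \<subseteq> I" for I
    unfolding J_def by (rule generated_ideal_closed(3)[OF A nn SA that])
  interpret J: star_ideal ?A J by (rule closed_star_idealD[OF A Jc])
  let ?T = "{X \<in> carrier ?A. th X = \<zero>\<^bsub>?B\<^esub>}"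
  have "closed_star_ideal ?A ?T"
    unfolding closed_star_ideal_def
  proof (intro conjI ballI impI)
    have "ring_hom_ring ?A ?B th"
      using th(1) A.ring_axioms B.ring_axioms by (intro ring_hom_ringI2) (auto simp: star_hom_def)
    then show "ideal ?T ?A" using ring_hom_ring.kernel_is_ideal[of ?A ?B th] by (simp add: a_kernel_def')
    fix X assume "X \<in> ?T"
    then show "adj ?A X \<in> ?T" using star_homD(6)[OF th(1), of X] by simp
  next
    fix X assume X: "X \<in> carrier ?A" "\<forall>e>0. \<exists>Y\<in>?T. nrm ?A (X \<ominus>\<^bsub>?A\<^esub> Y) < e"
    have thX: "th X \<in> carrier ?B" using star_homD(1)[OF th(1)] X by blast
    have "nrm ?B (th X) \<le> 0"
    proof (rule field_le_epsilon)
      fix e :: real assume "0 < e"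
      then obtain Y where Y: "Y \<in> carrier ?A" "th Y = \<zero>\<^bsub>?B\<^esub>" "nrm ?A (X \<ominus>\<^bsub>?A\<^esub> Y) < e" using X(2) by blast
      have "th (X \<ominus>\<^bsub>?A\<^esub> Y) = th X" using star_hom_diff[OF A B th(1) X(1) Y(1)] Y(2) thX by (simp add: B.minus_eq)
      then show "nrm ?B (th X) \<le> 0 + e" using th_le[of "X \<ominus>\<^bsub>?A\<^esub> Y"] X(1) Y by simp
    qed
    then show "X \<in> ?T" using E.completion_nrm_zero[OF thX] B.p_nonneg[OF thX] X(1) by simp
  qed
  moreover have "completion_emb F p ` S \<subseteq> ?T"
  proof (rule image_subsetI)
    fix x assume x: "x \<in> S"
    then have xF: "x \<in> carrier F" using S(1) by blast
    have "th (completion_emb F p x) = completion_emb E q (\<Phi> x)"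
      using th(2)[OF F.const_cauchy[OF xF]] by (simp add: a_emb \<Theta>_emb)
    then have "th (completion_emb F p x) = \<zero>\<^bsub>?B\<^esub>"
      using S(2)[OF x] star_hom_zero[OF E.star_algebra_axioms B E.completion_facts(6)] by simp
    then show "completion_emb F p x \<in> ?T" using emb[OF xF] by blast
  qed
  ultimately have JT: "J \<subseteq> ?T" by (rule Jmin)
  \<comment> \<open>approximate \<open>s\<close> by a late term, and that term by an element \<open>i\<close> of the kernel of \<open>\<Phi>\<close>\<close>
  have TJ: "?a s \<in> J" if s: "s \<in> carrier ?C" "\<Theta> s = \<zero>\<^bsub>?B\<^esub>" for s
  proof -
    have "\<exists>Y\<in>J. nrm ?A (?a s \<ominus>\<^bsub>?A\<^esub> Y) < e" if e: "0 < e" for e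
    proof -
      have "nrm ?D (\<lambda>k. \<Phi> (s k)) = 0" using \<Theta>_nrm[OF s(1)] s(2) by simp
      then have "(\<lambda>k. q (\<Phi> (s k))) \<longlonglongrightarrow> 0" using E.cauchy_norm_tendsto[OF \<Phi>s[OF s(1)]] by simp
      then have "eventually (\<lambda>k. q (\<Phi> (s k)) < e/4) sequentially" using e by (intro order_tendstoD) auto
      then obtain N1 where N1: "\<And>k. k \<ge> N1 \<Longrightarrow> q (\<Phi> (s k)) < e/4" by (auto simp: eventually_sequentially)
      obtain N2 where N2: "\<forall>m\<ge>N2. \<forall>k\<ge>N2. p (s m \<ominus>\<^bsub>F\<^esub> s k) < e/4"
        using F.cauchy_dist_eventually[OF s(1), of "e/4"] e by auto
      define k where "k = max N1 N2"
      note sk = F.cauchyD[OF s(1)]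
      obtain i where i: "i \<in> ?K" "p (s k \<ominus>\<^bsub>F\<^esub> i) < q (\<Phi> (s k)) + e/4"
        using F.quotient_seminorm_approx[OF K sk, of "e/4" k] q[OF sk] e by auto
      then have iF: "i \<in> carrier F" by blast
      have pk: "p (s k \<ominus>\<^bsub>F\<^esub> i) < e/2" using i(2) N1[of k] by (simp add: k_def)
      have ic: "(\<lambda>_. i) \<in> carrier ?C" using iF by (rule F.const_cauchy)
      have dc: "s \<ominus>\<^bsub>?C\<^esub> (\<lambda>_. i) \<in> carrier ?C" using s(1) ic by (rule C.minus_closed)
      have "nrm ?C (s \<ominus>\<^bsub>?C\<^esub> (\<lambda>_. i)) \<le> 3 * e / 4"
      proof (rule LIMSEQ_le_const2[OF F.cauchy_norm_tendsto[OF dc]])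
        have "p ((s \<ominus>\<^bsub>?C\<^esub> (\<lambda>_. i)) m) \<le> 3 * e / 4" if "m \<ge> N2" for m
        proof -
          have "p (s m \<ominus>\<^bsub>F\<^esub> s k) < e/4" using N2 that by (simp add: k_def)
          then show ?thesis unfolding F.cauchy_minus[OF s(1) ic]
            using F.p_triangle[OF sk sk iF, of m k] pk by linarith
        qed
        then show "\<exists>N. \<forall>n\<ge>N. p ((s \<ominus>\<^bsub>?C\<^esub> (\<lambda>_. i)) n) \<le> 3 * e / 4" by blast
      qed
      moreover have "nrm ?A (?a s \<ominus>\<^bsub>?A\<^esub> completion_emb F p i) = nrm ?C (s \<ominus>\<^bsub>?C\<^esub> (\<lambda>_. i))"
        using star_hom_diff[OF C.star_algebra_axioms A F.completion_facts(3) s(1) ic]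
          F.completion_nrm[OF dc] by (simp only: a_emb)
      moreover have "completion_emb F p i \<in> J" using J i(1) by blast
      ultimately show ?thesis using e by (intro bexI[of _ "completion_emb F p i"]) auto
    qed
    then show ?thesis using Jc aC[OF s(1)] unfolding closed_star_ideal_def by blast
  qed
  define \<Psi> where "\<Psi> s = J +>\<^bsub>?A\<^esub> ?a s" for s
  have \<Psi>: "\<Psi> \<in> star_hom ?C (quotient_alg ?A J)"
    unfolding \<Psi>_def[abs_def] using F.completion_facts(3) J.rcos_star_hom by (rule star_hom_comp)
  have \<Psi>_surj: "\<Psi> ` carrier ?C = carrier (quotient_alg ?A J)"
    unfolding J.quotient_carrier a_surj[symmetric] \<Psi>_def by (simp add: image_image)
  have "\<Theta> s = \<zero>\<^bsub>?B\<^esub> \<longleftrightarrow> \<Psi> s = \<zero>\<^bsub>quotient_alg ?A J\<^esub>" if s: "s \<in> carrier ?C" for s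
  proof -
    have "\<Psi> s = \<zero>\<^bsub>quotient_alg ?A J\<^esub> \<longleftrightarrow> ?a s \<in> J"
      unfolding \<Psi>_def J.quotient_zero by (rule A.rcos_zero_iff[OF J.is_ideal aC[OF s]])
    then show ?thesis using TJ[OF s] JT th(2)[OF s] by auto
  qed
  then obtain \<phi> where "\<phi> \<in> star_iso ?B (quotient_alg ?A J)" "\<And>s. s \<in> carrier ?C \<Longrightarrow> \<phi> (\<Theta> s) = \<Psi> s"
    using star_iso_factor[OF C.star_algebra_axioms B J.quotient_star_algebra \<Theta> \<Theta>_surj \<Psi> \<Psi>_surj] by blast
  moreover have "\<Psi> (\<lambda>k. x) = J +>\<^bsub>?A\<^esub> completion_emb F p x" for x by (simp add: \<Psi>_def a_emb)
  ultimately show ?thesis using F.const_cauchy \<Theta>_emb by metis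
qed

section \<open>Monoid algebras\<close>

locale involutive_monoid = monoid M for M :: "('a, 'm) monoid_scheme" (structure) +
  fixes \<iota> :: "'a \<Rightarrow> 'a"
  assumes inv_closed [simp]: "x \<in> carrier M \<Longrightarrow> \<iota> x \<in> carrier M"
    and inv_inv [simp]: "x \<in> carrier M \<Longrightarrow> \<iota> (\<iota> x) = x"
    and inv_mult: "x \<in> carrier M \<Longrightarrow> y \<in> carrier M \<Longrightarrow> \<iota> (x \<otimes> y) = \<iota> y \<otimes> \<iota> x"
begin

lemma inv_one [simp]: "\<iota> \<one> = \<one>"
  by (metis inv_closed inv_inv inv_mult l_one one_closed r_one)

end

text \<open>
  Finitely supported functions are determined by their pairings with all functions, and these turn
  convolution into iterated summation; all algebra laws follow from this.
\<close>

definition pairing :: "('a \<Rightarrow> complex) \<Rightarrow> ('a \<Rightarrow> complex) \<Rightarrow> complex" where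
  "pairing f \<phi> = (\<Sum>x | f x \<noteq> 0. f x * \<phi> x)"

lemma pairing_superset:
  assumes "finite S" "{x. f x \<noteq> 0} \<subseteq> S"
  shows "pairing f \<phi> = (\<Sum>x\<in>S. f x * \<phi> x)"
  unfolding pairing_def using assms by (intro sum.mono_neutral_left) auto

lemma pairing_ext:
  fixes f g :: "'a \<Rightarrow> complex"
  assumes f: "finite {x. f x \<noteq> 0}" and g: "finite {x. g x \<noteq> 0}" and eq: "\<And>\<phi>. pairing f \<phi> = pairing g \<phi>"
  shows "f = g"
proof
  fix z
  have "pairing h (\<lambda>x. if x = z then 1 else 0) = h z" if "finite {x. h x \<noteq> 0}" for h :: "'a \<Rightarrow> complex"
    using that by (simp add: pairing_def if_distrib cong: if_cong)
  then show "f z = g z" using f g eq by metis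
qed

lemma pairing_cong: "(\<And>x. f x \<noteq> 0 \<Longrightarrow> \<phi> x = \<psi> x) \<Longrightarrow> pairing f \<phi> = pairing f \<psi>"
  unfolding pairing_def by (intro sum.cong) auto

lemma pairing_swap: "pairing f (\<lambda>x. pairing g (\<lambda>y. \<phi> x y)) = pairing g (\<lambda>y. pairing f (\<lambda>x. \<phi> x y))"
  unfolding pairing_def sum_distrib_left by (subst sum.swap) (simp add: mult.left_commute)

lemma pairing_linear:
  "finite {x. f x \<noteq> 0} \<Longrightarrow> finite {x. g x \<noteq> 0} \<Longrightarrow>
    pairing (\<lambda>x. f x + g x) \<phi> = pairing f \<phi> + pairing g \<phi>"
  "pairing f (\<lambda>x. \<phi> x + \<psi> x) = pairing f \<phi> + pairing f \<psi>"
  "finite {x. f x \<noteq> 0} \<Longrightarrow> pairing (\<lambda>x. c * f x) \<phi> = c * pairing f \<phi>"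
  "pairing f (\<lambda>x. c * \<phi> x) = c * pairing f \<phi>"
proof -
  show "pairing (\<lambda>x. f x + g x) \<phi> = pairing f \<phi> + pairing g \<phi>" if "finite {x. f x \<noteq> 0}" "finite {x. g x \<noteq> 0}"
  proof -
    let ?S = "{x. f x \<noteq> 0} \<union> {x. g x \<noteq> 0}"
    have "finite ?S" "{x. f x + g x \<noteq> 0} \<subseteq> ?S" using that by auto
    then show ?thesis using pairing_superset[of ?S] by (auto simp: distrib_right sum.distrib)
  qed
  show "pairing (\<lambda>x. c * f x) \<phi> = c * pairing f \<phi>" if "finite {x. f x \<noteq> 0}"
    using pairing_superset[OF that, of "\<lambda>x. c * f x" \<phi>]
    by (auto simp: pairing_def sum_distrib_left mult.assoc)
qed (simp_all add: pairing_def sum.distrib sum_distrib_left algebra_simps)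

context involutive_monoid
begin

abbreviation "MA \<equiv> monoid_alg M \<iota>"

lemma monoid_alg_carrier: "f \<in> carrier MA \<longleftrightarrow> finite {x. f x \<noteq> 0} \<and> {x. f x \<noteq> 0} \<subseteq> carrier M"
  by (simp add: monoid_alg_def)

lemma monoid_algD: "f \<in> carrier MA \<Longrightarrow> finite {x. f x \<noteq> 0}" "f \<in> carrier MA \<Longrightarrow> f x \<noteq> 0 \<Longrightarrow> x \<in> carrier M"
  by (auto simp: monoid_alg_carrier)

lemma monoid_alg_ops:
  "\<one>\<^bsub>MA\<^esub> = basis_elem \<one>" "\<zero>\<^bsub>MA\<^esub> = (\<lambda>x. 0)" "f \<oplus>\<^bsub>MA\<^esub> g = (\<lambda>x. f x + g x)" "c \<odot>\<^bsub>MA\<^esub> f = (\<lambda>x. c * f x)"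
  "adj MA f = (\<lambda>x. if x \<in> carrier M then cnj (f (\<iota> x)) else 0)"
  by (simp_all add: monoid_alg_def basis_elem_def fun_eq_iff)

lemma monoid_alg_mult:
  "(f \<otimes>\<^bsub>MA\<^esub> g) z = (\<Sum>i\<in>{i \<in> {x. f x \<noteq> 0} \<times> {y. g y \<noteq> 0}. fst i \<otimes> snd i = z}. f (fst i) * g (snd i))"
  unfolding monoid_alg_def by (simp, intro sum.cong) auto

lemma monoid_alg_mult_support:
  "{z. (f \<otimes>\<^bsub>MA\<^esub> g) z \<noteq> 0} \<subseteq> (\<lambda>i. fst i \<otimes> snd i) ` ({x. f x \<noteq> 0} \<times> {y. g y \<noteq> 0})"
proof (rule subsetI, rule ccontr)
  fix z assume z: "z \<in> {z. (f \<otimes>\<^bsub>MA\<^esub> g) z \<noteq> 0}"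
    "z \<notin> (\<lambda>i. fst i \<otimes> snd i) ` ({x. f x \<noteq> 0} \<times> {y. g y \<noteq> 0})"
  then have "{i \<in> {x. f x \<noteq> 0} \<times> {y. g y \<noteq> 0}. fst i \<otimes> snd i = z} = {}" by blast
  then have "(f \<otimes>\<^bsub>MA\<^esub> g) z = 0" unfolding monoid_alg_mult by (simp only: sum.empty)
  then show False using z(1) by simp
qed

lemma monoid_alg_closed:
  assumes f: "f \<in> carrier MA" and g: "g \<in> carrier MA"
  shows "f \<oplus>\<^bsub>MA\<^esub> g \<in> carrier MA" "f \<otimes>\<^bsub>MA\<^esub> g \<in> carrier MA" "c \<odot>\<^bsub>MA\<^esub> f \<in> carrier MA" "adj MA f \<in> carrier MA"
proof -
  have "{x. f x + g x \<noteq> 0} \<subseteq> {x. f x \<noteq> 0} \<union> {x. g x \<noteq> 0}" by auto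
  then show "f \<oplus>\<^bsub>MA\<^esub> g \<in> carrier MA" using f g unfolding monoid_alg_carrier monoid_alg_ops
    by (meson finite_UnI finite_subset le_supI subset_trans)
  have "{x. c * f x \<noteq> 0} \<subseteq> {x. f x \<noteq> 0}" by auto
  then show "c \<odot>\<^bsub>MA\<^esub> f \<in> carrier MA" using f unfolding monoid_alg_carrier monoid_alg_ops
    by (meson finite_subset subset_trans)
  have "{x. (if x \<in> carrier M then cnj (f (\<iota> x)) else 0) \<noteq> 0} \<subseteq> \<iota> ` {x. f x \<noteq> 0}"
  proof safe
    fix x assume x: "(if x \<in> carrier M then cnj (f (\<iota> x)) else 0) \<noteq> 0"
    then have "x = \<iota> (\<iota> x)" "f (\<iota> x) \<noteq> 0" by (auto split: if_splits)
    then show "x \<in> \<iota> ` {x. f x \<noteq> 0}" by blast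
  qed
  then show "adj MA f \<in> carrier MA" using f unfolding monoid_alg_carrier monoid_alg_ops
    by (auto intro: finite_subset split: if_splits)
  have "finite ((\<lambda>i. fst i \<otimes> snd i) ` ({x. f x \<noteq> 0} \<times> {y. g y \<noteq> 0}))"
    "(\<lambda>i. fst i \<otimes> snd i) ` ({x. f x \<noteq> 0} \<times> {y. g y \<noteq> 0}) \<subseteq> carrier M"
    using monoid_algD[OF f] monoid_algD[OF g] by auto
  then show "f \<otimes>\<^bsub>MA\<^esub> g \<in> carrier MA" using monoid_alg_mult_support[of f g] unfolding monoid_alg_carrier
    by (meson finite_subset subset_trans)
qed

lemma basis_elem_closed [simp]: "x \<in> carrier M \<Longrightarrow> basis_elem x \<in> carrier MA"
  by (simp add: monoid_alg_carrier basis_elem_def)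

lemma zero_closed_MA: "(\<lambda>x. 0) \<in> carrier MA"
  by (simp add: monoid_alg_carrier)

lemma pairing_mult:
  assumes f: "f \<in> carrier MA" and g: "g \<in> carrier MA"
  shows "pairing (f \<otimes>\<^bsub>MA\<^esub> g) \<phi> = pairing f (\<lambda>x. pairing g (\<lambda>y. \<phi> (x \<otimes> y)))"
proof -
  let ?I = "{x. f x \<noteq> 0} \<times> {y. g y \<noteq> 0}" and ?m = "\<lambda>i. fst i \<otimes> snd i"
  have I: "finite ?I" using f g by (auto simp: monoid_alg_carrier)
  then have "pairing (f \<otimes>\<^bsub>MA\<^esub> g) \<phi> = (\<Sum>z\<in>?m ` ?I. (\<Sum>i\<in>{i\<in>?I. ?m i = z}. f (fst i) * g (snd i)) * \<phi> z)"
    unfolding monoid_alg_mult[symmetric] using monoid_alg_mult_support by (intro pairing_superset) auto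
  also have "\<dots> = (\<Sum>z\<in>?m ` ?I. \<Sum>i\<in>{i\<in>?I. ?m i = z}. f (fst i) * g (snd i) * \<phi> (?m i))"
    unfolding sum_distrib_right by (intro sum.cong) auto
  also have "\<dots> = (\<Sum>i\<in>?I. f (fst i) * g (snd i) * \<phi> (?m i))" using I by (rule sum.image_gen[symmetric])
  also have "\<dots> = pairing f (\<lambda>x. pairing g (\<lambda>y. \<phi> (x \<otimes> y)))"
    unfolding pairing_def sum_distrib_left sum.cartesian_product by (simp add: case_prod_unfold mult.assoc)
  finally show ?thesis .
qed

lemma pairing_basis [simp]: "pairing (basis_elem x) \<phi> = \<phi> x"
  by (simp add: pairing_def basis_elem_def)

lemma pairing_adj:
  assumes f: "f \<in> carrier MA"
  shows "pairing (adj MA f) \<phi> = cnj (pairing f (\<lambda>x. cnj (\<phi> (\<iota> x))))"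
proof -
  have "pairing (adj MA f) \<phi> = (\<Sum>x\<in>\<iota> ` {x. f x \<noteq> 0}. adj MA f x * \<phi> x)"
  proof (rule pairing_superset)
    show "finite (\<iota> ` {x. f x \<noteq> 0})" using f by (simp add: monoid_alg_carrier)
    show "{x. adj MA f x \<noteq> 0} \<subseteq> \<iota> ` {x. f x \<noteq> 0}"
    proof safe
      fix x assume x: "adj MA f x \<noteq> 0"
      then have "x = \<iota> (\<iota> x)" "f (\<iota> x) \<noteq> 0" by (auto simp: monoid_alg_ops split: if_splits)
      then show "x \<in> \<iota> ` {x. f x \<noteq> 0}" by blast
    qed
  qed
  also have "\<dots> = (\<Sum>x | f x \<noteq> 0. adj MA f (\<iota> x) * \<phi> (\<iota> x))"
  proof (rule sum.reindex_cong[of \<iota>])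
    show "inj_on \<iota> {x. f x \<noteq> 0}" by (intro inj_on_inverseI[of _ \<iota>]) (simp add: monoid_algD(2)[OF f])
  qed auto
  also have "\<dots> = (\<Sum>x | f x \<noteq> 0. cnj (f x) * \<phi> (\<iota> x))"
    using monoid_algD(2)[OF f] by (intro sum.cong) (auto simp: monoid_alg_ops)
  finally show ?thesis by (simp add: pairing_def)
qed

theorem monoid_alg_star_algebra: "star_algebra MA"
proof -
  note cl = monoid_alg_closed zero_closed_MA
  note fin = monoid_algD(1)
  have ext: "f = g" if "f \<in> carrier MA" "g \<in> carrier MA" "\<And>\<phi>. pairing f \<phi> = pairing g \<phi>" for f g
    using that by (intro pairing_ext fin)
  have add: "pairing (f \<oplus>\<^bsub>MA\<^esub> g) \<phi> = pairing f \<phi> + pairing g \<phi>" if "f \<in> carrier MA" "g \<in> carrier MA" for f g \<phi>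
    using that by (simp add: monoid_alg_ops pairing_linear fin)
  have smult: "pairing (c \<odot>\<^bsub>MA\<^esub> f) \<phi> = c * pairing f \<phi>" if "f \<in> carrier MA" for c f \<phi>
    using that by (simp add: monoid_alg_ops pairing_linear fin)
  note P = add smult pairing_mult pairing_adj
  have one: "\<one>\<^bsub>MA\<^esub> \<in> carrier MA" by (simp add: monoid_alg_ops)
  have ring: "ring MA"
  proof (intro ringI abelian_groupI monoidI)
    fix f g h assume fgh: "f \<in> carrier MA" "g \<in> carrier MA" "h \<in> carrier MA"
    show "f \<otimes>\<^bsub>MA\<^esub> g \<otimes>\<^bsub>MA\<^esub> h = f \<otimes>\<^bsub>MA\<^esub> (g \<otimes>\<^bsub>MA\<^esub> h)"
    proof (rule ext)
      show "pairing (f \<otimes>\<^bsub>MA\<^esub> g \<otimes>\<^bsub>MA\<^esub> h) \<phi> = pairing (f \<otimes>\<^bsub>MA\<^esub> (g \<otimes>\<^bsub>MA\<^esub> h)) \<phi>" for \<phi>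
        using fgh by (simp add: P cl) (intro pairing_cong, simp add: m_assoc monoid_algD)
    qed (use fgh in \<open>simp_all add: cl\<close>)
    show "(f \<oplus>\<^bsub>MA\<^esub> g) \<otimes>\<^bsub>MA\<^esub> h = f \<otimes>\<^bsub>MA\<^esub> h \<oplus>\<^bsub>MA\<^esub> g \<otimes>\<^bsub>MA\<^esub> h"
      "h \<otimes>\<^bsub>MA\<^esub> (f \<oplus>\<^bsub>MA\<^esub> g) = h \<otimes>\<^bsub>MA\<^esub> f \<oplus>\<^bsub>MA\<^esub> h \<otimes>\<^bsub>MA\<^esub> g"
      using fgh by (intro ext; simp add: P cl pairing_linear)+
  next
    fix f assume f: "f \<in> carrier MA"
    show "\<one>\<^bsub>MA\<^esub> \<otimes>\<^bsub>MA\<^esub> f = f" "f \<otimes>\<^bsub>MA\<^esub> \<one>\<^bsub>MA\<^esub> = f"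
      using f one by (intro ext; simp add: P cl; simp add: monoid_alg_ops; intro pairing_cong; simp add: monoid_algD)+
    show "\<exists>g\<in>carrier MA. g \<oplus>\<^bsub>MA\<^esub> f = \<zero>\<^bsub>MA\<^esub>"
      using cl(3)[OF f f, of "-1"] by (intro bexI[of _ "(-1) \<odot>\<^bsub>MA\<^esub> f"]) (simp_all add: monoid_alg_ops)
  qed (use one in \<open>auto simp: cl\<close>, auto simp: monoid_alg_ops cl add_ac)
  show ?thesis
  proof (intro star_algebra.intro star_algebra_axioms.intro ring)
    fix f g and c d :: complex assume fg: "f \<in> carrier MA" "g \<in> carrier MA"
    show "(c \<odot>\<^bsub>MA\<^esub> f) \<otimes>\<^bsub>MA\<^esub> g = c \<odot>\<^bsub>MA\<^esub> (f \<otimes>\<^bsub>MA\<^esub> g)" "f \<otimes>\<^bsub>MA\<^esub> (c \<odot>\<^bsub>MA\<^esub> g) = c \<odot>\<^bsub>MA\<^esub> (f \<otimes>\<^bsub>MA\<^esub> g)"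
      using fg by (intro ext; simp add: P cl pairing_linear)+
    show "adj MA (f \<otimes>\<^bsub>MA\<^esub> g) = adj MA g \<otimes>\<^bsub>MA\<^esub> adj MA f"
    proof (rule ext)
      fix \<phi>
      have "pairing (adj MA g \<otimes>\<^bsub>MA\<^esub> adj MA f) \<phi> = cnj (pairing g (\<lambda>y. pairing f (\<lambda>x. cnj (\<phi> (\<iota> y \<otimes> \<iota> x)))))"
        using fg by (simp add: P cl)
      also have "\<dots> = cnj (pairing f (\<lambda>x. pairing g (\<lambda>y. cnj (\<phi> (\<iota> y \<otimes> \<iota> x)))))" by (subst pairing_swap) simp
      also have "\<dots> = pairing (adj MA (f \<otimes>\<^bsub>MA\<^esub> g)) \<phi>"
        using fg by (simp add: P cl) (intro pairing_cong, simp add: inv_mult monoid_algD)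
      finally show "pairing (adj MA (f \<otimes>\<^bsub>MA\<^esub> g)) \<phi> = pairing (adj MA g \<otimes>\<^bsub>MA\<^esub> adj MA f) \<phi>" by simp
    qed (use fg in \<open>simp_all add: cl\<close>)
    show "adj MA (adj MA f) = f"
      using monoid_algD(2)[OF fg(1)] by (auto simp: monoid_alg_ops fun_eq_iff)
  qed (auto simp: cl monoid_alg_closed[unfolded monoid_alg_ops] monoid_alg_ops fun_eq_iff algebra_simps)
qed

lemma basis_mult:
  assumes "x \<in> carrier M" "y \<in> carrier M"
  shows "basis_elem x \<otimes>\<^bsub>MA\<^esub> basis_elem y = basis_elem (x \<otimes> y)"
proof -
  have "basis_elem x \<otimes>\<^bsub>MA\<^esub> basis_elem y \<in> carrier MA" "basis_elem (x \<otimes> y) \<in> carrier MA"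
    using assms by (simp_all add: monoid_alg_closed)
  then show ?thesis using assms by (intro pairing_ext monoid_algD(1)) (simp_all add: pairing_mult)
qed

lemma basis_adj:
  assumes "x \<in> carrier M"
  shows "adj MA (basis_elem x) = basis_elem (\<iota> x)"
proof -
  have b: "basis_elem x \<in> carrier MA" using assms by simp
  have "adj MA (basis_elem x) \<in> carrier MA" by (rule monoid_alg_closed(4)[OF b b])
  moreover have "basis_elem (\<iota> x) \<in> carrier MA" using assms by simp
  ultimately show ?thesis using assms by (intro pairing_ext monoid_algD(1)) (simp_all add: pairing_adj)
qed

lemma lincomb_basis:
  assumes "finite S" "S \<subseteq> carrier M"
  shows "lincomb MA S c basis_elem = (\<lambda>x. if x \<in> S then c x else 0)"
proof -
  interpret MA: star_algebra MA by (rule monoid_alg_star_algebra)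
  show ?thesis using assms
  proof (induction S)
    case empty then show ?case by (simp add: monoid_alg_ops)
  next
    case (insert x S)
    then have eq: "lincomb MA (insert x S) c basis_elem = c x \<odot>\<^bsub>MA\<^esub> basis_elem x \<oplus>\<^bsub>MA\<^esub> lincomb MA S c basis_elem"
      by (subst MA.lincomb_insert) auto
    have IH: "lincomb MA S c basis_elem = (\<lambda>x. if x \<in> S then c x else 0)" using insert by simp
    show ?case unfolding eq IH monoid_alg_ops using insert(2) by (auto simp: fun_eq_iff basis_elem_def)
  qed
qed

lemma monoid_alg_eq_lincomb:
  assumes f: "f \<in> carrier MA"
  shows "f = lincomb MA {x. f x \<noteq> 0} f basis_elem"
  using f by (subst lincomb_basis) (auto simp: monoid_alg_carrier fun_eq_iff)

lemma star_hom_eqI: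
  assumes E: "star_algebra E" and h: "h \<in> star_hom MA E" and k: "k \<in> star_hom MA E"
    and eq: "\<And>x. x \<in> carrier M \<Longrightarrow> h (basis_elem x) = k (basis_elem x)" and f: "f \<in> carrier MA"
  shows "h f = k f"
proof -
  interpret E: star_algebra E by fact
  have b: "basis_elem ` {x. f x \<noteq> 0} \<subseteq> carrier MA"
    using monoid_algD(2)[OF f] by (intro image_subsetI basis_elem_closed) simp
  have "h (lincomb MA {x. f x \<noteq> 0} f basis_elem) = k (lincomb MA {x. f x \<noteq> 0} f basis_elem)"
    unfolding star_hom_lincomb[OF monoid_alg_star_algebra E h b] star_hom_lincomb[OF monoid_alg_star_algebra E k b]
    using b star_homD(1)[OF k] by (intro E.lincomb_cong) (auto simp: eq monoid_algD(2)[OF f])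
  then show ?thesis using monoid_alg_eq_lincomb[OF f] by simp
qed

text \<open>
  The universal property of the monoid algebra, by linear extension.
\<close>

theorem monoid_alg_lift:
  assumes E: "star_algebra E"
    and \<theta>: "\<And>x. x \<in> carrier M \<Longrightarrow> \<theta> x \<in> carrier E" "\<theta> \<one> = \<one>\<^bsub>E\<^esub>"
      "\<And>x y. x \<in> carrier M \<Longrightarrow> y \<in> carrier M \<Longrightarrow> \<theta> (x \<otimes> y) = \<theta> x \<otimes>\<^bsub>E\<^esub> \<theta> y"
      "\<And>x. x \<in> carrier M \<Longrightarrow> \<theta> (\<iota> x) = adj E (\<theta> x)"
  shows "\<exists>h\<in>star_hom MA E. \<forall>x\<in>carrier M. h (basis_elem x) = \<theta> x"
proof -
  interpret E: star_algebra E by fact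
  define h where "h f = lincomb E {x. f x \<noteq> 0} f \<theta>" for f
  have sup: "h f = lincomb E S f \<theta>" if "finite S" "{x. f x \<noteq> 0} \<subseteq> S" "S \<subseteq> carrier M" for f S
    unfolding h_def using that by (intro E.lincomb_neutral[symmetric]) (auto simp: \<theta>)
  have basis: "h (basis_elem x) = \<theta> x" if "x \<in> carrier M" for x
  proof -
    have "h (basis_elem x) = lincomb E {x} (\<lambda>y. if y = x then 1 else 0) \<theta>"
      using that unfolding basis_elem_def by (intro sup) auto
    then show ?thesis using that E.lincomb_single[of "{x}" x \<theta> 1] \<theta>(1) by simp
  qed
  have "h \<in> star_hom MA E"
    unfolding star_hom_def
  proof (intro CollectI conjI ring_hom_memI ballI allI)
    fix f g and c :: complex assume f: "f \<in> carrier MA"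
    note fD = monoid_algD[OF f]
    have \<theta>f: "\<theta> ` {x. f x \<noteq> 0} \<subseteq> carrier E" using fD \<theta> by auto
    show "h f \<in> carrier E" using \<theta>f by (auto simp: h_def)
    have "h (c \<odot>\<^bsub>MA\<^esub> f) = lincomb E {x. f x \<noteq> 0} (\<lambda>x. c * f x) \<theta>"
      unfolding monoid_alg_ops using fD by (intro sup) auto
    then show "h (c \<odot>\<^bsub>MA\<^esub> f) = c \<odot>\<^bsub>E\<^esub> h f" using \<theta>f by (simp add: h_def E.lincomb_smult)
    show "h (adj MA f) = adj E (h f)"
    proof -
      have inj: "inj_on \<iota> {x. f x \<noteq> 0}" by (intro inj_on_inverseI[of _ \<iota>]) (simp add: fD(2))
      have "h (adj MA f) = lincomb E (\<iota> ` {x. f x \<noteq> 0}) (adj MA f) \<theta>"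
      proof (rule sup)
        show "{x. adj MA f x \<noteq> 0} \<subseteq> \<iota> ` {x. f x \<noteq> 0}"
        proof safe
          fix x assume x: "adj MA f x \<noteq> 0"
          then have "x = \<iota> (\<iota> x)" "f (\<iota> x) \<noteq> 0" by (auto simp: monoid_alg_ops split: if_splits)
          then show "x \<in> \<iota> ` {x. f x \<noteq> 0}" by blast
        qed
      qed (use fD in auto)
      also have "\<dots> = lincomb E {x. f x \<noteq> 0} (\<lambda>x. adj MA f (\<iota> x)) (\<lambda>x. \<theta> (\<iota> x))"
        using inj fD \<theta> by (intro E.lincomb_reindex) auto
      also have "\<dots> = lincomb E {x. f x \<noteq> 0} (\<lambda>x. cnj (f x)) (\<lambda>x. adj E (\<theta> x))"
        using fD \<theta> by (intro E.lincomb_cong) (auto simp: monoid_alg_ops)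
      finally show ?thesis using \<theta>f by (simp add: h_def E.lincomb_adj)
    qed
    assume g: "g \<in> carrier MA"
    note gD = monoid_algD[OF g]
    let ?S = "{x. f x \<noteq> 0} \<union> {x. g x \<noteq> 0}"
    have S: "finite ?S" "?S \<subseteq> carrier M" using fD gD by auto
    then have \<theta>S: "\<theta> ` ?S \<subseteq> carrier E" using \<theta> by auto
    have "h (f \<oplus>\<^bsub>MA\<^esub> g) = lincomb E ?S (\<lambda>x. f x + g x) \<theta>"
      unfolding monoid_alg_ops using S by (intro sup) auto
    also have "\<dots> = lincomb E ?S f \<theta> \<oplus>\<^bsub>E\<^esub> lincomb E ?S g \<theta>" using \<theta>S by (rule E.lincomb_add)
    also have "\<dots> = h f \<oplus>\<^bsub>E\<^esub> h g" using sup[of ?S f] sup[of ?S g] S by auto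
    finally show "h (f \<oplus>\<^bsub>MA\<^esub> g) = h f \<oplus>\<^bsub>E\<^esub> h g" .
    let ?I = "{x. f x \<noteq> 0} \<times> {y. g y \<noteq> 0}" and ?m = "\<lambda>i. fst i \<otimes> snd i"
    have I: "finite ?I" "?m ` ?I \<subseteq> carrier M" using fD gD by auto
    have \<theta>g: "\<theta> ` {x. g x \<noteq> 0} \<subseteq> carrier E" using gD \<theta> by auto
    have "h (f \<otimes>\<^bsub>MA\<^esub> g) = lincomb E (?m ` ?I) (f \<otimes>\<^bsub>MA\<^esub> g) \<theta>"
      using monoid_alg_mult_support I by (intro sup) auto
    also have "\<dots> = lincomb E (?m ` ?I) (\<lambda>z. \<Sum>i\<in>{i\<in>?I. ?m i = z}. f (fst i) * g (snd i)) \<theta>"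
      by (simp add: monoid_alg_mult[abs_def])
    also have "\<dots> = lincomb E ?I (\<lambda>i. f (fst i) * g (snd i)) (\<lambda>i. \<theta> (?m i))"
      using I \<theta> by (intro E.lincomb_fibre[symmetric]) (auto simp: image_subset_iff)
    also have "\<dots> = lincomb E ?I (\<lambda>(x, y). f x * g y) (\<lambda>(x, y). \<theta> x \<otimes>\<^bsub>E\<^esub> \<theta> y)"
      using fD(2) gD(2) \<theta> by (intro E.lincomb_cong) auto
    also have "\<dots> = h f \<otimes>\<^bsub>E\<^esub> h g"
      unfolding h_def using fD gD \<theta>f \<theta>g by (intro E.lincomb_product[symmetric])
    finally show "h (f \<otimes>\<^bsub>MA\<^esub> g) = h f \<otimes>\<^bsub>E\<^esub> h g" .
  next
    show "h \<one>\<^bsub>MA\<^esub> = \<one>\<^bsub>E\<^esub>" using basis[of \<one>] \<theta>(2) by (simp add: monoid_alg_ops)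
  qed
  then show ?thesis using basis by blast
qed

end

subsection \<open>Words\<close>

text \<open>
  Words are evaluated in any monoid with an involution: in a group with inverses, and in a star
  algebra with adjoints.
\<close>

fun letter_eval :: "('b, 'k) monoid_scheme \<Rightarrow> ('b \<Rightarrow> 'b) \<Rightarrow> ('x \<Rightarrow> 'b) \<Rightarrow> 'x \<times> bool \<Rightarrow> 'b" where
  "letter_eval M \<iota> a (x, b) = (if b then \<iota> (a x) else a x)"

primrec word_eval :: "('b, 'k) monoid_scheme \<Rightarrow> ('b \<Rightarrow> 'b) \<Rightarrow> ('x \<Rightarrow> 'b) \<Rightarrow> 'x word \<Rightarrow> 'b" where
  "word_eval M \<iota> a [] = \<one>\<^bsub>M\<^esub>"
| "word_eval M \<iota> a (l # w) = letter_eval M \<iota> a l \<otimes>\<^bsub>M\<^esub> word_eval M \<iota> a w"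

context involutive_monoid
begin

context
  fixes a :: "'x \<Rightarrow> 'a"
  assumes a: "range a \<subseteq> carrier M"
begin

lemma letter_eval_closed [simp]: "letter_eval M \<iota> a l \<in> carrier M"
  using a by (cases l) (auto simp: image_subset_iff)

lemma word_eval_closed [simp]: "word_eval M \<iota> a w \<in> carrier M"
  by (induction w) auto

lemma word_eval_append: "word_eval M \<iota> a (v @ w) = word_eval M \<iota> a v \<otimes> word_eval M \<iota> a w"
  by (induction v) (auto simp: m_assoc)

lemma word_eval_inv: "word_eval M \<iota> a (word_inv w) = \<iota> (word_eval M \<iota> a w)"
proof (induction w)
  case (Cons l w)
  obtain x b where l: "l = (x, b)" by (cases l)
  have "a x \<in> carrier M" using a by auto
  then have "word_eval M \<iota> a [(x, \<not> b)] = \<iota> (letter_eval M \<iota> a l)" by (simp add: l)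
  moreover have "word_inv (l # w) = word_inv w @ [(x, \<not> b)]" by (simp add: word_inv_def l)
  ultimately show ?case using Cons by (simp add: word_eval_append inv_mult del: word_eval.simps(2)) (simp add: inv_mult)
qed (simp add: word_inv_def)

text \<open>
  The universal property of a presentation, for unitaries of a star algebra as well as for elements
  of a group.
\<close>

lemma word_eval_congruence:
  assumes inv: "\<And>x. a x \<otimes> \<iota> (a x) = \<one>" "\<And>x. \<iota> (a x) \<otimes> a x = \<one>"
    and R: "\<And>v w. (v, w) \<in> R \<Longrightarrow> word_eval M \<iota> a v = word_eval M \<iota> a w"
    and vw: "(v, w) \<in> word_congruence R"
  shows "word_eval M \<iota> a v = word_eval M \<iota> a w"
  using vw
proof (induction rule: word_congruence.induct)
  case (cancel x b)
  have "a x \<in> carrier M" using a by auto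
  then show ?case using inv by simp
qed (auto simp: word_eval_append R)

end

end

lemma word_involutive_monoid: "involutive_monoid word_monoid word_inv"
  by unfold_locales (auto simp: word_monoid_def word_inv_def rev_map[symmetric] o_def case_prod_beta)

lemma (in group) group_involutive_monoid: "involutive_monoid G (m_inv G)"
  by unfold_locales (auto simp: inv_mult_group)

lemma (in star_algebra) star_involutive_monoid: "involutive_monoid A (adj A)"
  by unfold_locales (auto simp: adj_mult)

lemma free_star_algebra: "star_algebra free_star_alg"
  unfolding free_star_alg_def by (rule involutive_monoid.monoid_alg_star_algebra[OF word_involutive_monoid])

lemma indet_closed [simp]: "indet x \<in> carrier free_star_alg"
  unfolding free_star_alg_def indet_def
  by (rule involutive_monoid.basis_elem_closed[OF word_involutive_monoid]) (simp add: word_monoid_def)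

lemma free_star_alg_lift:
  fixes a :: "'x \<Rightarrow> 'e"
  assumes E: "star_algebra E" and a: "range a \<subseteq> carrier E"
  shows "\<exists>h\<in>star_hom free_star_alg E.
    (\<forall>x. h (indet x) = a x) \<and> (\<forall>w. h (basis_elem w) = word_eval E (adj E) a w)"
proof -
  interpret E: star_algebra E by fact
  interpret I: involutive_monoid E "adj E" by (rule E.star_involutive_monoid)
  interpret W: involutive_monoid word_monoid word_inv by (rule word_involutive_monoid)
  have W: "carrier word_monoid = UNIV" "\<one>\<^bsub>word_monoid\<^esub> = []" "v \<otimes>\<^bsub>word_monoid\<^esub> w = v @ w" for v w :: "'x word"
    by (simp_all add: word_monoid_def)
  obtain h where h: "h \<in> star_hom free_star_alg E" "\<And>w. h (basis_elem w) = word_eval E (adj E) a w"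
    using W.monoid_alg_lift[OF E, of "word_eval E (adj E) a"]
    by (auto simp: W a I.word_eval_append I.word_eval_inv free_star_alg_def)
  have "h (indet x) = a x" for x using a by (simp add: indet_def h(2) image_subset_iff)
  then show ?thesis using h by blast
qed

lemma free_basis:
  fixes w :: "'x word"
  shows "basis_elem w \<in> carrier free_star_alg"
    and "basis_elem ([] :: 'x word) = \<one>\<^bsub>free_star_alg\<^esub>"
    and "basis_elem (l # w) = basis_elem [l] \<otimes>\<^bsub>free_star_alg\<^esub> basis_elem w"
    and "basis_elem [(x, False)] = indet x"
    and "basis_elem [(x, True)] = adj free_star_alg (indet x)"
proof -
  interpret W: involutive_monoid word_monoid word_inv by (rule word_involutive_monoid)
  have W: "carrier word_monoid = UNIV" "\<one>\<^bsub>word_monoid\<^esub> = []" "v \<otimes>\<^bsub>word_monoid\<^esub> w = v @ w" for v w :: "'x word"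
    by (simp_all add: word_monoid_def)
  show "basis_elem w \<in> carrier free_star_alg" "basis_elem ([] :: 'x word) = \<one>\<^bsub>free_star_alg\<^esub>"
    "basis_elem (l # w) = basis_elem [l] \<otimes>\<^bsub>free_star_alg\<^esub> basis_elem w"
    unfolding free_star_alg_def by (simp_all add: W W.basis_mult W.monoid_alg_ops)
  show "basis_elem [(x, False)] = indet x" by (simp add: indet_def)
  show "basis_elem [(x, True)] = adj free_star_alg (indet x)"
    unfolding free_star_alg_def indet_def by (simp add: W W.basis_adj) (simp add: word_inv_def)
qed

lemma free_star_hom_eqI:
  fixes h k :: "('x word \<Rightarrow> complex) \<Rightarrow> 'e"
  assumes E: "star_algebra E" and h: "h \<in> star_hom free_star_alg E" and k: "k \<in> star_hom free_star_alg E"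
    and eq: "\<And>x. h (indet x) = k (indet x)" and f: "f \<in> carrier free_star_alg"
  shows "h f = k f"
proof -
  note hD = star_homD[OF h] and kD = star_homD[OF k]
  have "h (basis_elem w) = k (basis_elem w)" for w
  proof (induction w)
    case Nil
    then show ?case using hD(4) kD(4) by (simp add: free_basis(2))
  next
    case (Cons l w)
    obtain x c where l: "l = (x, c)" by (cases l)
    have "h (basis_elem [l]) = k (basis_elem [l])"
      by (cases c) (simp_all add: l free_basis(4,5) hD(6) kD(6) eq)
    then show ?case using Cons hD(3) kD(3) by (simp add: free_basis(1) free_basis(3)[of l w])
  qed
  then show ?thesis
    using involutive_monoid.star_hom_eqI[OF word_involutive_monoid E] h k f unfolding free_star_alg_def by blast
qed

section \<open>Presented groups\<close>

context
  fixes R :: "('x word \<times> 'x word) set"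
begin

abbreviation "cls \<equiv> \<lambda>w. word_congruence R `` {w}"

lemma word_congruence_equiv: "equiv UNIV (word_congruence R)"
  by (intro equivI refl_onI symI transI) (auto intro: word_congruence.intros)

lemma cls_eq_iff: "cls v = cls w \<longleftrightarrow> (v, w) \<in> word_congruence R"
  using eq_equiv_class_iff[OF word_congruence_equiv] by simp

lemma presented_carrier: "carrier (presented_group R) = range cls"
  by (auto simp: presented_group_def quotient_def)

lemma presented_mult: "cls v \<otimes>\<^bsub>presented_group R\<^esub> cls w = cls (v @ w)"
proof -
  have "congruent2 (word_congruence R) (word_congruence R) (\<lambda>v w. cls (v @ w))"
    by (rule congruent2I') (auto simp: cls_eq_iff intro: word_congruence.append)
  then show ?thesis
    using UN_equiv_class2[OF word_congruence_equiv word_congruence_equiv, of "\<lambda>v w. cls (v @ w)" v w]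
    by (simp add: presented_group_def)
qed

lemma presented_one: "\<one>\<^bsub>presented_group R\<^esub> = cls []"
  by (simp add: presented_group_def)

lemma word_inv_right: "(w @ word_inv w, []) \<in> word_congruence R"
proof (induction w)
  case (Cons l w)
  obtain x b where l: "l = (x, b)" by (cases l)
  have "([l] @ (w @ word_inv w) @ [(x, \<not> b)], [l] @ [] @ [(x, \<not> b)]) \<in> word_congruence R"
    using Cons by (intro word_congruence.append word_congruence.refl)
  moreover have "([l] @ [] @ [(x, \<not> b)], []) \<in> word_congruence R" by (simp add: l word_congruence.cancel)
  ultimately show ?case by (simp add: word_inv_def l) (rule word_congruence.trans)
qed (simp add: word_inv_def word_congruence.refl)

lemma word_inv_word_inv: "word_inv (word_inv w) = w"
  by (simp add: word_inv_def rev_map[symmetric] o_def case_prod_beta)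

lemma presented_group: "group (presented_group R)"
proof (rule groupI)
  fix X assume "X \<in> carrier (presented_group R)"
  then obtain w where w: "X = cls w" by (auto simp: presented_carrier)
  have "cls (word_inv w) \<otimes>\<^bsub>presented_group R\<^esub> X = \<one>\<^bsub>presented_group R\<^esub>"
    using word_inv_right[of "word_inv w"] by (simp add: w presented_mult presented_one cls_eq_iff word_inv_word_inv)
  then show "\<exists>Y\<in>carrier (presented_group R). Y \<otimes>\<^bsub>presented_group R\<^esub> X = \<one>\<^bsub>presented_group R\<^esub>"
    unfolding presented_carrier by blast
qed (auto simp: presented_carrier presented_mult presented_one)

lemma presented_inv: "inv\<^bsub>presented_group R\<^esub> cls w = cls (word_inv w)"
proof -
  interpret group "presented_group R" by (rule presented_group)
  show ?thesis
    by (rule inv_equality) (use word_inv_right[of "word_inv w"] in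
      \<open>auto simp: presented_carrier presented_mult presented_one cls_eq_iff word_inv_word_inv\<close>)
qed

lemma presented_gen_closed: "presented_gen R x \<in> carrier (presented_group R)"
  by (simp add: presented_gen_def presented_carrier)

lemma presented_word_eval: "word_eval (presented_group R) (m_inv (presented_group R)) (presented_gen R) w = cls w"
proof (induction w)
  case (Cons l w)
  obtain x b where l: "l = (x, b)" by (cases l)
  have "letter_eval (presented_group R) (m_inv (presented_group R)) (presented_gen R) l = cls [l]"
    by (simp add: l presented_gen_def presented_inv word_inv_def)
  then show ?case using Cons by (simp add: presented_mult)
qed (simp add: presented_one)

lemma presented_rel: "(v, w) \<in> R \<Longrightarrow> cls v = cls w"
  by (simp add: cls_eq_iff word_congruence.rel)

end

lemma (in group) generate_word_eval:
  assumes a: "range a \<subseteq> carrier G"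
  shows "generate G (range a) = range (word_eval G (m_inv G) a)"
proof -
  interpret I: involutive_monoid G "m_inv G" by (rule group_involutive_monoid)
  have "x \<in> range (word_eval G (m_inv G) a)" if "x \<in> generate G (range a)" for x
    using that
  proof (induction rule: generate.induct)
    case one
    have "\<one> = word_eval G (m_inv G) a []" by simp
    then show ?case by blast
  next
    case (incl h)
    then obtain x where "h = a x" by auto
    then have "h = word_eval G (m_inv G) a [(x, False)]" using a by (simp add: image_subset_iff)
    then show ?case by blast
  next
    case (inv h)
    then obtain x where "h = a x" by auto
    then have "inv h = word_eval G (m_inv G) a [(x, True)]" using a by (simp add: image_subset_iff)
    then show ?case by blast
  next
    case (eng h1 h2)
    then obtain v w where "h1 = word_eval G (m_inv G) a v" "h2 = word_eval G (m_inv G) a w" by blast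
    then have "h1 \<otimes> h2 = word_eval G (m_inv G) a (v @ w)" by (simp add: I.word_eval_append[OF a])
    then show ?case by blast
  qed
  moreover have "word_eval G (m_inv G) a w \<in> generate G (range a)" for w
  proof (induction w)
    case (Cons l w)
    obtain x b where l: "l = (x, b)" by (cases l)
    have "letter_eval G (m_inv G) a l \<in> generate G (range a)"
      by (auto simp: l intro: generate.incl generate.inv)
    then show ?case using Cons by (auto intro: generate.eng)
  qed (auto intro: generate.one)
  ultimately show ?thesis by blast
qed

section \<open>The regular representation and group C*-algebras\<close>

definition l2_norm :: "('a \<Rightarrow> complex) \<Rightarrow> real" where
  "l2_norm f = L2_set (\<lambda>x. cmod (f x)) {x. f x \<noteq> 0}"

lemma l2_norm_superset:
  assumes "finite S" "{x. f x \<noteq> 0} \<subseteq> S"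
  shows "l2_norm f = L2_set (\<lambda>x. cmod (f x)) S"
  unfolding l2_norm_def L2_set_def using assms by (intro arg_cong[where f = sqrt] sum.mono_neutral_left) auto

lemma l2_norm_nonneg: "0 \<le> l2_norm f"
  by (simp add: l2_norm_def)

lemma l2_norm_add:
  assumes "finite {x. f x \<noteq> 0}" "finite {x. g x \<noteq> 0}"
  shows "l2_norm (\<lambda>x. f x + g x) \<le> l2_norm f + l2_norm g"
proof -
  let ?S = "{x. f x \<noteq> 0} \<union> {x. g x \<noteq> 0}"
  have S: "finite ?S" using assms by simp
  have "l2_norm (\<lambda>x. f x + g x) = L2_set (\<lambda>x. cmod (f x + g x)) ?S" by (rule l2_norm_superset[OF S]) auto
  also have "\<dots> \<le> L2_set (\<lambda>x. cmod (f x) + cmod (g x)) ?S" by (intro L2_set_mono norm_triangle_ineq) auto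
  also have "\<dots> \<le> L2_set (\<lambda>x. cmod (f x)) ?S + L2_set (\<lambda>x. cmod (g x)) ?S" by (rule L2_set_triangle_ineq)
  also have "\<dots> = l2_norm f + l2_norm g" using l2_norm_superset[OF S, of f] l2_norm_superset[OF S, of g] by auto
  finally show ?thesis .
qed

lemma l2_norm_smult: "l2_norm (\<lambda>x. c * f x) = cmod c * l2_norm f"
proof (cases "c = 0")
  case False
  then have "{x. c * f x \<noteq> 0} = {x. f x \<noteq> 0}" by auto
  then show ?thesis by (simp add: l2_norm_def norm_mult L2_set_right_distrib)
qed (simp add: l2_norm_def)

lemma l2_norm_eq_0: "finite {x. f x \<noteq> 0} \<Longrightarrow> l2_norm f = 0 \<Longrightarrow> f x = 0"
  by (auto simp: l2_norm_def L2_set_eq_0_iff)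

locale group_star_algebra = group G for G :: "('g, 'm) monoid_scheme" (structure)
begin

sublocale I: involutive_monoid G "m_inv G" by (rule group_involutive_monoid)

abbreviation "E \<equiv> monoid_alg G (m_inv G)"

sublocale E: star_algebra E by (rule I.monoid_alg_star_algebra)

text \<open>The canonical trace of \<open>\<eta>\<^sup>* \<xi>\<close> is the inner product of \<open>\<eta>\<close> and \<open>\<xi>\<close> in \<open>\<ell>\<^sup>2(G)\<close>.\<close>

lemma trace_adj_mult:
  assumes f: "f \<in> carrier E" and g: "g \<in> carrier E"
  shows "(adj E f \<otimes>\<^bsub>E\<^esub> g) \<one> = (\<Sum>x | f x \<noteq> 0. cnj (f x) * g x)"
proof -
  have eval: "pairing h (\<lambda>x. if x = z then 1 else 0) = h z" if "h \<in> carrier E" for h z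
    using I.monoid_algD(1)[OF that] by (simp add: pairing_def if_distrib cong: if_cong)
  have "(adj E f \<otimes>\<^bsub>E\<^esub> g) \<one> = pairing (adj E f \<otimes>\<^bsub>E\<^esub> g) (\<lambda>x. if x = \<one> then 1 else 0)"
    using f g by (intro eval[symmetric]) auto
  also have "\<dots> = cnj (pairing f (\<lambda>x. cnj (pairing g (\<lambda>y. if inv x \<otimes> y = \<one> then 1 else 0))))"
    using f g by (simp add: I.pairing_mult I.pairing_adj)
  also have "\<dots> = cnj (pairing f (\<lambda>x. cnj (g x)))"
  proof -
    have "pairing g (\<lambda>y. if inv x \<otimes> y = \<one> then 1 else 0) = g x" if x: "f x \<noteq> 0" for x
    proof -
      have xG: "x \<in> carrier G" by (rule I.monoid_algD(2)[OF f x])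
      have "pairing g (\<lambda>y. if inv x \<otimes> y = \<one> then 1 else 0) = pairing g (\<lambda>y. if y = x then 1 else 0)"
      proof (rule pairing_cong)
        fix y assume "g y \<noteq> 0"
        then have yG: "y \<in> carrier G" by (rule I.monoid_algD(2)[OF g])
        have "inv x \<otimes> y = \<one> \<longleftrightarrow> y = x"
          using xG yG inv_solve_left[of \<one> x y] by auto
        then show "(if inv x \<otimes> y = \<one> then 1 else 0) = (if y = x then 1 else 0 :: complex)" by simp
      qed
      then show ?thesis using eval[OF g] by simp
    qed
    then show ?thesis by (intro arg_cong[where f = cnj] pairing_cong) simp
  qed
  finally show ?thesis by (simp add: pairing_def)
qed

lemma trace_norm:
  assumes f: "f \<in> carrier E"
  shows "(adj E f \<otimes>\<^bsub>E\<^esub> f) \<one> = of_real ((l2_norm f)\<^sup>2)"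
  unfolding trace_adj_mult[OF f f] l2_norm_def L2_set_def
  by (simp add: sum_nonneg complex_norm_square mult.commute del: of_real_power of_real_mult)

lemma trace_cauchy_schwarz:
  assumes f: "f \<in> carrier E" and g: "g \<in> carrier E"
  shows "cmod ((adj E f \<otimes>\<^bsub>E\<^esub> g) \<one>) \<le> l2_norm f * l2_norm g"
proof -
  let ?S = "{x. f x \<noteq> 0} \<union> {x. g x \<noteq> 0}"
  have S: "finite ?S" using I.monoid_algD(1)[OF f] I.monoid_algD(1)[OF g] by simp
  have "(adj E f \<otimes>\<^bsub>E\<^esub> g) \<one> = (\<Sum>x\<in>?S. cnj (f x) * g x)"
    unfolding trace_adj_mult[OF f g] using S by (intro sum.mono_neutral_left) auto
  also have "cmod \<dots> \<le> (\<Sum>x\<in>?S. \<bar>cmod (f x)\<bar> * \<bar>cmod (g x)\<bar>)"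
    by (rule order_trans[OF norm_sum]) (simp add: norm_mult)
  also have "\<dots> \<le> L2_set (\<lambda>x. cmod (f x)) ?S * L2_set (\<lambda>x. cmod (g x)) ?S" by (rule L2_set_mult_ineq)
  also have "\<dots> = l2_norm f * l2_norm g" using l2_norm_superset[OF S, of f] l2_norm_superset[OF S, of g] by auto
  finally show ?thesis .
qed

text \<open>
  This is \<open>\<parallel>f x\<parallel>\<^sup>2 = \<langle>x, f\<^sup>* f x\<rangle>\<close> with the Cauchy-Schwarz inequality; it yields both halves of the
  C*-identity.
\<close>

lemma l2_norm_mult_square:
  assumes f: "f \<in> carrier E" and x: "x \<in> carrier E"
  shows "(l2_norm (f \<otimes>\<^bsub>E\<^esub> x))\<^sup>2 \<le> l2_norm x * l2_norm (adj E f \<otimes>\<^bsub>E\<^esub> f \<otimes>\<^bsub>E\<^esub> x)"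
proof -
  have "complex_of_real ((l2_norm (f \<otimes>\<^bsub>E\<^esub> x))\<^sup>2) = (adj E x \<otimes>\<^bsub>E\<^esub> (adj E f \<otimes>\<^bsub>E\<^esub> f \<otimes>\<^bsub>E\<^esub> x)) \<one>"
    using f x by (subst trace_norm[symmetric]) (simp_all add: E.adj_mult E.m_assoc)
  then have "(l2_norm (f \<otimes>\<^bsub>E\<^esub> x))\<^sup>2 = cmod ((adj E x \<otimes>\<^bsub>E\<^esub> (adj E f \<otimes>\<^bsub>E\<^esub> f \<otimes>\<^bsub>E\<^esub> x)) \<one>)"
    by (metis norm_of_real abs_of_nonneg zero_le_power2)
  also have "\<dots> \<le> l2_norm x * l2_norm (adj E f \<otimes>\<^bsub>E\<^esub> f \<otimes>\<^bsub>E\<^esub> x)"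
    using f x by (intro trace_cauchy_schwarz) auto
  finally show ?thesis .
qed

lemma basis_unitary:
  assumes "x \<in> carrier G"
  shows "adj E (basis_elem x) \<otimes>\<^bsub>E\<^esub> basis_elem x = \<one>\<^bsub>E\<^esub>"
  using assms by (simp add: I.basis_adj I.basis_mult) (simp add: I.monoid_alg_ops)

lemma l2_norm_translate:
  assumes x: "x \<in> carrier G" and f: "f \<in> carrier E"
  shows "l2_norm (basis_elem x \<otimes>\<^bsub>E\<^esub> f) = l2_norm f"
proof -
  have b: "basis_elem x \<in> carrier E" using x by simp
  have "adj E (basis_elem x \<otimes>\<^bsub>E\<^esub> f) \<otimes>\<^bsub>E\<^esub> (basis_elem x \<otimes>\<^bsub>E\<^esub> f) =
      adj E f \<otimes>\<^bsub>E\<^esub> (adj E (basis_elem x) \<otimes>\<^bsub>E\<^esub> basis_elem x) \<otimes>\<^bsub>E\<^esub> f"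
    using b f by (simp only: E.adj_mult E.m_assoc E.adj_closed E.m_closed)
  also have "\<dots> = adj E f \<otimes>\<^bsub>E\<^esub> f" using f by (simp add: basis_unitary[OF x])
  finally have "complex_of_real ((l2_norm (basis_elem x \<otimes>\<^bsub>E\<^esub> f))\<^sup>2) = of_real ((l2_norm f)\<^sup>2)"
    using trace_norm[of "basis_elem x \<otimes>\<^bsub>E\<^esub> f"] trace_norm[of f] b f by simp
  then have "(l2_norm (basis_elem x \<otimes>\<^bsub>E\<^esub> f))\<^sup>2 = (l2_norm f)\<^sup>2" by (simp only: of_real_eq_iff)
  then show ?thesis by (rule power2_eq_imp_eq) (simp_all add: l2_norm_nonneg)
qed

lemma l2_norm_lincomb:
  assumes "finite S" "V ` S \<subseteq> carrier E"
  shows "l2_norm (lincomb E S c V) \<le> (\<Sum>i\<in>S. cmod (c i) * l2_norm (V i))"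
  using assms
proof (induction S)
  case empty then show ?case by (simp add: I.monoid_alg_ops l2_norm_def)
next
  case (insert i S)
  then have V: "V i \<in> carrier E" "V ` S \<subseteq> carrier E" by auto
  let ?f = "c i \<odot>\<^bsub>E\<^esub> V i" and ?g = "lincomb E S c V"
  have "?f \<in> carrier E" "?g \<in> carrier E" using V by auto
  then have "l2_norm (?f \<oplus>\<^bsub>E\<^esub> ?g) \<le> l2_norm ?f + l2_norm ?g"
    unfolding I.monoid_alg_ops(3) by (intro l2_norm_add I.monoid_algD(1))
  moreover have "l2_norm ?f = cmod (c i) * l2_norm (V i)" by (simp add: I.monoid_alg_ops l2_norm_smult)
  ultimately show ?case using insert V by (simp add: E.lincomb_insert)
qed

text \<open>
  The norm of the left regular representation, on the dense subspace of finitely supported functions.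
\<close>

definition op_norm :: "('g \<Rightarrow> complex) \<Rightarrow> real" where
  "op_norm f = (SUP x\<in>{x \<in> carrier E. l2_norm x \<le> 1}. l2_norm (f \<otimes>\<^bsub>E\<^esub> x))"

lemma op_bounded:
  assumes f: "f \<in> carrier E"
  shows "\<exists>K. \<forall>x\<in>carrier E. l2_norm (f \<otimes>\<^bsub>E\<^esub> x) \<le> K * l2_norm x"
proof (intro exI ballI)
  fix x assume x: "x \<in> carrier E"
  have b: "basis_elem ` {y. f y \<noteq> 0} \<subseteq> carrier E"
    using I.monoid_algD(2)[OF f] by (intro image_subsetI I.basis_elem_closed) simp
  have b': "(\<lambda>y. basis_elem y \<otimes>\<^bsub>E\<^esub> x) ` {y. f y \<noteq> 0} \<subseteq> carrier E" using b x by (auto simp: image_subset_iff)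
  have "f \<otimes>\<^bsub>E\<^esub> x = lincomb E {y. f y \<noteq> 0} f (\<lambda>y. basis_elem y \<otimes>\<^bsub>E\<^esub> x)"
    using E.lincomb_mult_right[OF b x, of f] I.monoid_alg_eq_lincomb[OF f] by simp
  then have "l2_norm (f \<otimes>\<^bsub>E\<^esub> x) \<le> (\<Sum>y | f y \<noteq> 0. cmod (f y) * l2_norm (basis_elem y \<otimes>\<^bsub>E\<^esub> x))"
    using l2_norm_lincomb[OF I.monoid_algD(1)[OF f] b'] by simp
  also have "\<dots> = (\<Sum>y | f y \<noteq> 0. cmod (f y)) * l2_norm x"
    unfolding sum_distrib_right using I.monoid_algD(2)[OF f] x by (intro sum.cong) (auto simp: l2_norm_translate)
  finally show "l2_norm (f \<otimes>\<^bsub>E\<^esub> x) \<le> (\<Sum>y | f y \<noteq> 0. cmod (f y)) * l2_norm x" .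
qed

lemma op_norm_upper:
  assumes f: "f \<in> carrier E" and x: "x \<in> carrier E" "l2_norm x \<le> 1"
  shows "l2_norm (f \<otimes>\<^bsub>E\<^esub> x) \<le> op_norm f"
  unfolding op_norm_def
proof (rule cSUP_upper)
  obtain K where K: "\<And>x. x \<in> carrier E \<Longrightarrow> l2_norm (f \<otimes>\<^bsub>E\<^esub> x) \<le> K * l2_norm x" using op_bounded[OF f] by blast
  have "l2_norm (f \<otimes>\<^bsub>E\<^esub> x) \<le> \<bar>K\<bar>" if "x \<in> carrier E" "l2_norm x \<le> 1" for x
  proof -
    have "K * l2_norm x \<le> \<bar>K\<bar> * 1" using that l2_norm_nonneg[of x] by (intro mult_mono) auto
    then show ?thesis using K[OF that(1)] by linarith
  qed
  then show "bdd_above ((\<lambda>x. l2_norm (f \<otimes>\<^bsub>E\<^esub> x)) ` {x \<in> carrier E. l2_norm x \<le> 1})"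
    by (intro bdd_aboveI2[of _ _ "\<bar>K\<bar>"]) auto
qed (use x in auto)

lemma op_norm_least:
  assumes "\<And>x. x \<in> carrier E \<Longrightarrow> l2_norm x \<le> 1 \<Longrightarrow> l2_norm (f \<otimes>\<^bsub>E\<^esub> x) \<le> t"
  shows "op_norm f \<le> t"
  unfolding op_norm_def
proof (rule cSUP_least)
  have "\<zero>\<^bsub>E\<^esub> \<in> {x \<in> carrier E. l2_norm x \<le> 1}"
    using E.zero_closed by (simp add: I.monoid_alg_ops l2_norm_def)
  then show "{x \<in> carrier E. l2_norm x \<le> 1} \<noteq> {}" by blast
qed (use assms in auto)

lemma op_norm_nonneg: "f \<in> carrier E \<Longrightarrow> 0 \<le> op_norm f"
  using op_norm_upper[of f "\<zero>\<^bsub>E\<^esub>"] by (simp add: I.monoid_alg_ops l2_norm_def I.zero_closed_MA order_trans[OF l2_norm_nonneg])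

lemma op_norm_bound:
  assumes f: "f \<in> carrier E" and x: "x \<in> carrier E"
  shows "l2_norm (f \<otimes>\<^bsub>E\<^esub> x) \<le> op_norm f * l2_norm x"
proof (cases "l2_norm x = 0")
  case True
  obtain K where "l2_norm (f \<otimes>\<^bsub>E\<^esub> x) \<le> K * l2_norm x" using op_bounded[OF f] x by blast
  then show ?thesis using True by simp
next
  case False
  then have p: "0 < l2_norm x" using l2_norm_nonneg[of x] by simp
  let ?c = "complex_of_real (1 / l2_norm x)"
  have "l2_norm (?c \<odot>\<^bsub>E\<^esub> y) = cmod ?c * l2_norm y" for y
    unfolding I.monoid_alg_ops by (rule l2_norm_smult)
  then have "l2_norm (?c \<odot>\<^bsub>E\<^esub> y) = l2_norm y / l2_norm x" for y
    using p by (simp add: norm_divide)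
  then have "l2_norm (f \<otimes>\<^bsub>E\<^esub> x) / l2_norm x \<le> op_norm f"
    using op_norm_upper[OF f, of "?c \<odot>\<^bsub>E\<^esub> x"] x f p by (simp add: E.smult_mult_right)
  then show ?thesis using p by (simp add: field_simps)
qed

theorem op_norm_cstar: "cstar_seminorm E op_norm"
proof -
  have add: "op_norm (f \<oplus>\<^bsub>E\<^esub> g) \<le> op_norm f + op_norm g" if fg: "f \<in> carrier E" "g \<in> carrier E" for f g
  proof (rule op_norm_least)
    fix x assume x: "x \<in> carrier E" "l2_norm x \<le> 1"
    have "l2_norm ((f \<oplus>\<^bsub>E\<^esub> g) \<otimes>\<^bsub>E\<^esub> x) = l2_norm (f \<otimes>\<^bsub>E\<^esub> x \<oplus>\<^bsub>E\<^esub> g \<otimes>\<^bsub>E\<^esub> x)" using fg x by (simp add: E.l_distr)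
    also have "\<dots> \<le> l2_norm (f \<otimes>\<^bsub>E\<^esub> x) + l2_norm (g \<otimes>\<^bsub>E\<^esub> x)"
      unfolding I.monoid_alg_ops(3) using fg x by (intro l2_norm_add I.monoid_algD(1)) auto
    also have "\<dots> \<le> op_norm f + op_norm g" using fg x by (intro add_mono op_norm_upper)
    finally show "l2_norm ((f \<oplus>\<^bsub>E\<^esub> g) \<otimes>\<^bsub>E\<^esub> x) \<le> op_norm f + op_norm g" .
  qed
  have smult_le: "op_norm (c \<odot>\<^bsub>E\<^esub> f) \<le> cmod c * op_norm f" if f: "f \<in> carrier E" for c f
  proof (rule op_norm_least)
    fix x assume x: "x \<in> carrier E" "l2_norm x \<le> 1"
    have "l2_norm (c \<odot>\<^bsub>E\<^esub> f \<otimes>\<^bsub>E\<^esub> x) = l2_norm (c \<odot>\<^bsub>E\<^esub> (f \<otimes>\<^bsub>E\<^esub> x))" using f x by (simp add: E.smult_mult_left)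
    also have "\<dots> = cmod c * l2_norm (f \<otimes>\<^bsub>E\<^esub> x)" by (simp add: I.monoid_alg_ops l2_norm_smult)
    also have "\<dots> \<le> cmod c * op_norm f" using f x by (intro mult_left_mono op_norm_upper) auto
    finally show "l2_norm (c \<odot>\<^bsub>E\<^esub> f \<otimes>\<^bsub>E\<^esub> x) \<le> cmod c * op_norm f" .
  qed
  have mult: "op_norm (f \<otimes>\<^bsub>E\<^esub> g) \<le> op_norm f * op_norm g" if fg: "f \<in> carrier E" "g \<in> carrier E" for f g
  proof (rule op_norm_least)
    fix x assume x: "x \<in> carrier E" "l2_norm x \<le> 1"
    have "l2_norm (f \<otimes>\<^bsub>E\<^esub> g \<otimes>\<^bsub>E\<^esub> x) \<le> op_norm f * l2_norm (g \<otimes>\<^bsub>E\<^esub> x)"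
      using op_norm_bound[of f "g \<otimes>\<^bsub>E\<^esub> x"] fg x by (simp add: E.m_assoc)
    also have "\<dots> \<le> op_norm f * op_norm g" using fg x by (intro mult_left_mono op_norm_upper op_norm_nonneg)
    finally show "l2_norm (f \<otimes>\<^bsub>E\<^esub> g \<otimes>\<^bsub>E\<^esub> x) \<le> op_norm f * op_norm g" .
  qed
  have adj: "op_norm (adj E f) \<le> op_norm f" if f: "f \<in> carrier E" for f
  proof (rule op_norm_least)
    fix x assume x: "x \<in> carrier E" "l2_norm x \<le> 1"
    let ?y = "adj E f \<otimes>\<^bsub>E\<^esub> x"
    have y: "?y \<in> carrier E" using f x by simp
    have "(l2_norm ?y)\<^sup>2 \<le> l2_norm x * l2_norm (f \<otimes>\<^bsub>E\<^esub> ?y)"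
      using l2_norm_mult_square[of "adj E f" x] f x by (simp add: E.m_assoc)
    also have "\<dots> \<le> 1 * (op_norm f * l2_norm ?y)"
      using x op_norm_bound[OF f y] op_norm_nonneg[OF f] by (intro mult_mono) (auto simp: l2_norm_nonneg)
    finally have "l2_norm ?y * l2_norm ?y \<le> op_norm f * l2_norm ?y" by (simp add: power2_eq_square)
    then show "l2_norm ?y \<le> op_norm f"
      using l2_norm_nonneg[of ?y] op_norm_nonneg[OF f] by (cases "l2_norm ?y = 0") auto
  qed
  have square: "(op_norm f)\<^sup>2 \<le> op_norm (adj E f \<otimes>\<^bsub>E\<^esub> f)" if f: "f \<in> carrier E" for f
  proof -
    have ff: "adj E f \<otimes>\<^bsub>E\<^esub> f \<in> carrier E" using f by simp
    have "op_norm f \<le> sqrt (op_norm (adj E f \<otimes>\<^bsub>E\<^esub> f))"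
    proof (rule op_norm_least, rule real_le_rsqrt)
      fix x assume x: "x \<in> carrier E" "l2_norm x \<le> 1"
      have "(l2_norm (f \<otimes>\<^bsub>E\<^esub> x))\<^sup>2 \<le> l2_norm x * l2_norm (adj E f \<otimes>\<^bsub>E\<^esub> f \<otimes>\<^bsub>E\<^esub> x)"
        using f x by (intro l2_norm_mult_square)
      also have "\<dots> \<le> 1 * op_norm (adj E f \<otimes>\<^bsub>E\<^esub> f)"
        using x op_norm_upper[OF ff x] by (intro mult_mono) (auto simp: l2_norm_nonneg)
      finally show "(l2_norm (f \<otimes>\<^bsub>E\<^esub> x))\<^sup>2 \<le> op_norm (adj E f \<otimes>\<^bsub>E\<^esub> f)" by simp
    qed
    then have "(op_norm f)\<^sup>2 \<le> (sqrt (op_norm (adj E f \<otimes>\<^bsub>E\<^esub> f)))\<^sup>2" using op_norm_nonneg[OF f] by (intro power_mono)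
    then show ?thesis using op_norm_nonneg[OF ff] by simp
  qed
  show ?thesis by (intro E.cstar_seminormI op_norm_nonneg add smult_le mult adj square)
qed

text \<open>
  The regular representation is faithful, because \<open>f\<close> is recovered from its action on the unit.
\<close>

lemma op_norm_faithful:
  assumes f: "f \<in> carrier E" "op_norm f = 0"
  shows "f = \<zero>\<^bsub>E\<^esub>"
proof -
  have "l2_norm (f \<otimes>\<^bsub>E\<^esub> \<one>\<^bsub>E\<^esub>) \<le> 0"
    using op_norm_bound[OF f(1) E.one_closed] f(2) by simp
  then have "l2_norm f = 0" using f(1) l2_norm_nonneg[of f] by simp
  then show ?thesis using l2_norm_eq_0[OF I.monoid_algD(1)[OF f(1)]] by (auto simp: I.monoid_alg_ops)
qed

lemma group_seminorm_bounded:
  assumes f: "f \<in> carrier E" and p: "cstar_seminorm E p"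
  shows "p f \<le> (\<Sum>x | f x \<noteq> 0. cmod (f x))"
proof -
  interpret p: cstar_seminormed E p using p by unfold_locales
  have 1: "p (basis_elem x) \<le> 1" if x: "x \<in> carrier G" for x
  proof -
    have "(p (basis_elem x))\<^sup>2 \<le> 1\<^sup>2"
      using p.p_adj_mult[of "basis_elem x"] p.p_one_le x by (simp add: basis_unitary)
    then show ?thesis by (rule power2_le_imp_le) simp
  qed
  have b: "basis_elem ` {y. f y \<noteq> 0} \<subseteq> carrier E"
    using I.monoid_algD(2)[OF f] by (intro image_subsetI I.basis_elem_closed) simp
  have "p f \<le> (\<Sum>x | f x \<noteq> 0. cmod (f x) * p (basis_elem x))"
    using p.p_lincomb[OF b, of f] I.monoid_alg_eq_lincomb[OF f] by simp
  also have "\<dots> \<le> (\<Sum>x | f x \<noteq> 0. cmod (f x) * 1)"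
    using 1 I.monoid_algD(2)[OF f] by (intro sum_mono mult_left_mono) auto
  finally show ?thesis by simp
qed

abbreviation "full_norm \<equiv> universal_seminorm E {}"

lemma full_norm_bdd: "f \<in> carrier E \<Longrightarrow> \<exists>K. \<forall>p. cstar_seminorm E p \<longrightarrow> (\<forall>r\<in>{}. p r = 0) \<longrightarrow> p f \<le> K"
  using group_seminorm_bounded by blast

lemma full_norm_upper: "cstar_seminorm E p \<Longrightarrow> f \<in> carrier E \<Longrightarrow> p f \<le> full_norm f"
  by (rule universal_seminorm_upper[OF _ _ _ full_norm_bdd]) auto

sublocale full: cstar_seminormed E full_norm
  by unfold_locales (rule universal_seminorm_cstar(1)[OF E.star_algebra_axioms full_norm_bdd])

lemma group_cstar_eq: "group_cstar G = completion E full_norm"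
  "group_cstar_elem G x = completion_emb E full_norm (basis_elem x)"
  by (simp_all add: group_cstar_def group_cstar_elem_def universal_cstar_completion)

lemma group_cstar_elem_closed: "x \<in> carrier G \<Longrightarrow> group_cstar_elem G x \<in> carrier (group_cstar G)"
  unfolding group_cstar_eq by (rule star_homD(1)[OF full.completion_facts(6)]) simp

text \<open>
  The full norm dominates that of the regular representation, hence separates group elements.
\<close>

lemma group_cstar_elem_inj:
  assumes xy: "x \<in> carrier G" "y \<in> carrier G" and eq: "group_cstar_elem G x = group_cstar_elem G y"
  shows "x = y"
proof -
  let ?d = "basis_elem x \<ominus>\<^bsub>E\<^esub> basis_elem y"
  have d: "?d \<in> carrier E" using xy by simp
  have b: "basis_elem x \<in> carrier E" "basis_elem y \<in> carrier E" using xy by auto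
  interpret N: cstar_seminormed "completion E full_norm" "nrm (completion E full_norm)"
    by (rule cstar_seminormedI[OF full.completion_facts(1,2)])
  have "completion_emb E full_norm ?d = \<zero>\<^bsub>completion E full_norm\<^esub>"
    using star_hom_eq_iff[OF E.star_algebra_axioms full.completion_facts(1,6) b] eq
    by (simp add: group_cstar_eq)
  then have "full_norm ?d = 0" using full.completion_emb_nrm[OF d] by simp
  then have "op_norm ?d = 0" using full_norm_upper[OF op_norm_cstar d] op_norm_nonneg[OF d] by simp
  then have "?d = \<zero>\<^bsub>E\<^esub>" by (rule op_norm_faithful[OF d])
  then have "basis_elem x = (basis_elem y :: 'g \<Rightarrow> complex)" using E.diff_eq_zero_iff[OF b] by simp
  then have "basis_elem x x = (basis_elem y x :: complex)" by simp
  then show ?thesis by (simp add: basis_elem_def split: if_splits)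
qed

lemma group_cstar_word:
  assumes Q: "star_algebra Q" and h: "h \<in> star_hom (group_cstar G) Q" and g: "range g \<subseteq> carrier G"
  shows "h (group_cstar_elem G (word_eval G (m_inv G) g w)) =
    word_eval Q (adj Q) (\<lambda>i. h (group_cstar_elem G (g i))) w"
proof -
  note e = star_homD[OF full.completion_facts(6), folded group_cstar_eq]
  have elem: "x \<in> carrier G \<Longrightarrow> basis_elem x \<in> carrier E" for x by simp
  have mult: "group_cstar_elem G (x \<otimes> y) = group_cstar_elem G x \<otimes>\<^bsub>group_cstar G\<^esub> group_cstar_elem G y"
    if "x \<in> carrier G" "y \<in> carrier G" for x y
    using e(3)[OF elem elem, OF that] that unfolding group_cstar_eq by (simp add: I.basis_mult)
  have adj: "group_cstar_elem G (inv x) = adj (group_cstar G) (group_cstar_elem G x)" if "x \<in> carrier G" for x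
    using e(6)[OF elem, OF that] that unfolding group_cstar_eq by (simp add: I.basis_adj)
  have one: "group_cstar_elem G \<one> = \<one>\<^bsub>group_cstar G\<^esub>"
    using e(4) unfolding group_cstar_eq by (simp add: I.monoid_alg_ops)
  show ?thesis
  proof (induction w)
    case Nil then show ?case using star_homD(4)[OF h] by (simp add: one)
  next
    case (Cons l w)
    obtain i b where l: "l = (i, b)" by (cases l)
    have gi: "g i \<in> carrier G" using g by auto
    let ?l = "letter_eval G (m_inv G) g l" and ?w = "word_eval G (m_inv G) g w"
    have c: "?l \<in> carrier G" "?w \<in> carrier G" using g by (rule I.letter_eval_closed I.word_eval_closed)+
    have "h (group_cstar_elem G ?l) = letter_eval Q (adj Q) (\<lambda>i. h (group_cstar_elem G (g i))) l"
      using adj[OF gi] star_homD(6)[OF h group_cstar_elem_closed[OF gi]] by (simp add: l)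
    moreover have "h (group_cstar_elem G (?l \<otimes> ?w)) = h (group_cstar_elem G ?l) \<otimes>\<^bsub>Q\<^esub> h (group_cstar_elem G ?w)"
      unfolding mult[OF c] by (rule star_homD(3)[OF h group_cstar_elem_closed[OF c(1)] group_cstar_elem_closed[OF c(2)]])
    ultimately show ?case using Cons by simp
  qed
qed

end

section \<open>Magic matrices that become diagonal\<close>

context star_algebra
begin

lemma lincomb_const:
  assumes "finite S" "x \<in> carrier A"
  shows "lincomb A S c (\<lambda>_. x) = (\<Sum>i\<in>S. c i) \<odot> x"
  using assms(1)
proof (induction S)
  case (insert i S)
  then show ?case using assms(2) by (subst lincomb_insert) (auto simp: smult_add_left)
qed (simp add: assms)

lemma lincomb_single_vector:
  assumes "finite S" "i \<in> S" "V ` S \<subseteq> carrier A" "\<And>j. j \<in> S \<Longrightarrow> j \<noteq> i \<Longrightarrow> V j = \<zero>"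
  shows "lincomb A S c V = c i \<odot> V i"
proof -
  have "lincomb A S c V = lincomb A S (\<lambda>j. if j = i then c i else 0) V"
    unfolding lincomb_def using assms by (intro finsum_cong') auto
  then show ?thesis using assms by (simp add: lincomb_single)
qed

lemma finsum_eq_lincomb:
  assumes "V ` S \<subseteq> carrier A"
  shows "(\<Oplus>i\<in>S. V i) = lincomb A S (\<lambda>_. 1) V"
  unfolding lincomb_def using assms by (intro finsum_cong') auto

end

text \<open>The entries of \<open>U u U\<^sup>*\<close>.\<close>

definition conj_entry ::
  "('a, 'm) star_alg_scheme \<Rightarrow> ('n::finite \<Rightarrow> 'n \<Rightarrow> 'a) \<Rightarrow> complex ^ 'n ^ 'n \<Rightarrow> 'n \<Rightarrow> 'n \<Rightarrow> 'a" where
  "conj_entry A u U i j =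
     lincomb A UNIV (\<lambda>k. U $ i $ k) (\<lambda>k. lincomb A UNIV (\<lambda>l. cnj (U $ j $ l)) (u k))"

lemma conj_coeff_eq:
  fixes A :: "('a, 'm) normed_star_alg_scheme"
  assumes "star_algebra A" "\<And>k l. u k l \<in> carrier A"
  shows "conj_coeff A u U i j = conj_entry A u U i j"
proof -
  interpret A: star_algebra A by fact
  have "(\<Oplus>\<^bsub>A\<^esub>l\<in>UNIV. (U $ i $ k * cnj (U $ j $ l)) \<odot>\<^bsub>A\<^esub> u k l) =
      U $ i $ k \<odot>\<^bsub>A\<^esub> lincomb A UNIV (\<lambda>l. cnj (U $ j $ l)) (u k)" for k
    using assms(2) by (subst A.lincomb_smult) (auto simp: lincomb_def)
  then show ?thesis by (simp add: conj_coeff_def conj_entry_def lincomb_def[of A UNIV "\<lambda>k. U $ i $ k"])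
qed

locale unitary =
  fixes U :: "complex ^ 'n ^ 'n"
  assumes unitary: "unitary_matrix U"
begin

lemma rows: "(\<Sum>k\<in>UNIV. U $ i $ k * cnj (U $ j $ k)) = (if i = j then 1 else 0)"
proof -
  have "(U ** (\<chi> i j. cnj (U $ j $ i))) $ i $ j = mat 1 $ i $ j"
    using unitary by (simp add: unitary_matrix_def Let_def)
  then show ?thesis by (simp add: matrix_matrix_mult_def mat_def)
qed

lemma columns: "(\<Sum>i\<in>UNIV. cnj (U $ i $ k) * U $ i $ l) = (if k = l then 1 else 0)"
proof -
  have "((\<chi> i j. cnj (U $ j $ i)) ** U) $ k $ l = mat 1 $ k $ l"
    using unitary by (simp add: unitary_matrix_def Let_def)
  then show ?thesis by (simp add: matrix_matrix_mult_def mat_def)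
qed

lemma columns': "(\<Sum>i\<in>UNIV. U $ i $ l * cnj (U $ i $ k)) = (if k = l then 1 else 0)"
  using columns[of k l] by (simp add: mult.commute)

text \<open>
  Expanding a vector of \<open>\<complex>\<^sup>n\<close> in the orthonormal basis of the conjugated rows of \<open>U\<close>. The numbers \<open>c1\<close>,
  \<open>c2\<close> and \<open>c3\<close> below are the coefficients of the unit, of the adjoints, and of the products of these
  basis vectors.
\<close>

lemma expand: "(\<Sum>m\<in>UNIV. (\<Sum>l'\<in>UNIV. c l' * U $ m $ l') * cnj (U $ m $ l)) = c l"
proof -
  have "(\<Sum>m\<in>UNIV. (\<Sum>l'\<in>UNIV. c l' * U $ m $ l') * cnj (U $ m $ l)) =
      (\<Sum>l'\<in>UNIV. c l' * (\<Sum>m\<in>UNIV. U $ m $ l' * cnj (U $ m $ l)))"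
    unfolding sum_distrib_right sum_distrib_left by (subst sum.swap) (simp add: mult.assoc)
  then show ?thesis by (simp add: columns' if_distrib cong: if_cong)
qed

lemma expand_cnj: "(\<Sum>m\<in>UNIV. U $ m $ l * (\<Sum>l'\<in>UNIV. c l' * cnj (U $ m $ l'))) = c l"
  using arg_cong[OF expand[of "\<lambda>l. cnj (c l)" l], of cnj] by (simp add: mult.commute)

definition "c1 i = (\<Sum>l\<in>UNIV. U $ i $ l)"
definition "c2 i j = (\<Sum>l\<in>UNIV. U $ i $ l * U $ j $ l)"
definition "c3 i j k = (\<Sum>l\<in>UNIV. cnj (U $ i $ l) * cnj (U $ j $ l) * U $ k $ l)"

lemma diag_relations_eq:
  "diag_relations U = {([(i, False)], []) | i. c1 i \<noteq> 0} \<union>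
    {([(i, False), (j, False)], []) | i j. c2 i j \<noteq> 0} \<union>
    {([(i, False), (j, False)], [(k, False)]) | i j k. c3 i j k \<noteq> 0}"
  by (simp add: diag_relations_def Let_def c1_def c2_def c3_def)

end

text \<open>
  In a C*-algebra the orthogonality within a row follows from the row being a partition of \<open>1\<close> into
  projections; in a mere star algebra it is part of the structure.
\<close>

locale magic = star_algebra A for A :: "('a, 'm) star_alg_scheme" (structure) +
  fixes u :: "'n::finite \<Rightarrow> 'n \<Rightarrow> 'a"
  assumes u_closed: "u k l \<in> carrier A"
    and u_adj: "adj A (u k l) = u k l"
    and u_row_mult: "u k l \<otimes> u k l' = (if l = l' then u k l else \<zero>)"
    and u_row_sum: "lincomb A UNIV (\<lambda>_. 1) (u k) = \<one>"
    and u_col_sum: "lincomb A UNIV (\<lambda>_. 1) (\<lambda>k. u k l) = \<one>"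
begin

text \<open>As its entries are orthogonal projections with sum \<open>1\<close>, row \<open>k\<close> defines a unital star homomorphism on \<open>\<complex>\<^sup>n\<close>.\<close>

definition row :: "'n \<Rightarrow> ('n \<Rightarrow> complex) \<Rightarrow> 'a" where
  "row k c = lincomb A UNIV c (u k)"

lemma u_image: "u k ` S \<subseteq> carrier A" "(\<lambda>k. u k l) ` S \<subseteq> carrier A"
  using u_closed by auto

lemma row_closed [simp]: "row k c \<in> carrier A"
  by (simp add: row_def u_image)

lemma row_mult: "row k c \<otimes> row k d = row k (\<lambda>l. c l * d l)"
proof -
  have "u k l \<otimes> row k d = d l \<odot> u k l" for l
  proof -
    have "u k l \<otimes> row k d = lincomb A UNIV d (\<lambda>l'. if l = l' then u k l else \<zero>)"
      unfolding row_def using u_image u_closed by (simp add: lincomb_mult_left u_row_mult)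
    also have "\<dots> = d l \<odot> (if l = l then u k l else \<zero>)"
      using u_closed by (intro lincomb_single_vector) auto
    finally show ?thesis by simp
  qed
  then have "row k c \<otimes> row k d = lincomb A UNIV c (\<lambda>l. d l \<odot> u k l)"
    by (subst (1) row_def) (simp add: lincomb_mult_right u_image)
  then show ?thesis by (simp add: row_def lincomb_smult_vectors u_image)
qed

lemma row_adj: "adj A (row k c) = row k (\<lambda>l. cnj (c l))"
  by (simp add: row_def lincomb_adj u_image u_adj)

lemma sum_rows: "lincomb A UNIV (\<lambda>_. 1) (\<lambda>k. row k c) = (\<Sum>l\<in>UNIV. c l) \<odot> \<one>"
proof -
  have "lincomb A UNIV (\<lambda>_. 1) (\<lambda>k. row k c) = lincomb A UNIV c (\<lambda>l. lincomb A UNIV (\<lambda>_. 1) (\<lambda>k. u k l))"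
    unfolding row_def using u_closed by (intro lincomb_swap) auto
  then show ?thesis by (simp add: u_col_sum lincomb_const)
qed

end

locale diagonal_magic = magic A u + unitary U
  for A :: "('a, 'm) star_alg_scheme" (structure) and u :: "'n::finite \<Rightarrow> 'n \<Rightarrow> 'a" and U :: "complex ^ 'n ^ 'n" +
  assumes off_diagonal: "i \<noteq> j \<Longrightarrow> conj_entry A u U i j = \<zero>"
begin

definition "V i = conj_entry A u U i i"

lemma conj_entry_row: "conj_entry A u U i j = lincomb A UNIV (\<lambda>k. U $ i $ k) (\<lambda>k. row k (\<lambda>l. cnj (U $ j $ l)))"
  by (simp add: conj_entry_def row_def[abs_def])

lemma conj_entry_closed [simp]: "conj_entry A u U i j \<in> carrier A"
  unfolding conj_entry_row by (intro lincomb_closed) auto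

lemma V_closed [simp]: "V i \<in> carrier A"
  by (simp add: V_def)

text \<open>
  The coaction becomes diagonal in the basis of the conjugated rows of \<open>U\<close>: this is \<open>u U\<^sup>* = U\<^sup>* V\<close>.
\<close>

lemma row_basis: "row k (\<lambda>l. cnj (U $ i $ l)) = cnj (U $ i $ k) \<odot> V i"
proof -
  have "lincomb A UNIV (\<lambda>j. cnj (U $ j $ k)) (\<lambda>j. conj_entry A u U j i) =
      lincomb A UNIV (\<lambda>k'. \<Sum>j\<in>UNIV. cnj (U $ j $ k) * U $ j $ k') (\<lambda>k'. row k' (\<lambda>l. cnj (U $ i $ l)))"
    unfolding conj_entry_row by (intro lincomb_lincomb) auto
  also have "\<dots> = 1 \<odot> row k (\<lambda>l. cnj (U $ i $ l))"
    unfolding columns using lincomb_single[of UNIV k "\<lambda>k'. row k' (\<lambda>l. cnj (U $ i $ l))" 1] by (simp add: eq_commute image_subset_iff)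
  also have "lincomb A UNIV (\<lambda>j. cnj (U $ j $ k)) (\<lambda>j. conj_entry A u U j i) = cnj (U $ i $ k) \<odot> conj_entry A u U i i"
    by (intro lincomb_single_vector) (auto simp: off_diagonal)
  finally show ?thesis by (simp add: V_def)
qed

lemma row_expand: "row k c = lincomb A UNIV (\<lambda>m. (\<Sum>l\<in>UNIV. c l * U $ m $ l) * cnj (U $ m $ k)) V"
proof -
  have "row k c = row k (\<lambda>l. \<Sum>m\<in>UNIV. (\<Sum>l'\<in>UNIV. c l' * U $ m $ l') * cnj (U $ m $ l))"
    by (simp add: expand)
  also have "\<dots> = lincomb A UNIV (\<lambda>m. \<Sum>l\<in>UNIV. c l * U $ m $ l) (\<lambda>m. row k (\<lambda>l. cnj (U $ m $ l)))"
    unfolding row_def by (rule lincomb_lincomb[symmetric]) (auto simp: u_closed)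
  also have "\<dots> = lincomb A UNIV (\<lambda>m. (\<Sum>l\<in>UNIV. c l * U $ m $ l) * cnj (U $ m $ k)) V"
    unfolding row_basis by (intro lincomb_smult_vectors) auto
  finally show ?thesis .
qed

text \<open>
  Comparing coefficients in an identity between rows, by the orthogonality of the rows of \<open>U\<close>; the
  three families of relations are the cases \<open>X = 1\<close>, \<open>X = V\<^sub>i\<^sup>*\<close> and \<open>X = V\<^sub>i V\<^sub>j\<close>.
\<close>

lemma row_extract:
  assumes X: "X \<in> carrier A" and eq: "\<And>k. a k \<odot> X = row k c"
  shows "(\<Sum>k\<in>UNIV. U $ m $ k * a k) \<odot> X = (\<Sum>l\<in>UNIV. c l * U $ m $ l) \<odot> V m"
proof -
  let ?b = "\<lambda>m. \<Sum>l\<in>UNIV. c l * U $ m $ l"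
  have "(\<Sum>k\<in>UNIV. U $ m $ k * a k) \<odot> X = lincomb A UNIV (\<lambda>k. U $ m $ k) (\<lambda>k. a k \<odot> X)"
    using X by (simp add: lincomb_smult_vectors lincomb_const image_subset_iff)
  also have "\<dots> = lincomb A UNIV (\<lambda>k. U $ m $ k) (\<lambda>k. lincomb A UNIV (\<lambda>m. ?b m * cnj (U $ m $ k)) V)"
    unfolding eq row_expand ..
  also have "\<dots> = lincomb A UNIV (\<lambda>m'. \<Sum>k\<in>UNIV. U $ m $ k * (?b m' * cnj (U $ m' $ k))) V"
    by (intro lincomb_lincomb) auto
  also have "\<dots> = lincomb A UNIV (\<lambda>m'. if m' = m then ?b m else 0) V"
  proof (intro lincomb_cong)
    fix m'
    have "(\<Sum>k\<in>UNIV. U $ m $ k * (?b m' * cnj (U $ m' $ k))) = ?b m' * (\<Sum>k\<in>UNIV. U $ m $ k * cnj (U $ m' $ k))"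
      unfolding sum_distrib_left by (intro sum.cong) (auto simp: mult_ac)
    then show "(\<Sum>k\<in>UNIV. U $ m $ k * (?b m' * cnj (U $ m' $ k))) = (if m' = m then ?b m else 0)"
      by (simp add: rows)
  qed auto
  also have "\<dots> = ?b m \<odot> V m" by (intro lincomb_single) auto
  finally show ?thesis .
qed

lemma smult_cancel:
  assumes "c \<noteq> 0" "x \<in> carrier A" "y \<in> carrier A" "c \<odot> x = c \<odot> y"
  shows "x = y"
proof -
  have "(1 / c) \<odot> (c \<odot> x) = (1 / c) \<odot> (c \<odot> y)" using assms by simp
  then show ?thesis using assms(1-3) by (simp add: smult_smult)
qed

lemma V_one: assumes "c1 m \<noteq> 0" shows "V m = \<one>"
proof -
  have "c1 m \<odot> \<one> = c1 m \<odot> V m"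
    using row_extract[of \<one> "\<lambda>_. 1" "\<lambda>_. 1" m] by (simp add: c1_def row_def u_row_sum)
  then show ?thesis using smult_cancel[OF assms] by simp
qed

lemma V_mult: assumes "c3 i j m \<noteq> 0" shows "V i \<otimes> V j = V m"
proof -
  have "(cnj (U $ i $ k) * cnj (U $ j $ k)) \<odot> (V i \<otimes> V j) = row k (\<lambda>l. cnj (U $ i $ l) * cnj (U $ j $ l))" for k
    unfolding row_mult[symmetric] row_basis by (simp add: smult_mult_left smult_mult_right smult_smult mult.commute)
  from row_extract[OF _ this, of m] have "c3 i j m \<odot> (V i \<otimes> V j) = c3 i j m \<odot> V m"
    by (simp add: c3_def mult_ac)
  then show ?thesis using smult_cancel[OF assms] by simp
qed

lemma V_adj: assumes "c2 i m \<noteq> 0" shows "adj A (V i) = V m"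
proof -
  have "U $ i $ k \<odot> adj A (V i) = row k (\<lambda>l. U $ i $ l)" for k
  proof -
    have "adj A (row k (\<lambda>l. cnj (U $ i $ l))) = adj A (cnj (U $ i $ k) \<odot> V i)" by (simp add: row_basis)
    then show ?thesis by (simp add: row_adj adj_smult)
  qed
  from row_extract[OF _ this, of m] have "c2 i m \<odot> adj A (V i) = c2 i m \<odot> V m"
    by (simp add: c2_def mult_ac)
  then show ?thesis using smult_cancel[OF assms] by simp
qed

lemma V_unitary: "adj A (V i) \<otimes> V i = \<one>" "V i \<otimes> adj A (V i) = \<one>"
proof -
  have adj: "U $ i $ k \<odot> adj A (V i) = row k (\<lambda>l. U $ i $ l)" for k
  proof -
    have "adj A (row k (\<lambda>l. cnj (U $ i $ l))) = adj A (cnj (U $ i $ k) \<odot> V i)" by (simp add: row_basis)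
    then show ?thesis by (simp add: row_adj adj_smult)
  qed
  have 1: "x = \<one>" if x: "x \<in> carrier A" "\<And>k. (U $ i $ k * cnj (U $ i $ k)) \<odot> x = row k (\<lambda>l. U $ i $ l * cnj (U $ i $ l))" for x
  proof -
    have "lincomb A UNIV (\<lambda>_. 1) (\<lambda>k. (U $ i $ k * cnj (U $ i $ k)) \<odot> x) = \<one>"
      unfolding x(2) sum_rows by (simp add: rows)
    then show ?thesis using x(1) by (simp add: lincomb_smult_vectors lincomb_const image_subset_iff rows)
  qed
  show "adj A (V i) \<otimes> V i = \<one>"
    by (rule 1, simp, subst row_mult[symmetric], subst row_basis, subst adj[symmetric])
       (simp add: smult_mult_left smult_mult_right smult_smult mult.commute)
  show "V i \<otimes> adj A (V i) = \<one>"
    by (rule 1, simp, subst (2) mult.commute, subst row_mult[symmetric], subst row_basis, subst adj[symmetric])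
       (simp add: smult_mult_left smult_mult_right smult_smult mult.commute)
qed

lemma V_relations:
  assumes "(v, w) \<in> diag_relations U"
  shows "word_eval A (adj A) V v = word_eval A (adj A) V w"
  using assms unfolding diag_relations_eq
  by (auto simp: V_one V_mult) (metis V_adj V_unitary(2))

lemma u_expand: "u k l = lincomb A UNIV (\<lambda>m. U $ m $ l * cnj (U $ m $ k)) V"
proof -
  have "u k l = row k (\<lambda>l'. if l' = l then 1 else 0)"
    unfolding row_def using u_closed by (subst lincomb_single) auto
  also have "\<dots> = lincomb A UNIV (\<lambda>m. U $ m $ l * cnj (U $ m $ k)) V"
    unfolding row_expand by (intro lincomb_cong) (auto simp: if_distrib[of "\<lambda>x. x * _"] cong: if_cong)
  finally show ?thesis .
qed

end

text \<open>
  Conversely, unitaries \<open>V\<^sub>i\<close> satisfying the relations give a magic matrix \<open>u = U\<^sup>* V U\<close>. Each relation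
  is used in the form that its coefficient times the difference of the two sides vanishes, which
  also covers the vanishing coefficients.
\<close>

locale diag_unitaries = star_algebra A + unitary U
  for A :: "('a, 'm) star_alg_scheme" (structure) and V :: "'n::finite \<Rightarrow> 'a" and U :: "complex ^ 'n ^ 'n" +
  assumes V_closed [simp]: "V i \<in> carrier A"
    and V_unitary: "adj A (V i) \<otimes> V i = \<one>"
    and V_relations: "(v, w) \<in> diag_relations U \<Longrightarrow> word_eval A (adj A) V v = word_eval A (adj A) V w"
begin

definition "u k l = lincomb A UNIV (\<lambda>m. U $ m $ l * cnj (U $ m $ k)) V"

lemma V_image: "V ` S \<subseteq> carrier A" by auto

lemma u_closed [simp]: "u k l \<in> carrier A"
  by (simp add: u_def V_image)

lemma V_one: "c1 i \<noteq> 0 \<Longrightarrow> V i = \<one>"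
  using V_relations[of "[(i, False)]" "[]"] by (simp add: diag_relations_eq)

lemma V_mult: "c3 i j k \<noteq> 0 \<Longrightarrow> V i \<otimes> V j = V k"
  using V_relations[of "[(i, False), (j, False)]" "[(k, False)]"] by (simp add: diag_relations_eq)

lemma V_adj: assumes "c2 i j \<noteq> 0" shows "adj A (V i) = V j"
proof -
  have "V i \<otimes> V j = \<one>"
    using V_relations[of "[(i, False), (j, False)]" "[]"] assms by (simp add: diag_relations_eq)
  then have "adj A (V i) \<otimes> V i \<otimes> V j = adj A (V i)" by (simp add: m_assoc)
  then show ?thesis by (simp add: V_unitary)
qed

lemma c1_smult: "c1 i \<odot> V i = c1 i \<odot> \<one>"
  using V_one[of i] by (cases "c1 i = 0") auto

lemma c2_smult: "c2 i j \<odot> adj A (V i) = c2 i j \<odot> V j"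
  using V_adj[of i j] by (cases "c2 i j = 0") auto

lemma c3_smult: "c3 i j k \<odot> (V i \<otimes> V j) = c3 i j k \<odot> V k"
  using V_mult[of i j k] by (cases "c3 i j k = 0") auto

lemma u_adj: "adj A (u k l) = u k l"
proof -
  have "adj A (u k l) = lincomb A UNIV (\<lambda>m. cnj (U $ m $ l) * U $ m $ k) (\<lambda>m. adj A (V m))"
    by (simp add: u_def lincomb_adj V_image)
  also have "\<dots> = lincomb A UNIV (\<lambda>m. cnj (U $ m $ l)) (\<lambda>m. U $ m $ k \<odot> adj A (V m))"
    by (intro lincomb_smult_vectors[symmetric]) auto
  also have "\<dots> = lincomb A UNIV (\<lambda>m. cnj (U $ m $ l)) (\<lambda>m. lincomb A UNIV (\<lambda>j. cnj (U $ j $ k) * c2 m j) V)"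
  proof (intro lincomb_cong)
    fix m
    have "(\<Sum>j\<in>UNIV. cnj (U $ j $ k) * c2 m j) = U $ m $ k"
      using expand[of "\<lambda>l. U $ m $ l" k] by (simp add: c2_def mult.commute)
    then have "U $ m $ k \<odot> adj A (V m) = lincomb A UNIV (\<lambda>j. cnj (U $ j $ k)) (\<lambda>j. c2 m j \<odot> adj A (V m))"
      by (subst lincomb_smult_vectors) (auto simp: lincomb_const)
    also have "\<dots> = lincomb A UNIV (\<lambda>j. cnj (U $ j $ k) * c2 m j) V"
      unfolding c2_smult by (intro lincomb_smult_vectors) auto
    finally show "U $ m $ k \<odot> adj A (V m) = lincomb A UNIV (\<lambda>j. cnj (U $ j $ k) * c2 m j) V" .
  qed auto
  also have "\<dots> = lincomb A UNIV (\<lambda>j. \<Sum>m\<in>UNIV. cnj (U $ m $ l) * (cnj (U $ j $ k) * c2 m j)) V"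
    by (intro lincomb_lincomb) auto
  also have "\<dots> = u k l"
    unfolding u_def
  proof (intro lincomb_cong)
    fix j
    have "(\<Sum>m\<in>UNIV. cnj (U $ m $ l) * c2 m j) = U $ j $ l"
      using expand[of "\<lambda>l. U $ j $ l" l] by (simp add: c2_def mult.commute)
    moreover have "(\<Sum>m\<in>UNIV. cnj (U $ m $ l) * (cnj (U $ j $ k) * c2 m j)) =
        (\<Sum>m\<in>UNIV. cnj (U $ m $ l) * c2 m j) * cnj (U $ j $ k)"
      unfolding sum_distrib_right by (intro sum.cong) (auto simp: mult_ac)
    ultimately show "(\<Sum>m\<in>UNIV. cnj (U $ m $ l) * (cnj (U $ j $ k) * c2 m j)) = U $ j $ l * cnj (U $ j $ k)"
      by simp
  qed auto
  finally show ?thesis .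
qed

lemma u_idem: "u k l \<otimes> u k l = u k l"
proof -
  have "u k l \<otimes> u k l = lincomb A UNIV (\<lambda>i. U $ i $ l * cnj (U $ i $ k)) (\<lambda>i. lincomb A UNIV (\<lambda>j. U $ j $ l * cnj (U $ j $ k)) (\<lambda>j. V i \<otimes> V j))"
    by (subst (1) u_def) (simp add: lincomb_mult_right V_image, simp add: u_def lincomb_mult_left V_image)
  also have "\<dots> = lincomb A UNIV (\<lambda>i. U $ i $ l) (\<lambda>i. lincomb A UNIV (\<lambda>j. U $ j $ l)
      (\<lambda>j. (cnj (U $ i $ k) * cnj (U $ j $ k)) \<odot> (V i \<otimes> V j)))"
    by (subst lincomb_smult_vectors, force, subst lincomb_smult_vectors[symmetric], force, subst lincomb_smult, force)
       (simp add: mult_ac)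
  also have "\<dots> = lincomb A UNIV (\<lambda>i. U $ i $ l) (\<lambda>i. lincomb A UNIV (\<lambda>j. U $ j $ l)
      (\<lambda>j. lincomb A UNIV (\<lambda>m. cnj (U $ m $ k) * c3 i j m) V))"
  proof (intro lincomb_cong)
    fix i j
    have "(\<Sum>m\<in>UNIV. cnj (U $ m $ k) * c3 i j m) = cnj (U $ i $ k) * cnj (U $ j $ k)"
      using expand[of "\<lambda>l. cnj (U $ i $ l) * cnj (U $ j $ l)" k] by (simp add: c3_def mult.commute)
    then have "(cnj (U $ i $ k) * cnj (U $ j $ k)) \<odot> (V i \<otimes> V j) =
        lincomb A UNIV (\<lambda>m. cnj (U $ m $ k)) (\<lambda>m. c3 i j m \<odot> (V i \<otimes> V j))"
      by (subst lincomb_smult_vectors) (auto simp: lincomb_const)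
    also have "\<dots> = lincomb A UNIV (\<lambda>m. cnj (U $ m $ k) * c3 i j m) V"
      unfolding c3_smult by (intro lincomb_smult_vectors) auto
    finally show "(cnj (U $ i $ k) * cnj (U $ j $ k)) \<odot> (V i \<otimes> V j) =
        lincomb A UNIV (\<lambda>m. cnj (U $ m $ k) * c3 i j m) V" .
  qed (auto intro!: lincomb_closed)
  also have "\<dots> = lincomb A UNIV (\<lambda>m. \<Sum>i\<in>UNIV. U $ i $ l * (\<Sum>j\<in>UNIV. U $ j $ l * (cnj (U $ m $ k) * c3 i j m))) V"
    by (simp add: lincomb_lincomb V_image)
  also have "\<dots> = u k l"
    unfolding u_def
  proof (intro lincomb_cong)
    fix m
    have 1: "(\<Sum>j\<in>UNIV. U $ j $ l * c3 i j m) = cnj (U $ i $ l) * U $ m $ l" for i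
      using expand_cnj[of l "\<lambda>l. cnj (U $ i $ l) * U $ m $ l"] by (simp add: c3_def mult_ac)
    have "(\<Sum>i\<in>UNIV. U $ i $ l * (\<Sum>j\<in>UNIV. U $ j $ l * (cnj (U $ m $ k) * c3 i j m))) =
        cnj (U $ m $ k) * (\<Sum>i\<in>UNIV. U $ i $ l * (\<Sum>j\<in>UNIV. U $ j $ l * c3 i j m))"
      by (simp add: sum_distrib_left mult_ac)
    also have "\<dots> = cnj (U $ m $ k) * ((\<Sum>i\<in>UNIV. U $ i $ l * cnj (U $ i $ l)) * U $ m $ l)"
      unfolding 1 by (simp add: sum_distrib_right mult.assoc)
    finally show "(\<Sum>i\<in>UNIV. U $ i $ l * (\<Sum>j\<in>UNIV. U $ j $ l * (cnj (U $ m $ k) * c3 i j m))) = U $ m $ l * cnj (U $ m $ k)"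
      by (simp add: columns' mult.commute)
  qed auto
  finally show ?thesis .
qed

lemma lincomb_c1:
  "lincomb A UNIV (\<lambda>m. a m * c1 m) V = (\<Sum>m\<in>UNIV. a m * c1 m) \<odot> \<one>"
proof -
  have "lincomb A UNIV (\<lambda>m. a m * c1 m) V = lincomb A UNIV a (\<lambda>m. c1 m \<odot> V m)"
    by (intro lincomb_smult_vectors[symmetric]) auto
  also have "\<dots> = lincomb A UNIV (\<lambda>m. a m * c1 m) (\<lambda>_. \<one>)"
    unfolding c1_smult by (intro lincomb_smult_vectors) auto
  finally show ?thesis by (simp add: lincomb_const)
qed

lemma u_row_sum: "lincomb A UNIV (\<lambda>_. 1) (u k) = \<one>"
proof -
  have "lincomb A UNIV (\<lambda>_. 1) (u k) = lincomb A UNIV (\<lambda>m. \<Sum>l\<in>UNIV. 1 * (U $ m $ l * cnj (U $ m $ k))) V"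
    unfolding u_def[abs_def] by (intro lincomb_lincomb) auto
  also have "\<dots> = lincomb A UNIV (\<lambda>m. cnj (U $ m $ k) * c1 m) V"
    by (simp add: c1_def sum_distrib_left mult.commute)
  also have "\<dots> = (\<Sum>m\<in>UNIV. cnj (U $ m $ k) * c1 m) \<odot> \<one>" by (rule lincomb_c1)
  also have "(\<Sum>m\<in>UNIV. cnj (U $ m $ k) * c1 m) = 1"
    using expand[of "\<lambda>_. 1" k] by (simp add: c1_def mult.commute)
  finally show ?thesis by simp
qed

lemma u_col_sum: "lincomb A UNIV (\<lambda>_. 1) (\<lambda>k. u k l) = \<one>"
proof -
  have "lincomb A UNIV (\<lambda>_. 1) (\<lambda>k. u k l) = lincomb A UNIV (\<lambda>m. \<Sum>k\<in>UNIV. 1 * (U $ m $ l * cnj (U $ m $ k))) V"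
    unfolding u_def by (intro lincomb_lincomb) auto
  also have "\<dots> = lincomb A UNIV (\<lambda>m. U $ m $ l * cnj (c1 m)) V"
    by (simp add: c1_def sum_distrib_left)
  \<comment> \<open>write \<open>cnj (c1 m)\<close> as a multiple of \<open>c1 m\<close>\<close>
  also have "\<dots> = lincomb A UNIV (\<lambda>m. (if c1 m = 0 then 0 else U $ m $ l * cnj (c1 m) / c1 m) * c1 m) V"
    by (intro lincomb_cong) auto
  also have "\<dots> = (\<Sum>m\<in>UNIV. (if c1 m = 0 then 0 else U $ m $ l * cnj (c1 m) / c1 m) * c1 m) \<odot> \<one>"
    by (rule lincomb_c1)
  also have "(\<Sum>m\<in>UNIV. (if c1 m = 0 then 0 else U $ m $ l * cnj (c1 m) / c1 m) * c1 m) = (\<Sum>m\<in>UNIV. U $ m $ l * cnj (c1 m))"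
    by (intro sum.cong) auto
  also have "\<dots> = 1"
    using expand_cnj[of l "\<lambda>_. 1"] by (simp add: c1_def)
  finally show ?thesis by simp
qed

lemma conj_entry_u: "conj_entry A u U i j = (if i = j then V i else \<zero>)"
proof -
  have "conj_entry A u U i j = lincomb A UNIV (\<lambda>m. \<Sum>k\<in>UNIV. U $ i $ k * (\<Sum>l\<in>UNIV. cnj (U $ j $ l) * (U $ m $ l * cnj (U $ m $ k)))) V"
    by (simp add: conj_entry_def u_def[abs_def] lincomb_lincomb V_image)
  also have "\<dots> = lincomb A UNIV (\<lambda>m. if m = i then (if i = j then 1 else 0) else 0) V"
  proof (intro lincomb_cong)
    fix m
    have "(\<Sum>k\<in>UNIV. U $ i $ k * (\<Sum>l\<in>UNIV. cnj (U $ j $ l) * (U $ m $ l * cnj (U $ m $ k)))) =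
        (\<Sum>k\<in>UNIV. U $ i $ k * cnj (U $ m $ k)) * (\<Sum>l\<in>UNIV. U $ m $ l * cnj (U $ j $ l))"
    proof -
      have "(\<Sum>l\<in>UNIV. cnj (U $ j $ l) * (U $ m $ l * cnj (U $ m $ k))) =
          cnj (U $ m $ k) * (\<Sum>l\<in>UNIV. U $ m $ l * cnj (U $ j $ l))" for k
        unfolding sum_distrib_left by (intro sum.cong) (auto simp: mult_ac)
      then show ?thesis by (simp add: sum_distrib_right mult.assoc)
    qed
    then show "(\<Sum>k\<in>UNIV. U $ i $ k * (\<Sum>l\<in>UNIV. cnj (U $ j $ l) * (U $ m $ l * cnj (U $ m $ k)))) =
        (if m = i then (if i = j then 1 else 0) else 0)"
      by (auto simp: rows)
  qed auto
  also have "\<dots> = (if i = j then 1 else 0) \<odot> V i" by (intro lincomb_single) auto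
  finally show ?thesis by simp
qed

end

section \<open>The diagonal group of the quantum permutation group\<close>

lemma magic_relations_lincomb:
  fixes F :: "(('n::finite \<times> 'n) word \<Rightarrow> complex) star_alg"
  defines "F \<equiv> free_star_alg"
  shows "magic_relations =
    {indet (i, j) \<ominus>\<^bsub>F\<^esub> adj F (indet (i, j)) | i j. True} \<union>
    {indet (i, j) \<otimes>\<^bsub>F\<^esub> indet (i, j) \<ominus>\<^bsub>F\<^esub> indet (i, j) | i j. True} \<union>
    {lincomb F UNIV (\<lambda>_. 1) (\<lambda>j. indet (i, j)) \<ominus>\<^bsub>F\<^esub> \<one>\<^bsub>F\<^esub> | i. True} \<union>
    {lincomb F UNIV (\<lambda>_. 1) (\<lambda>i. indet (i, j)) \<ominus>\<^bsub>F\<^esub> \<one>\<^bsub>F\<^esub> | j. True}"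
proof -
  interpret F: star_algebra F unfolding F_def by (rule free_star_algebra)
  have "(\<Oplus>\<^bsub>F\<^esub>j\<in>UNIV. indet (i, j)) = lincomb F UNIV (\<lambda>_. 1) (\<lambda>j. indet (i, j))"
    "(\<Oplus>\<^bsub>F\<^esub>i\<in>UNIV. indet (i, j)) = lincomb F UNIV (\<lambda>_. 1) (\<lambda>i. indet (i, j))" for i j :: 'n
    by (rule F.finsum_eq_lincomb, force simp: F_def)+
  then show ?thesis unfolding magic_relations_def Let_def F_def by simp
qed

text \<open>
  Generators that are projections have norm at most \<open>1\<close>; hence so do words. This makes the universal
  seminorm finite.
\<close>

lemma magic_seminorm_bounded:
  fixes f :: "('n::finite \<times> 'n) word \<Rightarrow> complex"
  assumes f: "f \<in> carrier free_star_alg" and p: "cstar_seminorm free_star_alg p"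
    and M: "\<forall>r\<in>magic_relations. p r = 0"
  shows "p f \<le> (\<Sum>w | f w \<noteq> 0. cmod (f w))"
proof -
  let ?F = "free_star_alg :: (('n \<times> 'n) word \<Rightarrow> complex) star_alg"
  interpret p: cstar_seminormed ?F p
    by (rule cstar_seminormedI[OF free_star_algebra p])
  have x1: "p (indet (i, j)) \<le> 1" for i j
  proof -
    let ?x = "indet (i, j) :: ('n \<times> 'n) word \<Rightarrow> complex"
    have x: "?x \<in> carrier ?F" by simp
    have x_adj: "?x \<ominus>\<^bsub>?F\<^esub> adj ?F ?x \<in> magic_relations" and x_idem: "?x \<otimes>\<^bsub>?F\<^esub> ?x \<ominus>\<^bsub>?F\<^esub> ?x \<in> magic_relations"
      unfolding magic_relations_lincomb by blast+
    have "adj ?F ?x \<otimes>\<^bsub>?F\<^esub> ?x \<ominus>\<^bsub>?F\<^esub> ?x \<otimes>\<^bsub>?F\<^esub> ?x = (adj ?F ?x \<ominus>\<^bsub>?F\<^esub> ?x) \<otimes>\<^bsub>?F\<^esub> ?x"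
      using x p.adj_closed[OF x] by algebra
    then have "p (adj ?F ?x \<otimes>\<^bsub>?F\<^esub> ?x \<ominus>\<^bsub>?F\<^esub> ?x \<otimes>\<^bsub>?F\<^esub> ?x) \<le> p (adj ?F ?x \<ominus>\<^bsub>?F\<^esub> ?x) * p ?x"
      using p.p_mult[of "adj ?F ?x \<ominus>\<^bsub>?F\<^esub> ?x" ?x] by simp
    also have "p (adj ?F ?x \<ominus>\<^bsub>?F\<^esub> ?x) = 0"
      using M x_adj p.p_diff_commute[of ?x "adj ?F ?x"] by simp
    finally have "p (adj ?F ?x \<otimes>\<^bsub>?F\<^esub> ?x) \<le> p (?x \<otimes>\<^bsub>?F\<^esub> ?x)"
      using p.p_diff_ge[of "adj ?F ?x \<otimes>\<^bsub>?F\<^esub> ?x" "?x \<otimes>\<^bsub>?F\<^esub> ?x"] by simp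
    also have "\<dots> \<le> p ?x"
      using M x_idem p.p_diff_ge[of "?x \<otimes>\<^bsub>?F\<^esub> ?x" ?x] by simp
    finally have "p ?x * p ?x \<le> 1 * p ?x" by (simp add: p.p_adj_mult power2_eq_square)
    then show ?thesis using p.p_nonneg[OF x] by (cases "p ?x = 0") auto
  qed
  have w1: "p (basis_elem w) \<le> 1" for w
  proof (induction w)
    case Nil then show ?case using p.p_one_le by (simp add: free_basis(2))
  next
    case (Cons l w)
    obtain i j c where l: "l = ((i, j), c)" by (metis surj_pair)
    have "p (basis_elem [l]) \<le> 1" using x1[of i j] by (cases c) (simp_all add: l free_basis(4,5))
    then have "p (basis_elem [l]) * p (basis_elem w) \<le> 1 * 1"
      using Cons by (intro mult_mono) (auto intro: p.p_nonneg free_basis(1))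
    then show ?case
      using p.p_mult[of "basis_elem [l]" "basis_elem w"] by (simp add: free_basis(1) free_basis(3)[of l w])
  qed
  have "f = lincomb ?F {w. f w \<noteq> 0} f basis_elem"
    using involutive_monoid.monoid_alg_eq_lincomb[OF word_involutive_monoid] f unfolding free_star_alg_def by blast
  then have "p f \<le> (\<Sum>w | f w \<noteq> 0. cmod (f w) * p (basis_elem w))"
    using p.p_lincomb[of basis_elem "{w. f w \<noteq> 0}" f] by (simp add: image_subset_iff free_basis(1))
  also have "\<dots> \<le> (\<Sum>w | f w \<noteq> 0. cmod (f w) * 1)"
    using w1 by (intro sum_mono mult_left_mono) auto
  finally show ?thesis by simp
qed

abbreviation magic_norm :: "(('n::finite \<times> 'n) word \<Rightarrow> complex) \<Rightarrow> real" where
  "magic_norm \<equiv> universal_seminorm free_star_alg magic_relations"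

lemma magic_bdd:
  "f \<in> carrier free_star_alg \<Longrightarrow>
    \<exists>K. \<forall>p. cstar_seminorm free_star_alg p \<longrightarrow> (\<forall>r\<in>magic_relations. p r = 0) \<longrightarrow> p f \<le> K"
  using magic_seminorm_bounded by blast

interpretation free: cstar_seminormed free_star_alg magic_norm
  by (intro cstar_seminormedI free_star_algebra universal_seminorm_cstar(1) magic_bdd)

lemma quantum_perm_alg_eq:
  "quantum_perm_alg = completion free_star_alg magic_norm"
  "quantum_perm_gen i j = completion_emb free_star_alg magic_norm (indet (i, j))"
  by (simp_all add: quantum_perm_alg_def quantum_perm_gen_def universal_cstar_completion)

lemma quantum_perm_emb:
  "completion_emb free_star_alg magic_norm \<in> star_hom free_star_alg quantum_perm_alg"
  unfolding quantum_perm_alg_eq by (rule free.completion_facts)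

lemma quantum_perm_star_algebra: "star_algebra quantum_perm_alg"
  unfolding quantum_perm_alg_eq by (rule free.completion_facts)

text \<open>
  The relations hold by construction of the universal seminorm; orthogonality within rows comes from
  the theorem on projections with sum \<open>1\<close>, as the norm of the completion is definite.
\<close>

lemma quantum_perm_magic:
  "magic (quantum_perm_alg :: (nat \<Rightarrow> ('n::finite \<times> 'n) word \<Rightarrow> complex) set normed_star_alg) quantum_perm_gen"
proof -
  let ?F = "free_star_alg :: (('n \<times> 'n) word \<Rightarrow> complex) star_alg"
  let ?A = "quantum_perm_alg :: (nat \<Rightarrow> ('n \<times> 'n) word \<Rightarrow> complex) set normed_star_alg"
  let ?u = "quantum_perm_gen :: 'n \<Rightarrow> 'n \<Rightarrow> _"
  let ?e = "completion_emb free_star_alg magic_norm :: (('n \<times> 'n) word \<Rightarrow> complex) \<Rightarrow> _"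
  interpret A: cstar_seminormed ?A "nrm ?A"
    unfolding quantum_perm_alg_eq by (rule cstar_seminormedI[OF free.completion_facts(1,2)])
  note e = star_homD[OF quantum_perm_emb]
  have u: "?u k l = ?e (indet (k, l))" for k l by (rule quantum_perm_alg_eq)
  have uc: "?u k l \<in> carrier ?A" for k l unfolding u by (rule e(1)) simp
  have rel: "?e a = ?e b" if "a \<in> carrier ?F" "b \<in> carrier ?F" "a \<ominus>\<^bsub>?F\<^esub> b \<in> magic_relations" for a b
  proof -
    have d: "a \<ominus>\<^bsub>?F\<^esub> b \<in> carrier ?F" using that by simp
    have "magic_norm (a \<ominus>\<^bsub>?F\<^esub> b) = 0"
      using universal_seminorm_cstar(2)[OF free_star_algebra magic_bdd that(3) d] .
    then have "?e (a \<ominus>\<^bsub>?F\<^esub> b) = \<zero>\<^bsub>?A\<^esub>"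
      using free.completion_emb_nrm[OF d] e(1)[OF d] free.completion_nrm_zero unfolding quantum_perm_alg_eq by simp
    then show ?thesis
      using star_hom_eq_iff[OF free_star_algebra quantum_perm_star_algebra quantum_perm_emb that(1,2)] by simp
  qed
  have adj: "adj ?A (?u k l) = ?u k l" for k l
    unfolding u e(6)[OF indet_closed, symmetric] by (rule rel[symmetric]) (auto simp: magic_relations_lincomb)
  have idem: "?u k l \<otimes>\<^bsub>?A\<^esub> ?u k l = ?u k l" for k l
    unfolding u e(3)[OF indet_closed indet_closed, symmetric] by (rule rel) (auto simp: magic_relations_lincomb)
  have lc: "(\<lambda>l. indet (f l)) ` UNIV \<subseteq> carrier ?F" for f :: "'n \<Rightarrow> 'n \<times> 'n" by auto
  note hl = star_hom_lincomb[OF free_star_algebra quantum_perm_star_algebra quantum_perm_emb, symmetric]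
  have row: "lincomb ?A UNIV (\<lambda>_. 1) (?u k) = \<one>\<^bsub>?A\<^esub>" for k
  proof -
    have "lincomb ?A UNIV (\<lambda>_. 1) (\<lambda>l. ?e (indet (k, l))) = ?e \<one>\<^bsub>?F\<^esub>"
      unfolding hl[OF lc[of "Pair k"]] by (rule rel) (auto simp: magic_relations_lincomb)
    then show ?thesis unfolding e(4) u[abs_def] .
  qed
  have col: "lincomb ?A UNIV (\<lambda>_. 1) (\<lambda>k. ?u k l) = \<one>\<^bsub>?A\<^esub>" for l
  proof -
    have "lincomb ?A UNIV (\<lambda>_. 1) (\<lambda>k. ?e (indet (k, l))) = ?e \<one>\<^bsub>?F\<^esub>"
      unfolding hl[OF lc[of "\<lambda>k. (k, l)"]] by (rule rel) (auto simp: magic_relations_lincomb)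
    then show ?thesis unfolding e(4) u .
  qed
  have orth: "?u k l \<otimes>\<^bsub>?A\<^esub> ?u k l' = \<zero>\<^bsub>?A\<^esub>" if "l \<noteq> l'" for k l l'
  proof -
    have "nrm ?A (?u k l \<otimes>\<^bsub>?A\<^esub> ?u k l') = 0"
      using that by (intro A.projections_sum_one_orthogonal[of UNIV]) (auto simp: uc adj idem row)
    moreover have "?u k l \<otimes>\<^bsub>?A\<^esub> ?u k l' \<in> carrier ?A" using uc by simp
    ultimately show ?thesis using free.completion_nrm_zero unfolding quantum_perm_alg_eq(1) by blast
  qed
  show ?thesis
    by unfold_locales (auto simp: uc adj idem row col orth)
qed

lemma star_hom_conj_entry:
  assumes "star_algebra A" "star_algebra B" "h \<in> star_hom A B" "\<And>k l. u k l \<in> carrier A"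
  shows "h (conj_entry A u U i j) = conj_entry B (\<lambda>k l. h (u k l)) U i j"
proof -
  interpret A: star_algebra A by fact
  have "u k ` UNIV \<subseteq> carrier A" for k using assms(4) by auto
  moreover from this have "(\<lambda>k. lincomb A UNIV (\<lambda>l. cnj (U $ j $ l)) (u k)) ` UNIV \<subseteq> carrier A" by auto
  ultimately show ?thesis unfolding conj_entry_def by (simp add: star_hom_lincomb[OF assms(1-3)])
qed

lemma seminorm_descends:
  assumes A: "star_algebra A" and B: "star_algebra B" and h: "h \<in> star_hom A B" "h ` carrier A = carrier B"
    and p: "cstar_seminorm A p" and eq: "\<And>x y. x \<in> carrier A \<Longrightarrow> y \<in> carrier A \<Longrightarrow> h x = h y \<Longrightarrow> p x = p y"
  shows "\<exists>q. cstar_seminorm B q \<and> (\<forall>x\<in>carrier A. q (h x) = p x)"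
proof -
  interpret p: cstar_seminormed A p using A p by (rule cstar_seminormedI)
  define q where "q b = p (SOME x. x \<in> carrier A \<and> h x = b)" for b
  have q: "q (h x) = p x" if x: "x \<in> carrier A" for x
  proof -
    have "(SOME y. y \<in> carrier A \<and> h y = h x) \<in> carrier A \<and> h (SOME y. y \<in> carrier A \<and> h y = h x) = h x"
      by (rule someI[of _ x]) (simp add: x)
    then show ?thesis unfolding q_def using eq x by blast
  qed
  note hD = star_homD(2-6)[OF h(1), symmetric]
  have "cstar_seminorm B q"
    unfolding cstar_seminorm_def h(2)[symmetric]
    by (auto simp: hD q p.p_nonneg p.p_add p.p_smult p.p_mult p.p_adj_mult)
  then show ?thesis using q by blast
qed

lemma seminorm_pullback:
  assumes A: "star_algebra A" and h: "h \<in> star_hom A B" and p: "cstar_seminorm B p"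
  shows "cstar_seminorm A (\<lambda>x. p (h x))"
proof -
  interpret A: star_algebra A by fact
  show ?thesis using p star_homD[OF h] unfolding cstar_seminorm_def by simp
qed

context unitary
begin

abbreviation "P \<equiv> presented_group (diag_relations U)"
abbreviation "\<gamma> \<equiv> presented_gen (diag_relations U)"

sublocale P: group_star_algebra P
  by (simp add: group_star_algebra_def presented_group)

lemma group_alg_word: "basis_elem (cls (diag_relations U) w) = word_eval P.E (adj P.E) (\<lambda>i. basis_elem (\<gamma> i)) w"
proof (induction w)
  case Nil
  then show ?case by (simp add: P.I.monoid_alg_ops presented_one)
next
  case (Cons l w)
  obtain i b where l: "l = (i, b)" by (cases l)
  have c: "cls (diag_relations U) v \<in> carrier P" for v by (simp add: presented_carrier)
  have "basis_elem (cls (diag_relations U) [l]) = letter_eval P.E (adj P.E) (\<lambda>i. basis_elem (\<gamma> i)) l"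
    using P.I.basis_adj[OF presented_gen_closed, of i]
    by (simp add: l presented_gen_def presented_inv word_inv_def)
  moreover have "cls (diag_relations U) (l # w) = cls (diag_relations U) [l] \<otimes>\<^bsub>P\<^esub> cls (diag_relations U) w"
    by (simp add: presented_mult)
  ultimately show ?case using Cons P.I.basis_mult[OF c c, of "[l]" w] by simp
qed

sublocale P_unitaries: diag_unitaries P.E "\<lambda>i. basis_elem (\<gamma> i)" U
proof unfold_locales
  show "basis_elem (\<gamma> i) \<in> carrier P.E" for i by (simp add: presented_gen_closed)
  show "adj P.E (basis_elem (\<gamma> i)) \<otimes>\<^bsub>P.E\<^esub> basis_elem (\<gamma> i) = \<one>\<^bsub>P.E\<^esub>" for i
    by (rule P.basis_unitary) (rule presented_gen_closed)
  show "word_eval P.E (adj P.E) (\<lambda>i. basis_elem (\<gamma> i)) v = word_eval P.E (adj P.E) (\<lambda>i. basis_elem (\<gamma> i)) w"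
    if "(v, w) \<in> diag_relations U" for v w
    using presented_rel[OF that] by (simp add: group_alg_word[symmetric])
qed

abbreviation "A \<equiv> quantum_perm_alg :: (nat \<Rightarrow> ('n \<times> 'n) word \<Rightarrow> complex) set normed_star_alg"
abbreviation "J \<equiv> diag_ideal A quantum_perm_gen U"
abbreviation "Q \<equiv> quotient_alg A J"

sublocale A: magic A quantum_perm_gen
  by (rule quantum_perm_magic)

lemma conj_coeff_closed: "conj_entry A quantum_perm_gen U i j \<in> carrier A"
  unfolding conj_entry_def using A.u_closed by (auto intro!: A.lincomb_closed)

lemma diag_ideal_closed: "closed_star_ideal A J" "i \<noteq> j \<Longrightarrow> conj_entry A quantum_perm_gen U i j \<in> J"
proof -
  let ?S = "{conj_coeff A quantum_perm_gen U i j |i j. i \<noteq> j}"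
  interpret nA: cstar_seminormed A "nrm A"
    unfolding quantum_perm_alg_eq by (rule cstar_seminormedI[OF free.completion_facts(1,2)])
  have c: "conj_coeff A quantum_perm_gen U i j = conj_entry A quantum_perm_gen U i j" for i j
    by (rule conj_coeff_eq[OF A.star_algebra_axioms A.u_closed])
  have S: "?S \<subseteq> carrier A" unfolding c using conj_coeff_closed by auto
  have nn: "0 \<le> nrm A (x \<ominus>\<^bsub>A\<^esub> y)" if "x \<in> carrier A" "y \<in> carrier A" for x y
    using that by (intro nA.p_nonneg A.minus_closed)
  show "closed_star_ideal A J" unfolding diag_ideal_def by (rule generated_ideal_closed(1)[OF A.star_algebra_axioms nn S])
  have "?S \<subseteq> J" unfolding diag_ideal_def by (rule generated_ideal_closed(2)[OF A.star_algebra_axioms nn S])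
  then show "conj_entry A quantum_perm_gen U i j \<in> J" if "i \<noteq> j" using that c[of i j] by blast
qed

sublocale J: star_ideal A J
  by (rule closed_star_idealD[OF A.star_algebra_axioms diag_ideal_closed(1)])

abbreviation "v k l \<equiv> J +>\<^bsub>A\<^esub> quantum_perm_gen k l"

lemma quotient_conj_entry: "J +>\<^bsub>A\<^esub> conj_entry A quantum_perm_gen U i j = conj_entry Q v U i j"
  by (rule star_hom_conj_entry[OF A.star_algebra_axioms J.quotient_star_algebra J.rcos_star_hom A.u_closed])

sublocale Q: diagonal_magic Q v U
proof -
  interpret Q: star_algebra Q by (rule J.quotient_star_algebra)
  note h = star_homD[OF J.rcos_star_hom]
  note hl = star_hom_lincomb[OF A.star_algebra_axioms J.quotient_star_algebra J.rcos_star_hom, symmetric]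
  show "diagonal_magic Q v U"
  proof unfold_locales
    show "v k l \<in> carrier Q" for k l by (rule h(1)[OF A.u_closed])
    show "adj Q (v k l) = v k l" for k l using h(6)[OF A.u_closed, of k l] by (simp add: A.u_adj)
    show "v k l \<otimes>\<^bsub>Q\<^esub> v k l' = (if l = l' then v k l else \<zero>\<^bsub>Q\<^esub>)" for k l l'
      using h(3)[OF A.u_closed A.u_closed, of k l k l'] star_hom_zero[OF A.star_algebra_axioms J.quotient_star_algebra J.rcos_star_hom]
      by (auto simp: A.u_row_mult)
    show "lincomb Q UNIV (\<lambda>_. 1) (v k) = \<one>\<^bsub>Q\<^esub>" for k
      using hl[of "quantum_perm_gen k" UNIV "\<lambda>_. 1"] h(4) A.u_image by (simp add: A.u_row_sum)
    show "lincomb Q UNIV (\<lambda>_. 1) (\<lambda>k. v k l) = \<one>\<^bsub>Q\<^esub>" for l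
      using hl[of "\<lambda>k. quantum_perm_gen k l" UNIV "\<lambda>_. 1"] h(4) A.u_image by (simp add: A.u_col_sum)
    show "conj_entry Q v U i j = \<zero>\<^bsub>Q\<^esub>" if "i \<noteq> j" for i j
      unfolding quotient_conj_entry[symmetric] J.quotient_zero
      using A.rcos_zero_iff[OF J.is_ideal conj_coeff_closed] diag_ideal_closed(2)[OF that] by blast
  qed
qed

text \<open>The diagonal entries in the quotient are unitaries satisfying the relations, so they represent \<open>\<complex>[P]\<close>.\<close>

lemma group_alg_to_quotient: "\<exists>\<Lambda>\<in>star_hom P.E Q. \<forall>i. \<Lambda> (basis_elem (\<gamma> i)) = Q.V i"
proof -
  interpret IQ: involutive_monoid Q "adj Q" by (rule Q.star_involutive_monoid)
  have V: "range Q.V \<subseteq> carrier Q" by auto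
  define \<theta> where "\<theta> X = word_eval Q (adj Q) Q.V (SOME w. X = cls (diag_relations U) w)" for X
  have \<theta>: "\<theta> (cls (diag_relations U) w) = word_eval Q (adj Q) Q.V w" for w
  proof -
    have "cls (diag_relations U) w = cls (diag_relations U) (SOME v. cls (diag_relations U) w = cls (diag_relations U) v)"
      by (rule someI[of _ w]) simp
    then have "(w, SOME v. cls (diag_relations U) w = cls (diag_relations U) v) \<in> word_congruence (diag_relations U)"
      unfolding cls_eq_iff .
    then show ?thesis unfolding \<theta>_def
      by (intro IQ.word_eval_congruence[OF V _ _ Q.V_relations, symmetric]) (auto simp: Q.V_unitary)
  qed
  have "\<exists>\<Lambda>\<in>star_hom P.E Q. \<forall>x\<in>carrier P. \<Lambda> (basis_elem x) = \<theta> x"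
  proof (rule P.I.monoid_alg_lift[OF Q.star_algebra_axioms])
    fix X Y assume "X \<in> carrier P" "Y \<in> carrier P"
    then obtain v w where vw: "X = cls (diag_relations U) v" "Y = cls (diag_relations U) w" by (auto simp: presented_carrier)
    show "\<theta> X \<in> carrier Q" "\<theta> (X \<otimes>\<^bsub>P\<^esub> Y) = \<theta> X \<otimes>\<^bsub>Q\<^esub> \<theta> Y" "\<theta> (inv\<^bsub>P\<^esub> X) = adj Q (\<theta> X)"
      unfolding vw presented_mult presented_inv \<theta>
      by (rule IQ.word_eval_closed[OF V] IQ.word_eval_append[OF V] IQ.word_eval_inv[OF V])+
  next
    show "\<theta> \<one>\<^bsub>P\<^esub> = \<one>\<^bsub>Q\<^esub>" unfolding presented_one \<theta> by simp
  qed
  then obtain \<Lambda> where \<Lambda>: "\<Lambda> \<in> star_hom P.E Q" "\<And>x. x \<in> carrier P \<Longrightarrow> \<Lambda> (basis_elem x) = \<theta> x" by blast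
  have "\<Lambda> (basis_elem (\<gamma> i)) = Q.V i" for i
    using \<Lambda>(2)[OF presented_gen_closed, of i] Q.V_closed[of i] unfolding presented_gen_def \<theta> by simp
  then show ?thesis using \<Lambda>(1) by blast
qed

text \<open>
  The magic matrix \<open>U\<^sup>* diag(\<gamma>) U\<close> over \<open>\<complex>[P]\<close> defines \<open>\<Phi>\<close> from the free star algebra onto \<open>\<complex>[P]\<close>. Composing
  \<open>\<Phi>\<close> with the representation \<open>\<Lambda>\<close> of \<open>\<complex>[P]\<close> in the quotient recovers the quotient map, so the kernel of \<open>\<Phi>\<close>
  lies in the ideal. Moreover the quotient seminorm along \<open>\<Phi>\<close> is the full norm on \<open>\<complex>[P]\<close>: it is a
  C*-seminorm on \<open>\<complex>[P]\<close>, hence at most the full norm, and the full norm pulls back to a C*-seminorm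
  killing the magic relations. Thus the theorem on quotients of completions applies.
\<close>

theorem presented_is_diag_group: "is_diag_group quantum_perm_alg quantum_perm_gen U P \<gamma>"
proof -
  let ?F = "free_star_alg :: (('n \<times> 'n) word \<Rightarrow> complex) star_alg"
  let ?e = "completion_emb ?F magic_norm"
  let ?x = "\<lambda>k l. indet (k, l) :: ('n \<times> 'n) word \<Rightarrow> complex"
  note E = P.E.star_algebra_axioms
  obtain \<Phi> where \<Phi>: "\<Phi> \<in> star_hom ?F P.E" "\<And>k l. \<Phi> (?x k l) = P_unitaries.u k l"
  proof -
    have "range (\<lambda>(k, l). P_unitaries.u k l) \<subseteq> carrier P.E" by auto
    from free_star_alg_lift[OF E this] obtain h where "h \<in> star_hom ?F P.E"
      "\<forall>x. h (indet x) = (case x of (k, l) \<Rightarrow> P_unitaries.u k l)" by blast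
    then show ?thesis using that[of h] by simp
  qed
  note \<Phi>D = star_homD[OF \<Phi>(1)]
  have xc: "conj_entry ?F ?x U i j \<in> carrier ?F" for i j
    unfolding conj_entry_def by (auto intro!: free.lincomb_closed)
  have \<Phi>_conj: "\<Phi> (conj_entry ?F ?x U i j) = (if i = j then basis_elem (\<gamma> i) else \<zero>\<^bsub>P.E\<^esub>)" for i j
    unfolding star_hom_conj_entry[OF free_star_algebra E \<Phi>(1) indet_closed] \<Phi>(2) by (rule P_unitaries.conj_entry_u)
  have \<Phi>_surj: "\<Phi> ` carrier ?F = carrier P.E"
  proof (intro equalityI subsetI)
    interpret IF: involutive_monoid ?F "adj ?F" by (rule free.star_involutive_monoid)
    let ?w = "word_eval ?F (adj ?F) (\<lambda>i. conj_entry ?F ?x U i i)"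
    have r: "range (\<lambda>i. conj_entry ?F ?x U i i) \<subseteq> carrier ?F" using xc by auto
    have wc: "?w w \<in> carrier ?F" for w by (rule IF.word_eval_closed[OF r])
    have "\<Phi> (?w w) = basis_elem (cls (diag_relations U) w)" for w
      unfolding group_alg_word
    proof (induction w)
      case (Cons l w)
      obtain i b where l: "l = (i, b)" by (cases l)
      have "\<Phi> (letter_eval ?F (adj ?F) (\<lambda>i. conj_entry ?F ?x U i i) l) = letter_eval P.E (adj P.E) (\<lambda>i. basis_elem (\<gamma> i)) l"
        by (simp add: l \<Phi>D(6)[OF xc] \<Phi>_conj)
      then show ?case using Cons \<Phi>D(3)[OF IF.letter_eval_closed[OF r] wc] by simp
    qed (simp add: \<Phi>D(4))
    then have "\<forall>X. \<exists>y. X \<in> carrier P \<longrightarrow> y \<in> carrier ?F \<and> \<Phi> y = basis_elem X"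
      using wc by (auto simp: presented_carrier)
    then obtain y where y: "\<And>X. X \<in> carrier P \<Longrightarrow> y X \<in> carrier ?F" "\<And>X. X \<in> carrier P \<Longrightarrow> \<Phi> (y X) = basis_elem X"
      by metis
    fix f assume f: "f \<in> carrier P.E"
    let ?S = "{X. f X \<noteq> 0}"
    have S: "X \<in> ?S \<Longrightarrow> X \<in> carrier P" for X using P.I.monoid_algD(2)[OF f] by simp
    have yS: "y ` ?S \<subseteq> carrier ?F" using y(1) S by blast
    have "f = lincomb P.E ?S f basis_elem" by (rule P.I.monoid_alg_eq_lincomb[OF f])
    also have "\<dots> = lincomb P.E ?S f (\<lambda>X. \<Phi> (y X))"
      using y S by (intro P.E.lincomb_cong) (auto intro!: \<Phi>D(1))
    also have "\<dots> = \<Phi> (lincomb ?F ?S f y)" by (rule star_hom_lincomb[OF free_star_algebra E \<Phi>(1) yS, symmetric])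
    finally show "f \<in> \<Phi> ` carrier ?F" using free.lincomb_closed[OF yS] by blast
  qed (use \<Phi>D(1) in auto)
  let ?K = "{y \<in> carrier ?F. \<Phi> y = \<zero>\<^bsub>P.E\<^esub>}"
  have K: "ideal ?K ?F"
  proof -
    have "ring_hom_ring ?F P.E \<Phi>"
      using \<Phi>(1) free.ring_axioms P.E.ring_axioms by (intro ring_hom_ringI2) (auto simp: star_hom_def)
    then show ?thesis using ring_hom_ring.kernel_is_ideal[of ?F P.E \<Phi>] by (simp add: a_kernel_def')
  qed
  note diff = star_hom_diff[OF free_star_algebra E \<Phi>(1)]
  have \<Phi>_rel: "\<Phi> r = \<zero>\<^bsub>P.E\<^esub>" if "r \<in> magic_relations" for r
  proof -
    have z: "\<Phi> (a \<ominus>\<^bsub>?F\<^esub> b) = \<zero>\<^bsub>P.E\<^esub>" if "a \<in> carrier ?F" "b \<in> carrier ?F" "\<Phi> a = \<Phi> b" for a b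
      using star_hom_eq_iff[OF free_star_algebra E \<Phi>(1)] that by blast
    have im: "(\<lambda>l. indet (f l)) ` UNIV \<subseteq> carrier ?F" for f :: "'n \<Rightarrow> 'n \<times> 'n" by auto
    note hl = star_hom_lincomb[OF free_star_algebra E \<Phi>(1) im]
    show ?thesis using that unfolding magic_relations_lincomb
      by (auto intro!: z free.lincomb_closed simp: hl \<Phi>D(3,4,6) \<Phi>(2) P_unitaries.u_adj P_unitaries.u_idem
          P_unitaries.u_row_sum P_unitaries.u_col_sum)
  qed
  have q: "P.full_norm (\<Phi> x) = quotient_seminorm ?F magic_norm ?K x" if x: "x \<in> carrier ?F" for x
  proof (rule antisym)
    have le: "P.full_norm (\<Phi> y) \<le> magic_norm y" if "y \<in> carrier ?F" for y
    proof (rule universal_seminorm_upper[OF that _ _ magic_bdd])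
      show "cstar_seminorm ?F (\<lambda>y. P.full_norm (\<Phi> y))"
        by (rule seminorm_pullback[OF free_star_algebra \<Phi>(1) P.full.p_cstar])
    qed (auto simp: \<Phi>_rel)
    show "P.full_norm (\<Phi> x) \<le> quotient_seminorm ?F magic_norm ?K x"
    proof (rule free.quotient_seminorm_greatest[OF K])
      fix j assume j: "j \<in> ?K"
      then have "\<Phi> (x \<ominus>\<^bsub>?F\<^esub> j) = \<Phi> x" using diff[of x j] x \<Phi>D(1)[OF x] by (simp add: P.E.minus_eq)
      then show "P.full_norm (\<Phi> x) \<le> magic_norm (x \<ominus>\<^bsub>?F\<^esub> j)" using le[of "x \<ominus>\<^bsub>?F\<^esub> j"] x j by simp
    qed
    let ?q = "quotient_seminorm ?F magic_norm ?K"
    have cq: "cstar_seminorm ?F ?q"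
    proof (rule free.quotient_cstar_seminorm[OF K])
      fix y assume "y \<in> ?K"
      then show "adj ?F y \<in> ?K" by (simp add: \<Phi>D(6))
    qed
    interpret q: cstar_seminormed ?F ?q by unfold_locales (rule cq)
    have "?q y = ?q z" if yz: "y \<in> carrier ?F" "z \<in> carrier ?F" "\<Phi> y = \<Phi> z" for y z
    proof -
      have "y \<ominus>\<^bsub>?F\<^esub> z \<in> ?K" using yz star_hom_eq_iff[OF free_star_algebra E \<Phi>(1) yz(1,2)] by simp
      then have "?q (y \<ominus>\<^bsub>?F\<^esub> z) = 0" by (rule free.quotient_seminorm_ideal[OF K])
      then show ?thesis using q.p_diff_ge[OF yz(1,2)] by simp
    qed
    then obtain r where r: "cstar_seminorm P.E r" "\<And>y. y \<in> carrier ?F \<Longrightarrow> r (\<Phi> y) = ?q y"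
      using seminorm_descends[OF free_star_algebra E \<Phi>(1) \<Phi>_surj cq] by blast
    then show "?q x \<le> P.full_norm (\<Phi> x)" using P.full_norm_upper[OF r(1) \<Phi>D(1)[OF x]] x by simp
  qed
  obtain \<Lambda> where \<Lambda>: "\<Lambda> \<in> star_hom P.E Q" "\<And>i. \<Lambda> (basis_elem (\<gamma> i)) = Q.V i"
    using group_alg_to_quotient by blast
  note eh = star_hom_comp[OF quantum_perm_emb J.rcos_star_hom]
  have "\<Lambda> (\<Phi> x) = J +>\<^bsub>A\<^esub> ?e x" if x: "x \<in> carrier ?F" for x
  proof (rule free_star_hom_eqI[OF Q.star_algebra_axioms star_hom_comp[OF \<Phi>(1) \<Lambda>(1)] eh _ x])
    fix kl :: "'n \<times> 'n"
    obtain k l where kl: "kl = (k, l)" by (cases kl)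
    have "\<Lambda> (\<Phi> (indet kl)) = lincomb Q UNIV (\<lambda>m. U $ m $ l * cnj (U $ m $ k)) (\<lambda>m. \<Lambda> (basis_elem (\<gamma> m)))"
      unfolding kl \<Phi>(2) P_unitaries.u_def
      by (rule star_hom_lincomb[OF E Q.star_algebra_axioms \<Lambda>(1) P_unitaries.V_image])
    also have "\<dots> = v k l" unfolding \<Lambda>(2) by (rule Q.u_expand[symmetric])
    finally show "\<Lambda> (\<Phi> (indet kl)) = J +>\<^bsub>A\<^esub> ?e (indet kl)" by (simp add: kl quantum_perm_alg_eq(2))
  qed
  note \<Lambda>\<Phi> = this
  have KJ: "?e x \<in> J" if x: "x \<in> carrier ?F" "\<Phi> x = \<zero>\<^bsub>P.E\<^esub>" for x
  proof -
    have "J +>\<^bsub>A\<^esub> ?e x = \<Lambda> \<zero>\<^bsub>P.E\<^esub>" using \<Lambda>\<Phi>[OF x(1)] x(2) by argo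
    also have "\<dots> = J" unfolding star_hom_zero[OF E Q.star_algebra_axioms \<Lambda>(1)] by (rule J.quotient_zero)
    finally show ?thesis
      using A.rcos_zero_iff[OF J.is_ideal star_homD(1)[OF quantum_perm_emb x(1)]] by blast
  qed
  let ?S = "{conj_entry ?F ?x U i j |i j. i \<noteq> j}"
  have emb_conj: "?e (conj_entry ?F ?x U i j) = conj_coeff A quantum_perm_gen U i j" for i j
    unfolding star_hom_conj_entry[OF free_star_algebra quantum_perm_star_algebra quantum_perm_emb indet_closed]
      quantum_perm_alg_eq(2)[symmetric]
    by (rule conj_coeff_eq[OF A.star_algebra_axioms A.u_closed, symmetric])
  have J: "J = generated_ideal (completion ?F magic_norm) (?e ` ?S)"
    unfolding diag_ideal_def quantum_perm_alg_eq(1)[symmetric]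
    by (rule arg_cong[where f = "generated_ideal A"]) (auto simp: emb_conj[symmetric] image_iff)
  have "\<exists>\<phi>\<in>star_iso (completion P.E P.full_norm) (quotient_alg (completion ?F magic_norm) J).
    \<forall>x\<in>carrier ?F. \<phi> (completion_emb P.E P.full_norm (\<Phi> x)) = J +>\<^bsub>completion ?F magic_norm\<^esub> ?e x"
    by (rule completion_quotient_iso[OF free.cstar_seminormed_axioms P.full.cstar_seminormed_axioms \<Phi>(1) \<Phi>_surj q _ _ J KJ])
       (auto simp: xc \<Phi>_conj)
  then obtain \<phi> where \<phi>: "\<phi> \<in> star_iso (group_cstar P) Q"
    "\<And>x. x \<in> carrier ?F \<Longrightarrow> \<phi> (completion_emb P.E P.full_norm (\<Phi> x)) = J +>\<^bsub>A\<^esub> ?e x"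
    unfolding P.group_cstar_eq quantum_perm_alg_eq(1)[symmetric] by blast
  have "\<phi> (group_cstar_elem P (\<gamma> i)) = J +>\<^bsub>A\<^esub> conj_coeff A quantum_perm_gen U i i" for i
    using \<phi>(2)[OF xc[of i i]] by (simp add: \<Phi>_conj emb_conj P.group_cstar_eq)
  moreover have "range \<gamma> \<subseteq> carrier P" by (auto simp: presented_gen_closed)
  moreover have "generate P (range \<gamma>) = carrier P"
    using P.generate_word_eval[OF \<open>range \<gamma> \<subseteq> carrier P\<close>] by (simp add: presented_word_eval presented_carrier)
  ultimately show ?thesis unfolding is_diag_group_def using \<phi>(1) P.is_group by blast
qed

text \<open>
  By injectivity of \<open>\<Gamma> \<rightarrow> C\<^sup>*(\<Gamma>)\<close>, an equation between words in the generators of \<open>\<Gamma>\<close> can be checked in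
  \<open>C\<^sup>*(\<Gamma>)\<close>, hence in the quotient algebra, which does not depend on \<open>\<Gamma>\<close>.
\<close>

lemma diag_group_word_eq_iff:
  fixes \<Gamma> :: "('g, 'm) monoid_scheme"
  assumes \<Gamma>: "is_diag_group quantum_perm_alg quantum_perm_gen U \<Gamma> g"
  shows "word_eval \<Gamma> (m_inv \<Gamma>) g s = word_eval \<Gamma> (m_inv \<Gamma>) g t \<longleftrightarrow>
    word_eval Q (adj Q) (\<lambda>i. J +>\<^bsub>A\<^esub> conj_coeff A quantum_perm_gen U i i) s =
    word_eval Q (adj Q) (\<lambda>i. J +>\<^bsub>A\<^esub> conj_coeff A quantum_perm_gen U i i) t"
proof -
  interpret G: group_star_algebra \<Gamma> using \<Gamma> by (simp add: group_star_algebra_def is_diag_group_def)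
  have g: "range g \<subseteq> carrier \<Gamma>" using \<Gamma> by (simp add: is_diag_group_def)
  obtain \<phi> where \<phi>: "\<phi> \<in> star_iso (group_cstar \<Gamma>) Q"
    "\<And>i. \<phi> (group_cstar_elem \<Gamma> (g i)) = J +>\<^bsub>A\<^esub> conj_coeff A quantum_perm_gen U i i"
    using \<Gamma> unfolding is_diag_group_def by blast
  have hom: "\<phi> \<in> star_hom (group_cstar \<Gamma>) Q" and inj: "inj_on \<phi> (carrier (group_cstar \<Gamma>))"
    using \<phi>(1) by (auto simp: star_iso_def star_hom_def ring_iso_def bij_betw_def)
  have wc: "word_eval \<Gamma> (m_inv \<Gamma>) g u \<in> carrier \<Gamma>" for u by (rule G.I.word_eval_closed[OF g])
  have "word_eval \<Gamma> (m_inv \<Gamma>) g s = word_eval \<Gamma> (m_inv \<Gamma>) g t \<longleftrightarrow>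
      \<phi> (group_cstar_elem \<Gamma> (word_eval \<Gamma> (m_inv \<Gamma>) g s)) = \<phi> (group_cstar_elem \<Gamma> (word_eval \<Gamma> (m_inv \<Gamma>) g t))"
    using G.group_cstar_elem_inj[OF wc wc] inj_onD[OF inj] G.group_cstar_elem_closed[OF wc] by metis
  then show ?thesis
    by (simp only: G.group_cstar_word[OF J.quotient_star_algebra hom g] \<phi>(2))
qed

end

theorem theorem5p3:
  fixes U :: "complex ^ 'n ^ 'n"
    and \<Gamma> :: "('g, 'm) monoid_scheme"
    and g :: "'n \<Rightarrow> 'g"
  assumes "unitary_matrix U"
  shows "is_diag_group quantum_perm_alg quantum_perm_gen U
           (presented_group (diag_relations U)) (presented_gen (diag_relations U)) \<and>
         (is_diag_group quantum_perm_alg quantum_perm_gen U \<Gamma> g \<longrightarrow>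
           (\<exists>h \<in> iso (presented_group (diag_relations U)) \<Gamma>.
              \<forall>i. h (presented_gen (diag_relations U) i) = g i))"
proof (intro conjI impI)
  interpret unitary U by unfold_locales (rule assms)
  show diag: "is_diag_group quantum_perm_alg quantum_perm_gen U P \<gamma>" by (rule presented_is_diag_group)
  assume \<Gamma>: "is_diag_group quantum_perm_alg quantum_perm_gen U \<Gamma> g"
  interpret G: group_star_algebra \<Gamma> using \<Gamma> by (simp add: group_star_algebra_def is_diag_group_def)
  have g: "range g \<subseteq> carrier \<Gamma>" using \<Gamma> by (simp add: is_diag_group_def)
  let ?c = "cls (diag_relations U)" and ?w = "word_eval \<Gamma> (m_inv \<Gamma>) g"
  have eq: "?c v = ?c w \<longleftrightarrow> ?w v = ?w w" for v w
    using diag_group_word_eq_iff[OF \<Gamma>] diag_group_word_eq_iff[OF diag]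
    unfolding presented_word_eval by blast
  \<comment> \<open>evaluation of a representing word\<close>
  define h where "h X = ?w (SOME w. ?c w = X)" for X
  have h: "h (?c w) = ?w w" for w
  proof -
    have "?c (SOME v. ?c v = ?c w) = ?c w" by (rule someI[of _ w]) simp
    then show ?thesis unfolding h_def using eq by blast
  qed
  have "h \<in> hom P \<Gamma>"
    by (rule homI) (auto simp: presented_carrier presented_mult h G.I.word_eval_closed[OF g] G.I.word_eval_append[OF g])
  moreover have "inj_on h (carrier P)"
  proof (rule inj_onI)
    fix X Y assume "X \<in> carrier P" "Y \<in> carrier P" and hXY: "h X = h Y"
    then obtain v w where X: "X = ?c v" and Y: "Y = ?c w" by (auto simp: presented_carrier)
    show "X = Y" using hXY unfolding X Y h eq .
  qed
  moreover have "h ` carrier P = carrier \<Gamma>"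
    using \<Gamma> G.generate_word_eval[OF g] by (simp add: presented_carrier image_image h is_diag_group_def)
  ultimately have "h \<in> iso P \<Gamma>" by (simp add: iso_def bij_betw_def)
  moreover have "h (\<gamma> i) = g i" for i
    using h[of "[(i, False)]"] g by (simp add: presented_gen_def image_subset_iff)
  ultimately show "\<exists>h \<in> iso P \<Gamma>. \<forall>i. h (\<gamma> i) = g i" by blast
qed

end
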